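(* Let $n \geq 1$ and $\lambda \vdash n$. For all $r \in \mathbb{Z}/n$, $$\frac{a_{\lambda,r}}{f^\lambda} = \frac{1}{n} + \frac{1}{n} \sum_{\substack{\ell \mid n \\ \ell \neq 1}} \frac{\chi^\lambda(\ell^{n/\ell})}{f^\lambda}\, c_\ell(r),$$ where the sum is over positive divisors $\ell \neq 1$ of $n$ and $$c_\ell(r) = \mu\left(\frac{\ell}{\gcd(\ell,r)}\right) \frac{\phi(\ell)}{\phi(\ell/\gcd(\ell,r))},$$ with $\mu$ the classical Möbius function and $\phi$ Euler's totient function.
   Context: $\lambda \vdash n$ means that $\lambda$ is an integer partition of $n$. A standard Young tableau of shape $\lambda \vdash n$ is a filling of the Young diagram of $\lambda$ with $1,\ldots,n$, each used once, increasing along rows and along columns going away from the corner cell; $\operatorname{SYT}(\lambda)$ is the set of these. A descent of $T$ is an $i \in \{1,\ldots,n-1\}$ such that $i+1$ lies in a row of strictly larger index than the row of $i$ (the $j$th row has $\lambda_j$ cells), and $\operatorname{maj} T$ is the sum of the descents of $T$. $a_{\lambda,r} = \#\{T \in \operatorname{SYT}(\lambda) : \operatorname{maj} T \equiv r \pmod n\}$. $\chi^\lambda(\nu)$ is the value of the irreducible character of $S_n$ indexed by $\lambda$ (the character of the Specht module $S^\lambda$) at a permutation of cycle type $\nu$; $f^\lambda = \chi^\lambda(1^n) = \dim S^\lambda = \#\operatorname{SYT}(\lambda)$. The partition $\ell^{n/\ell} = (\ell,\ldots,\ell)$ has $n/\ell$ parts equal to $\ell$. The number $c_\ell(r)$ is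 a Ramanujan sum; since $\ell \mid n$, $\gcd(\ell,r)$ depends only on $r$ mod $n$. *)

theory Defs
  imports
    Complex_Main
    "HOL-Library.FuncSet"
    "HOL-Library.Multiset"
    "HOL-Library.Function_Algebras"
    "HOL-Combinatorics.Permutations"
    "HOL-Combinatorics.Orbits"
    "HOL-Computational_Algebra.Squarefree"
    "HOL-Number_Theory.Cong"
    "HOL-Number_Theory.Totient"
begin

section \<open>Partitions and tableaux\<close>

definition int_partition :: "nat list \<Rightarrow> nat \<Rightarrow> bool" where
  "int_partition lam n \<longleftrightarrow> sorted_wrt (\<ge>) lam \<and> 0 \<notin> set lam \<and> sum_list lam = n"

text \<open>Cells are pairs (row, column), both counted from 0, with the corner cell at (0, 0).\<close>

definition diagram :: "nat list \<Rightarrow> (nat \<times> nat) set" where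
  "diagram lam = {(i, j). i < length lam \<and> j < lam ! i}"

definition tableaux :: "nat list \<Rightarrow> (nat \<times> nat \<Rightarrow> nat) set" where
  "tableaux lam = {T \<in> extensional (diagram lam). bij_betw T (diagram lam) {1..sum_list lam}}"

definition SYT :: "nat list \<Rightarrow> (nat \<times> nat \<Rightarrow> nat) set" where
  "SYT lam = {T \<in> tableaux lam.
     (\<forall>i j j'. (i, j) \<in> diagram lam \<and> (i, j') \<in> diagram lam \<and> j < j' \<longrightarrow> T (i, j) < T (i, j')) \<and>
     (\<forall>i i' j. (i, j) \<in> diagram lam \<and> (i', j) \<in> diagram lam \<and> i < i' \<longrightarrow> T (i, j) < T (i', j))}"

definition row_of :: "nat list \<Rightarrow> (nat \<times> nat \<Rightarrow> nat) \<Rightarrow> nat \<Rightarrow> nat" where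
  "row_of lam T k = fst (inv_into (diagram lam) T k)"

definition descents :: "nat list \<Rightarrow> (nat \<times> nat \<Rightarrow> nat) \<Rightarrow> nat set" where
  "descents lam T = {i. 1 \<le> i \<and> i < sum_list lam \<and> row_of lam T i < row_of lam T (i + 1)}"

definition maj :: "nat list \<Rightarrow> (nat \<times> nat \<Rightarrow> nat) \<Rightarrow> nat" where
  "maj lam T = \<Sum> (descents lam T)"

text \<open>Here and in the Ramanujan sum below, a residue class is given by any integer
  representative \<open>r\<close>.\<close>

definition maj_count :: "nat list \<Rightarrow> int \<Rightarrow> nat" where
  "maj_count lam r = card {T \<in> SYT lam. [int (maj lam T) = r] (mod int (sum_list lam))}"

section \<open>Specht modules over the complex numbers\<close>

text \<open>A tabloid (a tableau up to reordering within rows) is the list of the sets of entries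
  of its rows.\<close>

definition tabloid :: "nat list \<Rightarrow> (nat \<times> nat \<Rightarrow> nat) \<Rightarrow> nat set list" where
  "tabloid lam t = map (\<lambda>i. t ` {c \<in> diagram lam. fst c = i}) [0..<length lam]"

definition tabloid_perm :: "(nat \<Rightarrow> nat) \<Rightarrow> nat set list \<Rightarrow> nat set list" where
  "tabloid_perm \<sigma> X = map ((`) \<sigma>) X"

definition column_stabilizer :: "nat list \<Rightarrow> (nat \<times> nat \<Rightarrow> nat) \<Rightarrow> (nat \<Rightarrow> nat) set" where
  "column_stabilizer lam t = {\<pi>. \<pi> permutes {1..sum_list lam} \<and>
     (\<forall>j. \<pi> ` (t ` {c \<in> diagram lam. snd c = j}) = t ` {c \<in> diagram lam. snd c = j})}"

text \<open>Linear combinations of tabloids are represented by their coefficient functions.\<close>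

type_synonym tabloid_vec = "nat set list \<Rightarrow> complex"

definition vec_scale :: "complex \<Rightarrow> ('a \<Rightarrow> complex) \<Rightarrow> ('a \<Rightarrow> complex)" where
  "vec_scale c v = (\<lambda>x. c * v x)"

interpretation fun_space: vector_space vec_scale
  by unfold_locales (auto simp: vec_scale_def fun_eq_iff algebra_simps)

definition basis_vec :: "'a \<Rightarrow> ('a \<Rightarrow> complex)" where
  "basis_vec x = (\<lambda>y. if y = x then 1 else 0)"

definition polytabloid :: "nat list \<Rightarrow> (nat \<times> nat \<Rightarrow> nat) \<Rightarrow> tabloid_vec" where
  "polytabloid lam t = (\<Sum>\<pi>\<in>column_stabilizer lam t.
     vec_scale (of_int (sign \<pi>)) (basis_vec (tabloid_perm \<pi> (tabloid lam t))))"

definition specht_module :: "nat list \<Rightarrow> tabloid_vec set" where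
  "specht_module lam = fun_space.span (polytabloid lam ` tableaux lam)"

text \<open>The linear action with \<open>\<sigma> \<cdot> basis_vec X = basis_vec (tabloid_perm \<sigma> X)\<close>; on coefficient
  functions this is precomposition with the inverse.\<close>

definition perm_action :: "(nat \<Rightarrow> nat) \<Rightarrow> tabloid_vec \<Rightarrow> tabloid_vec" where
  "perm_action \<sigma> v = (\<lambda>X. v (tabloid_perm (inv \<sigma>) X))"

lemma perm_action_basis_vec:
  assumes "bij \<sigma>"
  shows "perm_action \<sigma> (basis_vec X) = basis_vec (tabloid_perm \<sigma> X)"
proof -
  have "tabloid_perm (inv \<sigma>) Y = X \<longleftrightarrow> Y = tabloid_perm \<sigma> X" for Y
    using assms unfolding tabloid_perm_def
    by (auto simp: image_comp comp_def bij_def surj_f_inv_f intro!: map_idI)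
  then show ?thesis
    by (auto simp: perm_action_def basis_vec_def)
qed

text \<open>Trace of a linear endomorphism \<open>f\<close> of a finite-dimensional subspace \<open>S\<close>: the sum of the
  diagonal entries of its matrix with respect to a basis of \<open>S\<close>.\<close>

definition trace_on :: "('a \<Rightarrow> complex) set \<Rightarrow> (('a \<Rightarrow> complex) \<Rightarrow> ('a \<Rightarrow> complex)) \<Rightarrow> complex" where
  "trace_on S f =
     (let B = (SOME B. fun_space.independent B \<and> fun_space.span B = S)
      in \<Sum>b\<in>B. fun_space.representation B (f b) b)"

definition cycle_type :: "nat \<Rightarrow> (nat \<Rightarrow> nat) \<Rightarrow> nat multiset" where
  "cycle_type n \<sigma> = image_mset card (mset_set (orbit \<sigma> ` {1..n}))"

definition specht_char :: "nat list \<Rightarrow> nat list \<Rightarrow> complex" where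
  "specht_char lam \<nu> = trace_on (specht_module lam) (perm_action
     (SOME \<sigma>. \<sigma> permutes {1..sum_list lam} \<and> cycle_type (sum_list lam) \<sigma> = mset \<nu>))"

definition specht_degree :: "nat list \<Rightarrow> complex" where
  "specht_degree lam = specht_char lam (replicate (sum_list lam) 1)"

section \<open>Ramanujan sums\<close>

definition moebius :: "nat \<Rightarrow> int" where
  "moebius m = (if squarefree m then (-1) ^ card (prime_factors m) else 0)"

definition ramanujan_sum :: "nat \<Rightarrow> int \<Rightarrow> complex" where
  "ramanujan_sum l r =
     (let m = l div nat (gcd (int l) r)
      in of_int (moebius m) * (of_nat (totient l) / of_nat (totient m)))"

end

theory Submission
  imports Defs "HOL-Analysis.Infinite_Set_Sum" "HOL-Analysis.Complex_Transcendental"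
begin

text \<open>
  Let \<open>F q\<close> be the sum of \<open>q ^ maj T\<close> over the standard tableaux \<open>T\<close> of shape \<open>\<lambda>\<close>. By Fourier inversion
  on the integers modulo \<open>n\<close>, the number of tableaux with major index congruent to \<open>r\<close> is a combination of
  the values of \<open>F\<close> at the \<open>n\<close>-th roots of unity (\<open>maj_count_expansion\<close>). The theorem therefore says two
  things: at a primitive \<open>l\<close>-th root of unity, \<open>F\<close> takes the value of the character of the Specht module
  at a permutation all of whose cycles have length \<open>l\<close> (\<open>maj_sum_eq_specht_char\<close>); and the sum of the
  \<open>r\<close>-th powers of all primitive \<open>l\<close>-th roots of unity is given by Hoelder's formula
  (\<open>sum_totatives_eq_ramanujan_sum\<close>).

  The first fact comes from counting, in two ways, the graded multiplicity of the Specht module in the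
  polynomial ring in \<open>n\<close> variables, the monomials being words \<open>{1..n} \<rightarrow> \<nat>\<close> graded by their sum. A
  computation with traces (\<open>trace_fixed_words\<close>) expresses the multiplicity by characters and numbers of
  fixed words, which factor over the cycles of a permutation. On the other hand the homomorphisms
  from the Specht module to a permutation representation on words are in bijection with functions
  on the column-strict plane partitions of shape \<open>\<lambda>\<close> among these words (\<open>specht_fixed_words\<close>). This is
  the argument of James: Garnir relations and column antisymmetry show that a homomorphism is determined
  by these coefficients, and the semistandard homomorphisms realize all of them. Standardization
  splits a column-strict plane partition into a standard tableau \<open>T\<close> and a decreasing sequence that
  is strict at the descents of \<open>T\<close> (\<open>bij_fill\<close>). The outcome is the identity \<open>major_index_identity\<close>,
  for \<open>norm q < 1\<close>, between the sum over all permutations \<open>\<sigma>\<close> of \<open>\<chi>(\<sigma>)\<close> divided by the product of \<open>1 - q ^ c\<close>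
  over the cycle lengths \<open>c\<close> of \<open>\<sigma>\<close>, and \<open>n!\<close> times \<open>F q\<close> divided by the product of all \<open>1 - q ^ i\<close>, \<open>i \<le> n\<close>.

  When \<open>q\<close> tends to a primitive \<open>l\<close>-th root of unity, the denominator on the right has a zero of order
  \<open>n / l\<close>, and only permutations with all cycles of length \<open>l\<close> have a pole of the same order on the left
  (\<open>maj_sum_at_root\<close>). These form one conjugacy class, on which the character is constant; the
  remaining numerical factor is found by applying the same result to the partition with a single part,
  where \<open>F\<close> and the character are both 1.
\<close>

declare One_nat_def [simp del]

hide_const (open) Finite_Cartesian_Product.transpose Complex_Transcendental.moebius
hide_fact (open) Finite_Cartesian_Product.transpose_def Complex_Transcendental.moebius_def

section \<open>Traces and intertwiners\<close>

lemma sum_fun_apply: "(\<Sum>i\<in>I. f i) x = (\<Sum>i\<in>I. (f i x :: 'b :: comm_monoid_add))"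
  by (induction I rule: infinite_finite_induct) auto

lemma sum_rotate3:
  "(\<Sum>a\<in>A. \<Sum>b\<in>B. \<Sum>c\<in>C. f a b c) = (\<Sum>c\<in>C. \<Sum>a\<in>A. \<Sum>b\<in>B. f a b c)"
proof -
  have "(\<Sum>a\<in>A. \<Sum>b\<in>B. \<Sum>c\<in>C. f a b c) = (\<Sum>a\<in>A. \<Sum>c\<in>C. \<Sum>b\<in>B. f a b c)"
    by (intro sum.cong refl sum.swap)
  also have "\<dots> = (\<Sum>c\<in>C. \<Sum>a\<in>A. \<Sum>b\<in>B. f a b c)" by (rule sum.swap)
  finally show ?thesis .
qed

text \<open>A representation of the symmetric group of \<open>A\<close> on a finite-dimensional space \<open>S\<close> of
  functions; the laws are only required where they are meaningful, for permutations of \<open>A\<close> and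
  vectors of \<open>S\<close>.\<close>

locale permutation_rep =
  fixes A :: "'k set" and S :: "('a \<Rightarrow> complex) set"
    and act :: "('k \<Rightarrow> 'k) \<Rightarrow> ('a \<Rightarrow> complex) \<Rightarrow> ('a \<Rightarrow> complex)"
  assumes finite_points: "finite A"
    and subspace: "fun_space.subspace S"
    and finite_dim: "\<exists>F. finite F \<and> S \<subseteq> fun_space.span F"
    and act_closed: "g permutes A \<Longrightarrow> v \<in> S \<Longrightarrow> act g v \<in> S"
    and act_add: "g permutes A \<Longrightarrow> u \<in> S \<Longrightarrow> v \<in> S \<Longrightarrow> act g (u + v) = act g u + act g v"
    and act_scale: "g permutes A \<Longrightarrow> v \<in> S \<Longrightarrow> act g (vec_scale c v) = vec_scale c (act g v)"
    and act_comp: "g permutes A \<Longrightarrow> \<tau> permutes A \<Longrightarrow> v \<in> S \<Longrightarrow> act (g \<circ> \<tau>) v = act g (act \<tau> v)"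
    and act_id: "v \<in> S \<Longrightarrow> act id v = v"
begin

definition basis :: "('a \<Rightarrow> complex) set" where
  "basis = (SOME B. fun_space.independent B \<and> fun_space.span B = S)"

abbreviation coord :: "('a \<Rightarrow> complex) \<Rightarrow> ('a \<Rightarrow> complex) \<Rightarrow> complex" where
  "coord \<equiv> fun_space.representation basis"

lemma basis: "fun_space.independent basis" "fun_space.span basis = S"
proof -
  obtain B where "B \<subseteq> S" "fun_space.independent B" "S \<subseteq> fun_space.span B"
    using fun_space.maximal_independent_subset by blast
  then have "fun_space.independent B \<and> fun_space.span B = S"
    using fun_space.span_minimal[OF _ subspace] by blast
  then have "fun_space.independent basis \<and> fun_space.span basis = S"
    unfolding basis_def by (rule someI)
  then show "fun_space.independent basis" "fun_space.span basis = S" by auto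
qed

lemma finite_basis: "finite basis"
  using finite_dim fun_space.independent_span_bound[OF _ basis(1)] fun_space.span_superset[of basis]
  by (metis basis(2) subset_trans)

lemma basis_subset: "b \<in> basis \<Longrightarrow> b \<in> S"
  using basis(2) fun_space.span_superset by blast

lemma trace_eq: "trace_on S f = (\<Sum>b\<in>basis. coord (f b) b)"
  unfolding trace_on_def basis_def[symmetric] Let_def by simp

lemma zero_mem: "0 \<in> S"
  using subspace by (rule fun_space.subspace_0)

lemma sum_mem: "(\<And>i. i \<in> I \<Longrightarrow> f i \<in> S) \<Longrightarrow> (\<Sum>i\<in>I. f i) \<in> S"
  using subspace by (rule fun_space.subspace_sum)

lemma scale_mem: "v \<in> S \<Longrightarrow> vec_scale c v \<in> S"
  using subspace by (rule fun_space.subspace_scale)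

lemma coord_add: "u \<in> S \<Longrightarrow> v \<in> S \<Longrightarrow> coord (u + v) b = coord u b + coord v b"
  using fun_space.representation_add[OF basis(1)] basis(2) by simp

lemma coord_scale: "v \<in> S \<Longrightarrow> coord (vec_scale c v) b = c * coord v b"
  using fun_space.representation_scale[OF basis(1)] basis(2) by simp

lemma sum_coord: "v \<in> S \<Longrightarrow> (\<Sum>b\<in>basis. vec_scale (coord v b) b) = v"
  using fun_space.sum_representation_eq[OF basis(1)] basis(2) finite_basis by auto

definition linear_on :: "(('a \<Rightarrow> complex) \<Rightarrow> complex) \<Rightarrow> bool" where
  "linear_on \<theta> \<longleftrightarrow> (\<forall>u\<in>S. \<forall>v\<in>S. \<theta> (u + v) = \<theta> u + \<theta> v) \<and>
     (\<forall>c. \<forall>v\<in>S. \<theta> (vec_scale c v) = c * \<theta> v)"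

lemma linear_on_sum:
  assumes "linear_on \<theta>" "\<And>i. i \<in> I \<Longrightarrow> f i \<in> S"
  shows "\<theta> (\<Sum>i\<in>I. f i) = (\<Sum>i\<in>I. \<theta> (f i))"
proof -
  have "\<theta> 0 = 0"
  proof -
    have "\<theta> (vec_scale 0 0) = 0"
      using assms(1) zero_mem unfolding linear_on_def by (metis mult_zero_left)
    then show ?thesis by simp
  qed
  with assms(2) show ?thesis
  proof (induction I rule: infinite_finite_induct)
    case (insert i I)
    have "(\<Sum>i\<in>I. f i) \<in> S" using insert by (intro sum_mem) auto
    then have "\<theta> (f i + (\<Sum>i\<in>I. f i)) = \<theta> (f i) + \<theta> (\<Sum>i\<in>I. f i)"
      using insert.prems assms(1) unfolding linear_on_def by blast
    moreover have "\<theta> (\<Sum>i\<in>I. f i) = (\<Sum>i\<in>I. \<theta> (f i))" using insert by blast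
    ultimately show ?case unfolding sum.insert[OF insert.hyps] by (simp only:)
  qed (simp_all only: sum.infinite sum.empty simp_thms)
qed

lemma linear_on_expand:
  assumes "linear_on \<theta>" "v \<in> S"
  shows "\<theta> v = (\<Sum>b\<in>basis. coord v b * \<theta> b)"
proof -
  have "\<theta> v = \<theta> (\<Sum>b\<in>basis. vec_scale (coord v b) b)" by (simp add: sum_coord assms)
  also have "\<dots> = (\<Sum>b\<in>basis. \<theta> (vec_scale (coord v b) b))"
    by (intro linear_on_sum assms scale_mem basis_subset)
  also have "\<dots> = (\<Sum>b\<in>basis. coord v b * \<theta> b)"
    using assms(1) basis_subset unfolding linear_on_def by simp
  finally show ?thesis .
qed

lemma linear_on_coord: "linear_on (\<lambda>v. coord v b)"
  by (simp add: linear_on_def coord_add coord_scale)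

lemma linear_on_act: "linear_on \<theta> \<Longrightarrow> g permutes A \<Longrightarrow> linear_on (\<lambda>v. \<theta> (act g v))"
  by (auto simp: linear_on_def act_add act_scale act_closed)

lemma linear_on_lincomb:
  "(\<And>i. i \<in> I \<Longrightarrow> linear_on (\<theta> i)) \<Longrightarrow> linear_on (\<lambda>v. \<Sum>i\<in>I. c i * \<theta> i v)"
  by (auto simp: linear_on_def sum.distrib sum_distrib_left algebra_simps intro!: sum.cong)

lemma linear_on_diff: "linear_on \<theta> \<Longrightarrow> linear_on \<eta> \<Longrightarrow> linear_on (\<lambda>v. \<theta> v - \<eta> v)"
  by (auto simp: linear_on_def algebra_simps)

text \<open>The functions on \<open>X\<close> carry the permutation representation in which \<open>g\<close> moves the word
  \<open>x\<close> to \<open>x \<circ> inv g\<close>. An intertwiner is a homomorphism from \<open>S\<close> to this representation; it is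
  only inspected on \<open>S\<close> and at words of \<open>X\<close>.\<close>

definition intertwiner :: "('k \<Rightarrow> 'b) set \<Rightarrow> (('a \<Rightarrow> complex) \<Rightarrow> ('k \<Rightarrow> 'b) \<Rightarrow> complex) \<Rightarrow> bool" where
  "intertwiner X \<Theta> \<longleftrightarrow> (\<forall>x\<in>X. linear_on (\<lambda>v. \<Theta> v x)) \<and>
     (\<forall>g. g permutes A \<longrightarrow> (\<forall>v\<in>S. \<forall>x\<in>X. \<Theta> (act g v) x = \<Theta> v (x \<circ> g)))"

lemma intertwiner_diff_lincomb:
  assumes "intertwiner X E" "\<And>i. i \<in> I \<Longrightarrow> intertwiner X (\<Theta> i)"
  shows "intertwiner X (\<lambda>v x. E v x - (\<Sum>i\<in>I. c i * \<Theta> i v x))"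
  using assms unfolding intertwiner_def by (auto intro!: linear_on_diff linear_on_lincomb)

text \<open>Gaussian elimination: the duals of the words of smaller rank are subtracted from
  \<open>\<Theta> T\<close>.\<close>

lemma intertwiner_dual_basis:
  fixes rank :: "('k \<Rightarrow> 'b) \<Rightarrow> nat"
  assumes "finite K"
    and "\<And>T. T \<in> K \<Longrightarrow> intertwiner X (\<Theta> T)"
    and one: "\<And>T. T \<in> K \<Longrightarrow> \<Theta> T e T = 1"
    and tri: "\<And>T U. T \<in> K \<Longrightarrow> U \<in> K \<Longrightarrow> U \<noteq> T \<Longrightarrow> \<Theta> T e U \<noteq> 0 \<Longrightarrow> rank U < rank T"
    and "T \<in> K"
  shows "\<exists>\<Psi>. intertwiner X \<Psi> \<and> (\<forall>U\<in>K. \<Psi> e U = (if U = T then 1 else 0))"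
  using \<open>T \<in> K\<close>
proof (induction T rule: measure_induct_rule[of rank])
  case (less T)
  define K' where "K' = {U \<in> K. rank U < rank T}"
  have fin: "finite K'" using assms(1) by (simp add: K'_def)
  obtain \<Psi> where \<Psi>: "\<And>U. U \<in> K' \<Longrightarrow> intertwiner X (\<Psi> U)"
      "\<And>U V. U \<in> K' \<Longrightarrow> V \<in> K \<Longrightarrow> \<Psi> U e V = (if V = U then 1 else 0)"
    using less.IH unfolding K'_def mem_Collect_eq by metis
  define \<Psi>' where "\<Psi>' v x = \<Theta> T v x - (\<Sum>U\<in>K'. \<Theta> T e U * \<Psi> U v x)" for v x
  have "intertwiner X \<Psi>'"
    unfolding \<Psi>'_def using assms(2) less.prems by (intro intertwiner_diff_lincomb \<Psi>(1))
  moreover have "\<Psi>' e V = (if V = T then 1 else 0)" if V: "V \<in> K" for V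
  proof -
    have "(\<Sum>U\<in>K'. \<Theta> T e U * \<Psi> U e V) = (if V \<in> K' then \<Theta> T e V else 0)"
      using fin V \<Psi>(2) by (simp add: if_distrib[of "\<lambda>z. \<Theta> T e _ * z"] cong: if_cong)
    then show ?thesis
      using one[OF less.prems] tri[OF less.prems V] V unfolding \<Psi>'_def K'_def by auto
  qed
  ultimately show ?case by blast
qed

lemma trace_id: "trace_on S (act id) = of_nat (card basis)"
  by (simp add: trace_eq act_id basis_subset fun_space.representation_basis[OF basis(1)])

text \<open>The trace of a product is a double sum over matrix entries that is symmetric in the two
  factors.\<close>

lemma trace_conjugate:
  assumes "g permutes A" "\<tau> permutes A"
  shows "trace_on S (act (\<tau> \<circ> g \<circ> inv \<tau>)) = trace_on S (act g)"
proof -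
  have it: "inv \<tau> permutes A" using assms(2) by (rule permutes_inv)
  have st: "\<tau> \<circ> g permutes A" using assms by (intro permutes_compose)
  have comm: "trace_on S (act (\<alpha> \<circ> \<beta>)) = (\<Sum>b\<in>basis. \<Sum>c\<in>basis. coord (act \<beta> b) c * coord (act \<alpha> c) b)"
    if "\<alpha> permutes A" "\<beta> permutes A" for \<alpha> \<beta>
  proof -
    have "coord (act (\<alpha> \<circ> \<beta>) b) b = (\<Sum>c\<in>basis. coord (act \<beta> b) c * coord (act \<alpha> c) b)"
      if b: "b \<in> basis" for b
      using linear_on_expand[OF linear_on_act[OF linear_on_coord \<open>\<alpha> permutes A\<close>], of "act \<beta> b" b]
        act_comp act_closed basis_subset b \<open>\<alpha> permutes A\<close> \<open>\<beta> permutes A\<close> by simp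
    then show ?thesis by (simp add: trace_eq)
  qed
  have "trace_on S (act (\<tau> \<circ> g \<circ> inv \<tau>)) = trace_on S (act (inv \<tau> \<circ> (\<tau> \<circ> g)))"
    unfolding comm[OF st it] comm[OF it st] by (subst sum.swap) (simp add: mult.commute)
  also have "inv \<tau> \<circ> (\<tau> \<circ> g) = g"
    using permutes_inv_o(2)[OF assms(2)] by (simp add: comp_assoc[symmetric])
  finally show ?thesis .
qed

text \<open>The hypotheses on \<open>K\<close> say that \<open>\<Theta> \<mapsto> (\<Theta> e T)\<close>, \<open>T \<in> K\<close>, identifies the space of
  intertwiners with the functions on \<open>K\<close>, so that its dimension is \<open>card K\<close>. Averaging over the
  group projects the space of all linear maps from \<open>S\<close> to the functions on \<open>X\<close> onto the
  intertwiners, and the trace of a projection is the dimension of its image; the left side is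
  the trace, multiplied by the order of the group.\<close>

theorem trace_fixed_words:
  fixes X K :: "('k \<Rightarrow> 'b) set"
  assumes fin: "finite X" and closed: "\<And>g x. g permutes A \<Longrightarrow> x \<in> X \<Longrightarrow> x \<circ> g \<in> X"
    and K: "K \<subseteq> X" and e: "e \<in> S"
    and inj: "\<And>\<Theta> v x. intertwiner X \<Theta> \<Longrightarrow> \<forall>T\<in>K. \<Theta> e T = 0 \<Longrightarrow> v \<in> S \<Longrightarrow> x \<in> X \<Longrightarrow> \<Theta> v x = 0"
    and surj: "\<And>T. T \<in> K \<Longrightarrow> \<exists>\<Theta>. intertwiner X \<Theta> \<and> (\<forall>U\<in>K. \<Theta> e U = (if U = T then 1 else 0))"
  shows "(\<Sum>g | g permutes A. trace_on S (act g) * of_nat (card {x \<in> X. x \<circ> g = x}))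
    = fact (card A) * of_nat (card K)"
proof -
  let ?fixed = "\<lambda>g. of_nat (card {x \<in> X. x \<circ> g = x}) :: complex"
  define G where "G = {g. g permutes A}"
  have finG: "finite G" unfolding G_def by (rule finite_permutations[OF finite_points])
  have finK: "finite K" using K fin by (rule finite_subset)
  have invG: "inv g \<in> G" if "g \<in> G" for g using that by (auto simp: G_def permutes_inv)
  obtain \<Phi> where \<Phi>: "\<And>T. T \<in> K \<Longrightarrow> intertwiner X (\<Phi> T)"
      "\<And>T U. T \<in> K \<Longrightarrow> U \<in> K \<Longrightarrow> \<Phi> T e U = (if U = T then 1 else 0)"
    using surj by metis
  \<comment> \<open>\<open>E y c\<close> is the unnormalized average of the matrix unit that takes \<open>v\<close> to \<open>coord v c\<close> times the word \<open>y\<close>\<close>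
  define E where "E y c v x = (\<Sum>g\<in>G. (if x \<circ> g = y then 1 else 0) * coord (act (inv g) v) c)"
    for y :: "'k \<Rightarrow> 'b" and c v x
  have E: "intertwiner X (E y c)" for y c
    unfolding intertwiner_def
  proof (intro conjI allI impI ballI)
    fix x assume "x \<in> X"
    show "linear_on (\<lambda>v. E y c v x)"
      unfolding E_def
      by (intro linear_on_lincomb linear_on_act linear_on_coord) (auto simp: G_def permutes_inv)
  next
    fix \<tau> v x assume \<tau>: "\<tau> permutes A" and v: "v \<in> S" and "x \<in> X"
    have "E y c (act \<tau> v) x
        = (\<Sum>g\<in>G. (if x \<circ> (\<tau> \<circ> g) = y then 1 else 0) * coord (act (inv (\<tau> \<circ> g)) (act \<tau> v)) c)"
      unfolding E_def G_def
      by (rule sum.reindex_bij_witness[of _ "\<lambda>g. \<tau> \<circ> g" "\<lambda>g. inv \<tau> \<circ> g"])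
         (simp_all add: \<tau> permutes_compose permutes_inv permutes_inv_o[OF \<tau>] o_assoc)
    also have "\<dots> = E y c v (x \<circ> \<tau>)"
      unfolding E_def
    proof (intro sum.cong refl)
      fix g assume "g \<in> G"
      then have g: "g permutes A" by (simp add: G_def)
      have "act (inv (\<tau> \<circ> g)) (act \<tau> v) = act (inv (\<tau> \<circ> g) \<circ> \<tau>) v"
        using act_comp[OF permutes_inv[OF permutes_compose[OF g \<tau>]] \<tau> v] by simp
      also have "inv (\<tau> \<circ> g) \<circ> \<tau> = inv g"
        using g \<tau> by (simp add: o_inv_distrib permutes_bij comp_assoc permutes_inv_o[OF \<tau>])
      finally show "(if x \<circ> (\<tau> \<circ> g) = y then 1 else 0) * coord (act (inv (\<tau> \<circ> g)) (act \<tau> v)) c =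
          (if x \<circ> \<tau> \<circ> g = y then 1 else 0) * coord (act (inv g) v) c"
        by (simp only: comp_assoc)
    qed
    finally show "E y c (act \<tau> v) x = E y c v (x \<circ> \<tau>)" .
  qed
  have expand: "E y c v x = (\<Sum>T\<in>K. E y c e T * \<Phi> T v x)" if "v \<in> S" "x \<in> X" for y c v x
  proof -
    define D where "D v x = E y c v x - (\<Sum>T\<in>K. E y c e T * \<Phi> T v x)" for v x
    have "intertwiner X D" unfolding D_def by (intro intertwiner_diff_lincomb E \<Phi>(1))
    moreover have "\<forall>U\<in>K. D e U = 0"
      unfolding D_def using finK \<Phi>(2) by (simp add: if_distrib[of "\<lambda>z. E y c e _ * z"] cong: if_cong)
    ultimately have "D v x = 0" using inj that by blast
    then show ?thesis unfolding D_def by simp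
  qed
  \<comment> \<open>the trace of the averaging operator, computed from its definition and then from the expansion in \<open>\<Phi>\<close>\<close>
  have "(\<Sum>y\<in>X. \<Sum>c\<in>basis. E y c c y) = (\<Sum>g\<in>G. trace_on S (act (inv g)) * ?fixed g)"
  proof -
    have "(\<Sum>y\<in>X. \<Sum>c\<in>basis. E y c c y)
        = (\<Sum>g\<in>G. \<Sum>y\<in>X. \<Sum>c\<in>basis. (if y \<circ> g = y then 1 else 0) * coord (act (inv g) c) c)"
      unfolding E_def by (rule sum_rotate3)
    also have "\<dots> = (\<Sum>g\<in>G. (\<Sum>y\<in>X. if y \<circ> g = y then 1 else 0) * trace_on S (act (inv g)))"
      by (simp only: trace_eq sum_product)
    also have "\<dots> = (\<Sum>g\<in>G. of_nat (card {y \<in> X. y \<circ> g = y}) * trace_on S (act (inv g)))"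
      using fin by (simp add: sum.If_cases Int_def)
    finally show ?thesis by (simp add: mult.commute)
  qed
  moreover have "(\<Sum>y\<in>X. \<Sum>c\<in>basis. E y c c y) = fact (card A) * of_nat (card K)"
  proof -
    have "(\<Sum>y\<in>X. \<Sum>c\<in>basis. E y c c y) = (\<Sum>y\<in>X. \<Sum>c\<in>basis. \<Sum>T\<in>K. E y c e T * \<Phi> T c y)"
      using expand basis_subset by (intro sum.cong refl) auto
    also have "\<dots> = (\<Sum>T\<in>K. \<Sum>y\<in>X. \<Sum>c\<in>basis. E y c e T * \<Phi> T c y)"
      by (rule sum_rotate3)
    also have "\<dots> = (\<Sum>T\<in>K. \<Sum>g\<in>G. 1)"
    proof (intro sum.cong refl)
      fix T assume T: "T \<in> K"
      then have TX: "T \<in> X" using K by auto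
      have "(\<Sum>y\<in>X. \<Sum>c\<in>basis. E y c e T * \<Phi> T c y)
          = (\<Sum>g\<in>G. \<Sum>y\<in>X. (if y = T \<circ> g then 1 else 0) *
               (\<Sum>c\<in>basis. coord (act (inv g) e) c * \<Phi> T c y))"
        unfolding E_def sum_distrib_right sum_distrib_left
        by (subst sum_rotate3, intro sum.cong refl) auto
      also have "\<dots> = (\<Sum>g\<in>G. \<Sum>y\<in>X. if y = T \<circ> g then \<Phi> T (act (inv g) e) y else 0)"
      proof (intro sum.cong refl)
        fix g y assume "g \<in> G" "y \<in> X"
        then have "linear_on (\<lambda>v. \<Phi> T v y)" "act (inv g) e \<in> S"
          using \<Phi>(1)[OF T] e act_closed by (auto simp: intertwiner_def G_def permutes_inv)
        from linear_on_expand[OF this]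
        show "(if y = T \<circ> g then 1 else 0) * (\<Sum>c\<in>basis. coord (act (inv g) e) c * \<Phi> T c y)
            = (if y = T \<circ> g then \<Phi> T (act (inv g) e) y else 0)" by auto
      qed
      also have "\<dots> = (\<Sum>g\<in>G. 1)"
      proof (intro sum.cong refl)
        fix g assume "g \<in> G"
        then have g: "g permutes A" by (simp add: G_def)
        have "(\<Sum>y\<in>X. if y = T \<circ> g then \<Phi> T (act (inv g) e) y else 0) = \<Phi> T (act (inv g) e) (T \<circ> g)"
          using fin closed[OF g TX] by simp
        also have "\<dots> = \<Phi> T e (T \<circ> g \<circ> inv g)"
          using \<Phi>(1)[OF T] closed[OF g TX] e permutes_inv[OF g] by (auto simp: intertwiner_def)
        also have "T \<circ> g \<circ> inv g = T" using permutes_inv_o(1)[OF g] by (simp add: comp_assoc)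
        finally show "(\<Sum>y\<in>X. if y = T \<circ> g then \<Phi> T (act (inv g) e) y else 0) = 1"
          using \<Phi>(2)[OF T T] by (simp only: if_True refl)
      qed
      finally show "(\<Sum>y\<in>X. \<Sum>c\<in>basis. E y c e T * \<Phi> T c y) = (\<Sum>g\<in>G. 1)" .
    qed
    also have "\<dots> = fact (card A) * of_nat (card K)"
      using card_permutations[OF refl finite_points] by (simp add: G_def)
    finally show ?thesis .
  qed
  moreover have "(\<Sum>g\<in>G. trace_on S (act (inv g)) * ?fixed g)
      = (\<Sum>g\<in>G. trace_on S (act g) * ?fixed g)"
  proof (rule sum.reindex_bij_witness[of _ inv inv])
    fix g assume "g \<in> G"
    then have g: "g permutes A" by (simp add: G_def)
    show "inv (inv g) = g" "inv (inv g) = g" using g by (simp_all add: permutes_inv_inv)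
    show "inv g \<in> G" "inv g \<in> G" by (rule invG[OF \<open>g \<in> G\<close>])+
    have "x \<circ> inv g = x \<longleftrightarrow> x \<circ> g = x" for x :: "'k \<Rightarrow> 'b"
      using permutes_inv_o[OF g] by (metis comp_assoc comp_id)
    then show "trace_on S (act (inv g)) * of_nat (card {x \<in> X. x \<circ> inv g = x})
        = trace_on S (act (inv g)) * ?fixed g" by simp
  qed
  ultimately show ?thesis by (simp add: G_def)
qed

end

section \<open>Polytabloids and their relations\<close>

lemma sum_swap_less:
  fixes f x :: "'k \<Rightarrow> nat"
  assumes "finite A" "a \<in> A" "b \<in> A" "f a < f b" "x a < x b"
  shows "(\<Sum>k\<in>A. f k * x (transpose a b k)) < (\<Sum>k\<in>A. f k * x k)"
proof -
  have ab: "a \<noteq> b" using assms by auto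
  have split: "(\<Sum>k\<in>A. h k) = h a + h b + (\<Sum>k\<in>A - {a, b}. h k)" for h :: "'k \<Rightarrow> nat"
  proof -
    have "(\<Sum>k\<in>A. h k) = (\<Sum>k\<in>{a, b}. h k) + (\<Sum>k\<in>A - {a, b}. h k)"
      using assms by (subst sum.subset_diff[of "{a, b}"]) auto
    then show ?thesis using ab by simp
  qed
  obtain d e where d: "f b = f a + d" "d > 0" and e: "x b = x a + e" "e > 0"
    using assms(4,5) by (metis less_imp_add_positive)
  have "f a * x b + f b * x a < f a * x a + f b * x b"
    using d e by (simp add: algebra_simps)
  moreover have "(\<Sum>k\<in>A - {a, b}. f k * x (transpose a b k)) = (\<Sum>k\<in>A - {a, b}. f k * x k)"
    by (intro sum.cong) (auto simp: transpose_def)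
  ultimately show ?thesis by (subst (1 2) split) (simp add: transpose_def)
qed

lemma sum_exchange_less:
  fixes x :: "'k \<Rightarrow> nat"
  assumes fin: "finite Q" "finite R" and card: "card R = card Q" and "R \<noteq> Q"
    and less: "\<And>p q. p \<in> R - Q \<Longrightarrow> q \<in> Q \<Longrightarrow> x p < x q"
  shows "sum x R < sum x Q"
proof -
  have c: "card (R - Q) = card (Q - R)"
    using fin card by (metis card_Diff_subset_Int finite_Int inf_commute)
  then obtain h where h: "bij_betw h (R - Q) (Q - R)"
    using fin finite_same_card_bij[of "R - Q" "Q - R"] by auto
  have ne: "R - Q \<noteq> {}"
  proof
    assume "R - Q = {}"
    then have "R \<subseteq> Q" by auto
    then show False using card_subset_eq[OF fin(1)] card \<open>R \<noteq> Q\<close> by auto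
  qed
  have "sum x (R - Q) < (\<Sum>p\<in>R - Q. x (h p))"
    using fin ne h less by (intro sum_strict_mono) (auto simp: bij_betw_def)
  also have "\<dots> = sum x (Q - R)" using sum.reindex_bij_betw[OF h] .
  finally show ?thesis
    using sum.Int_Diff[OF fin(2), of x Q] sum.Int_Diff[OF fin(1), of x R] by (simp add: Int_commute)
qed

lemma permutes_image_mem:
  assumes "\<pi> permutes A"
  shows "k \<in> \<pi> ` M \<longleftrightarrow> inv \<pi> k \<in> M"
  using permutes_inverses[OF assms] by (auto intro: image_eqI[of _ _ "inv \<pi> k"])

lemma image_transpose_eq: "(a \<in> M \<longleftrightarrow> b \<in> M) \<Longrightarrow> transpose a b ` M = M"
  by (auto simp: transpose_def image_iff)

lemma tabloid_perm_comp: "tabloid_perm (\<sigma> \<circ> \<tau>) Y = tabloid_perm \<sigma> (tabloid_perm \<tau> Y)"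
  by (simp add: tabloid_perm_def image_comp)

lemma tabloid_perm_id [simp]: "tabloid_perm id Y = Y"
  by (simp add: tabloid_perm_def map_idI)

lemma perm_action_comp:
  assumes "bij \<sigma>" "bij \<tau>"
  shows "perm_action (\<sigma> \<circ> \<tau>) v = perm_action \<sigma> (perm_action \<tau> v)"
  using assms by (simp add: perm_action_def o_inv_distrib tabloid_perm_comp)

lemma perm_action_add: "perm_action \<sigma> (u + v) = perm_action \<sigma> u + perm_action \<sigma> v"
  by (simp add: perm_action_def fun_eq_iff)

lemma perm_action_scale: "perm_action \<sigma> (vec_scale c v) = vec_scale c (perm_action \<sigma> v)"
  by (simp add: perm_action_def vec_scale_def)

lemma perm_action_sum: "perm_action \<sigma> (\<Sum>i\<in>I. f i) = (\<Sum>i\<in>I. perm_action \<sigma> (f i))"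
  by (simp add: perm_action_def fun_eq_iff sum_fun_apply)

lemma perm_action_id [simp]: "perm_action id v = v"
  by (simp add: perm_action_def)

text \<open>Column-strict plane partitions, that is, semistandard tableaux for the reversed order
  of the entries. With the reversed order a descent at \<open>i\<close> raises the first \<open>i\<close> entries of a
  standard tableau instead of the last \<open>n - i\<close>, and therefore contributes to the sum of all
  entries what it contributes to the major index.\<close>

definition column_strict_pp :: "nat list \<Rightarrow> (nat \<times> nat \<Rightarrow> nat) \<Rightarrow> bool" where
  "column_strict_pp lam P \<longleftrightarrow>
    (\<forall>i j j'. (i, j) \<in> diagram lam \<and> (i, j') \<in> diagram lam \<and> j < j' \<longrightarrow> P (i, j') \<le> P (i, j)) \<and>
    (\<forall>i i' j. (i, j) \<in> diagram lam \<and> (i', j) \<in> diagram lam \<and> i < i' \<longrightarrow> P (i', j) < P (i, j))"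

locale shape =
  fixes lam :: "nat list"
  assumes partition: "int_partition lam (sum_list lam)"
begin

abbreviation "n \<equiv> sum_list lam"

abbreviation "A \<equiv> {1..sum_list lam}"

lemma permutes_mem: "\<sigma> permutes A \<Longrightarrow> k \<in> A \<Longrightarrow> \<sigma> k \<in> A"
  by (metis permutes_in_image)

lemma diagram_down:
  assumes "(i, j) \<in> diagram lam" "i' \<le> i" "j' \<le> j"
  shows "(i', j') \<in> diagram lam"
proof -
  have "lam ! i \<le> lam ! i'"
    using partition assms(1,2) sorted_wrt_nth_less[of "(\<ge>)" lam i' i]
    by (cases "i' = i") (auto simp: int_partition_def diagram_def)
  then show ?thesis using assms by (auto simp: diagram_def)
qed

lemma diagram_Sigma: "diagram lam = (SIGMA i:{..<length lam}. {..<lam ! i})"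
  by (auto simp: diagram_def)

lemma finite_diagram: "finite (diagram lam)"
  unfolding diagram_Sigma by auto

lemma card_diagram: "card (diagram lam) = n"
  unfolding diagram_Sigma by (simp add: sum_list_sum_nth atLeast0LessThan)

lemma finite_tableaux: "finite (tableaux lam)"
proof (rule finite_subset)
  show "tableaux lam \<subseteq> PiE (diagram lam) (\<lambda>_. A)"
    unfolding tableaux_def bij_betw_def by (auto simp: PiE_def)
  show "finite (PiE (diagram lam) (\<lambda>_. A))" using finite_diagram by (intro finite_PiE) auto
qed

lemma tableaux_nonempty: "\<exists>t. t \<in> tableaux lam"
proof -
  obtain t where t: "bij_betw t (diagram lam) A"
    using finite_same_card_bij[OF finite_diagram, of A] card_diagram by auto
  then have "restrict t (diagram lam) \<in> tableaux lam"
    by (auto simp: tableaux_def cong: bij_betw_cong)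
  then show ?thesis by blast
qed

end

text \<open>A fixed tableau \<open>t\<close> identifies the words on \<open>{1..n}\<close> with the fillings of the diagram,
  \<open>x\<close> corresponding to \<open>x \<circ> t\<close>.\<close>

locale tableau_of_shape = shape +
  fixes t :: "nat \<times> nat \<Rightarrow> nat"
  assumes tableau: "t \<in> tableaux lam"
begin

lemma bij_t: "bij_betw t (diagram lam) A"
  using tableau by (simp add: tableaux_def)

definition cell :: "nat \<Rightarrow> nat \<times> nat" where
  "cell = inv_into (diagram lam) t"

abbreviation row :: "nat \<Rightarrow> nat" where
  "row k \<equiv> fst (cell k)"

abbreviation col :: "nat \<Rightarrow> nat" where
  "col k \<equiv> snd (cell k)"

lemma cell_in: "k \<in> A \<Longrightarrow> cell k \<in> diagram lam"
  unfolding cell_def using bij_t by (metis bij_betw_imp_surj_on inv_into_into)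

lemma t_cell: "k \<in> A \<Longrightarrow> t (cell k) = k"
  unfolding cell_def using bij_t by (metis bij_betw_inv_into_right)

lemma cell_t: "c \<in> diagram lam \<Longrightarrow> cell (t c) = c"
  unfolding cell_def using bij_t by (metis bij_betw_inv_into_left)

lemma t_in: "c \<in> diagram lam \<Longrightarrow> t c \<in> A"
  using bij_t by (meson bij_betwE)

lemma cell_inj: "k \<in> A \<Longrightarrow> l \<in> A \<Longrightarrow> cell k = cell l \<Longrightarrow> k = l"
  using t_cell by metis

lemma t_image: "t ` {c \<in> diagram lam. p c} = {k \<in> A. p (cell k)}"
proof (intro set_eqI iffI)
  fix k assume "k \<in> t ` {c \<in> diagram lam. p c}"
  then obtain c where c: "c \<in> diagram lam" "p c" "k = t c" by blast
  then show "k \<in> {k \<in> A. p (cell k)}" using t_in[OF c(1)] cell_t[OF c(1)] by simp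
next
  fix k assume "k \<in> {k \<in> A. p (cell k)}"
  then have "k \<in> A" "p (cell k)" by blast+
  then show "k \<in> t ` {c \<in> diagram lam. p c}"
    using cell_in[OF \<open>k \<in> A\<close>] t_cell[OF \<open>k \<in> A\<close>] by (metis (mono_tags, lifting) imageI mem_Collect_eq)
qed

abbreviation rowset :: "nat \<Rightarrow> nat set" where
  "rowset i \<equiv> {k \<in> A. row k = i}"

lemma row_less: "k \<in> A \<Longrightarrow> row k < length lam"
  using cell_in[of k] by (cases "cell k") (simp add: diagram_def)

lemma tabloid_eq: "tabloid lam t = map rowset [0..<length lam]"
  unfolding tabloid_def t_image ..

abbreviation C :: "(nat \<Rightarrow> nat) set" where
  "C \<equiv> column_stabilizer lam t"

lemma C_iff: "\<pi> \<in> C \<longleftrightarrow> \<pi> permutes A \<and> (\<forall>k\<in>A. col (\<pi> k) = col k)"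
proof
  assume "\<pi> \<in> C"
  then have p: "\<pi> permutes A" and im: "\<And>j. \<pi> ` {k \<in> A. col k = j} = {k \<in> A. col k = j}"
    unfolding column_stabilizer_def t_image by auto
  have "col (\<pi> k) = col k" if "k \<in> A" for k using im[of "col k"] that by blast
  with p show "\<pi> permutes A \<and> (\<forall>k\<in>A. col (\<pi> k) = col k)" by blast
next
  assume r: "\<pi> permutes A \<and> (\<forall>k\<in>A. col (\<pi> k) = col k)"
  then have p: "\<pi> permutes A" by simp
  have "\<pi> ` {k \<in> A. col k = j} = {k \<in> A. col k = j}" for j
  proof (rule card_subset_eq)
    show "\<pi> ` {k \<in> A. col k = j} \<subseteq> {k \<in> A. col k = j}"
      using r permutes_mem[OF p] by blast
    show "card (\<pi> ` {k \<in> A. col k = j}) = card {k \<in> A. col k = j}"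
      using permutes_inj_on[OF p] by (rule card_image)
  qed auto
  then show "\<pi> \<in> C" unfolding column_stabilizer_def t_image using p by auto
qed

lemma C_permutes: "\<pi> \<in> C \<Longrightarrow> \<pi> permutes A" by (simp add: C_iff)

lemma finite_C: "finite C"
  by (rule finite_subset[OF _ finite_permutations[of A]]) (auto simp: C_iff)

lemma id_in_C: "id \<in> C" by (simp add: C_iff permutes_id)

lemma comp_in_C:
  assumes "\<pi> \<in> C" "\<rho> \<in> C"
  shows "\<pi> \<circ> \<rho> \<in> C"
proof -
  have "col ((\<pi> \<circ> \<rho>) k) = col k" if "k \<in> A" for k
    using assms permutes_mem[OF C_permutes[OF assms(2)] that] that unfolding C_iff comp_apply by metis
  then show ?thesis using permutes_compose assms unfolding C_iff by blast
qed

lemma inv_in_C: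
  assumes "\<pi> \<in> C"
  shows "inv \<pi> \<in> C"
proof -
  have p: "\<pi> permutes A" using assms by (rule C_permutes)
  have "col (inv \<pi> k) = col k" if "k \<in> A" for k
  proof -
    have "inv \<pi> k \<in> A" using permutes_mem[OF permutes_inv[OF p] that] .
    then have "col (\<pi> (inv \<pi> k)) = col (inv \<pi> k)" using assms unfolding C_iff by blast
    then show ?thesis using permutes_inverses[OF p] by simp
  qed
  then show ?thesis using permutes_inv[OF p] unfolding C_iff by blast
qed

lemma transpose_in_C: "a \<in> A \<Longrightarrow> b \<in> A \<Longrightarrow> col a = col b \<Longrightarrow> transpose a b \<in> C"
  by (auto simp: C_iff permutes_swap_id transpose_def)

lemma sign_comp:
  assumes "\<pi> permutes A" "\<rho> permutes A"
  shows "sign (\<pi> \<circ> \<rho>) = sign \<pi> * sign \<rho>"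
  using assms by (intro sign_compose permutes_imp_permutation[of A]) auto

abbreviation "e \<equiv> polytabloid lam t"

lemma perm_action_polytabloid_term:
  assumes "\<sigma> permutes A" "\<pi> permutes A"
  shows "perm_action \<sigma> (vec_scale c (basis_vec (tabloid_perm \<pi> Y)))
    = vec_scale c (basis_vec (tabloid_perm (\<sigma> \<circ> \<pi>) Y))"
  using assms by (simp add: perm_action_scale perm_action_basis_vec permutes_bij tabloid_perm_comp)

lemma perm_action_e:
  assumes "\<sigma> permutes A"
  shows "perm_action \<sigma> e = (\<Sum>\<pi>\<in>C. vec_scale (of_int (sign \<pi>))
    (basis_vec (tabloid_perm (\<sigma> \<circ> \<pi>) (tabloid lam t))))"
  unfolding polytabloid_def perm_action_sum
  using assms by (intro sum.cong refl perm_action_polytabloid_term) (auto simp: C_permutes)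

text \<open>Left multiplication by an element of the column stabilizer permutes the terms of a
  polytabloid.\<close>

lemma column_antisymmetry:
  assumes \<rho>: "\<rho> \<in> C"
  shows "perm_action \<rho> e = vec_scale (of_int (sign \<rho>)) e"
proof -
  have p: "\<rho> permutes A" using \<rho> by (rule C_permutes)
  have "vec_scale (of_int (sign \<rho>)) e = (\<Sum>\<pi>\<in>C. vec_scale (of_int (sign \<rho> * sign \<pi>))
     (basis_vec (tabloid_perm \<pi> (tabloid lam t))))"
    by (simp add: polytabloid_def fun_space.scale_sum_right)
  also have "\<dots> = (\<Sum>\<pi>\<in>C. vec_scale (of_int (sign \<rho> * sign (\<rho> \<circ> \<pi>)))
     (basis_vec (tabloid_perm (\<rho> \<circ> \<pi>) (tabloid lam t))))"
    by (rule sum.reindex_bij_witness[of _ "\<lambda>\<pi>. \<rho> \<circ> \<pi>" "\<lambda>\<pi>. inv \<rho> \<circ> \<pi>"])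
       (simp_all add: \<rho> comp_in_C inv_in_C o_assoc permutes_inv_o[OF p])
  also have "\<dots> = perm_action \<rho> e"
    unfolding perm_action_e[OF p]
  proof (intro sum.cong refl)
    fix \<pi> assume "\<pi> \<in> C"
    then have "sign (\<rho> \<circ> \<pi>) = sign \<rho> * sign \<pi>" using p C_permutes by (intro sign_comp)
    then show "vec_scale (of_int (sign \<rho> * sign (\<rho> \<circ> \<pi>))) (basis_vec (tabloid_perm (\<rho> \<circ> \<pi>) (tabloid lam t)))
      = vec_scale (of_int (sign \<pi>)) (basis_vec (tabloid_perm (\<rho> \<circ> \<pi>) (tabloid lam t)))"
      by (simp add: mult.assoc[symmetric])
  qed
  finally show ?thesis by simp
qed

text \<open>If two elements of \<open>D\<close> share a row of a tabloid, then their transposition fixes the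
  tabloid, and the terms of its antisymmetrization over \<open>D\<close> cancel in pairs. The sum runs over
  all permutations of \<open>D\<close>, not over coset representatives as in the usual Garnir element; in
  characteristic 0 this is just as good.\<close>

lemma garnir_relation:
  assumes D: "D \<subseteq> A"
    and clash: "\<And>\<pi>. \<pi> \<in> C \<Longrightarrow> \<exists>a\<in>D. \<exists>b\<in>D. a \<noteq> b \<and> row (inv \<pi> a) = row (inv \<pi> b)"
  shows "(\<Sum>\<sigma> | \<sigma> permutes D. vec_scale (of_int (sign \<sigma>)) (perm_action \<sigma> e)) = 0"
proof -
  have DA: "\<sigma> permutes A" if "\<sigma> permutes D" for \<sigma> using that D by (rule permutes_subset)
  define g where "g \<sigma> \<pi> = vec_scale (of_int (sign \<sigma>)) (basis_vec (tabloid_perm (\<sigma> \<circ> \<pi>) (tabloid lam t)))"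
    for \<sigma> \<pi>
  have zero: "(\<Sum>\<sigma> | \<sigma> permutes D. g \<sigma> \<pi>) = 0" if \<pi>: "\<pi> \<in> C" for \<pi>
  proof -
    obtain a b where ab: "a \<in> D" "b \<in> D" "a \<noteq> b" "row (inv \<pi> a) = row (inv \<pi> b)"
      using clash[OF \<pi>] by blast
    let ?\<tau> = "transpose a b"
    have p: "\<pi> permutes A" using \<pi> by (rule C_permutes)
    have \<tau>: "?\<tau> permutes D" using ab by (intro permutes_swap_id)
    have mem: "k \<in> \<pi> ` rowset i \<longleftrightarrow> k \<in> A \<and> row (inv \<pi> k) = i" for k i
    proof -
      have "k \<in> \<pi> ` rowset i \<longleftrightarrow> inv \<pi> k \<in> rowset i"
        using p by (rule permutes_image_mem)
      then show ?thesis using permutes_in_image[OF permutes_inv[OF p], of k] by blast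
    qed
    have same: "tabloid_perm (?\<tau> \<circ> \<pi>) (tabloid lam t) = tabloid_perm \<pi> (tabloid lam t)"
      unfolding tabloid_perm_comp unfolding tabloid_perm_def tabloid_eq map_map
    proof (intro map_cong refl)
      fix i
      have "a \<in> \<pi> ` rowset i \<longleftrightarrow> b \<in> \<pi> ` rowset i" unfolding mem using ab D by auto
      then show "((`) ?\<tau> \<circ> ((`) \<pi> \<circ> rowset)) i = ((`) \<pi> \<circ> rowset) i"
        unfolding comp_apply by (rule image_transpose_eq)
    qed
    have "(\<Sum>\<sigma> | \<sigma> permutes D. g \<sigma> \<pi>) = (\<Sum>\<sigma> | \<sigma> permutes D. g (\<sigma> \<circ> ?\<tau>) \<pi>)"
      by (rule sum.reindex_bij_witness[of _ "\<lambda>\<sigma>. \<sigma> \<circ> ?\<tau>" "\<lambda>\<sigma>. \<sigma> \<circ> ?\<tau>"])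
         (simp_all add: permutes_compose[OF \<tau>] comp_assoc)
    also have "\<dots> = (\<Sum>\<sigma> | \<sigma> permutes D. - g \<sigma> \<pi>)"
    proof (intro sum.cong refl)
      fix \<sigma> assume "\<sigma> \<in> {\<sigma>. \<sigma> permutes D}"
      then have s: "\<sigma> permutes D" by simp
      have "tabloid_perm (\<sigma> \<circ> ?\<tau> \<circ> \<pi>) (tabloid lam t) = tabloid_perm (\<sigma> \<circ> \<pi>) (tabloid lam t)"
        using same unfolding comp_assoc tabloid_perm_comp by simp
      moreover have "sign (\<sigma> \<circ> ?\<tau>) = - sign \<sigma>"
        using sign_comp[OF DA[OF s] DA[OF \<tau>]] ab by (simp add: sign_swap_id)
      ultimately show "g (\<sigma> \<circ> ?\<tau>) \<pi> = - g \<sigma> \<pi>"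
        unfolding g_def by (simp add: vec_scale_def fun_eq_iff)
    qed
    also have "\<dots> = - (\<Sum>\<sigma> | \<sigma> permutes D. g \<sigma> \<pi>)" by (rule sum_negf)
    finally show ?thesis by (simp add: fun_eq_iff)
  qed
  have "(\<Sum>\<sigma> | \<sigma> permutes D. vec_scale (of_int (sign \<sigma>)) (perm_action \<sigma> e))
      = (\<Sum>\<sigma> | \<sigma> permutes D. \<Sum>\<pi>\<in>C. vec_scale (of_int (sign \<pi>)) (g \<sigma> \<pi>))"
  proof (intro sum.cong refl)
    fix \<sigma> assume "\<sigma> \<in> {\<sigma>. \<sigma> permutes D}"
    then show "vec_scale (of_int (sign \<sigma>)) (perm_action \<sigma> e) = (\<Sum>\<pi>\<in>C. vec_scale (of_int (sign \<pi>)) (g \<sigma> \<pi>))"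
      by (simp add: perm_action_e DA fun_space.scale_sum_right g_def mult.commute)
  qed
  also have "\<dots> = (\<Sum>\<pi>\<in>C. vec_scale (of_int (sign \<pi>)) (\<Sum>\<sigma> | \<sigma> permutes D. g \<sigma> \<pi>))"
    by (subst sum.swap) (simp add: fun_space.scale_sum_right)
  also have "\<dots> = (\<Sum>\<pi>\<in>C. 0)" by (intro sum.cong refl) (simp only: zero fun_space.scale_zero_right)
  finally show ?thesis by (simp only: sum.neutral_const)
qed

text \<open>Relabelling the entries of a tableau conjugates its column stabilizer.\<close>

lemma translate:
  assumes \<sigma>: "\<sigma> permutes A"
  shows "restrict (\<sigma> \<circ> t) (diagram lam) \<in> tableaux lam"
    and "polytabloid lam (restrict (\<sigma> \<circ> t) (diagram lam)) = perm_action \<sigma> e"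
proof -
  define s where "s = restrict (\<sigma> \<circ> t) (diagram lam)"
  have "bij_betw (\<sigma> \<circ> t) (diagram lam) A"
    using bij_betw_trans[OF bij_t permutes_imp_bij[OF \<sigma>]] .
  then show s: "restrict (\<sigma> \<circ> t) (diagram lam) \<in> tableaux lam"
    by (auto simp: tableaux_def cong: bij_betw_cong)
  have s_im: "s ` {c \<in> diagram lam. p c} = \<sigma> ` t ` {c \<in> diagram lam. p c}" for p
    unfolding s_def image_comp by (intro image_cong) auto
  have tab: "tabloid lam s = tabloid_perm \<sigma> (tabloid lam t)"
    unfolding tabloid_def tabloid_perm_def s_im by simp
  have inv\<sigma>: "inv \<sigma> permutes A" using \<sigma> by (rule permutes_inv)
  have stab: "\<pi> \<in> column_stabilizer lam s \<longleftrightarrow> inv \<sigma> \<circ> \<pi> \<circ> \<sigma> \<in> C" for \<pi>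
  proof -
    have eq: "\<pi> ` \<sigma> ` M = \<sigma> ` M \<longleftrightarrow> (inv \<sigma> \<circ> \<pi> \<circ> \<sigma>) ` M = M" for M
    proof -
      have "\<pi> ` \<sigma> ` M = \<sigma> ` M \<longleftrightarrow> inv \<sigma> ` \<pi> ` \<sigma> ` M = inv \<sigma> ` \<sigma> ` M"
        using permutes_inj[OF inv\<sigma>] by (simp add: inj_image_eq_iff)
      also have "inv \<sigma> ` \<sigma> ` M = M" by (simp add: image_comp permutes_inv_o[OF \<sigma>])
      finally show ?thesis by (simp add: image_comp comp_assoc)
    qed
    have "\<pi> permutes A \<longleftrightarrow> inv \<sigma> \<circ> \<pi> \<circ> \<sigma> permutes A"
    proof
      assume "inv \<sigma> \<circ> \<pi> \<circ> \<sigma> permutes A"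
      then have "\<sigma> \<circ> (inv \<sigma> \<circ> \<pi> \<circ> \<sigma>) \<circ> inv \<sigma> permutes A"
        by (rule permutes_compose[OF inv\<sigma> permutes_compose[OF _ \<sigma>]])
      moreover have "\<sigma> \<circ> (inv \<sigma> \<circ> \<pi> \<circ> \<sigma>) \<circ> inv \<sigma> = (\<sigma> \<circ> inv \<sigma>) \<circ> \<pi> \<circ> (\<sigma> \<circ> inv \<sigma>)"
        by (simp only: comp_assoc)
      ultimately show "\<pi> permutes A" by (simp only: permutes_inv_o[OF \<sigma>] id_comp comp_id)
    qed (use \<sigma> inv\<sigma> in \<open>intro permutes_compose\<close>)
    then show ?thesis unfolding column_stabilizer_def s_im mem_Collect_eq by (simp only: eq)
  qed
  have conj: "\<sigma> \<circ> (inv \<sigma> \<circ> \<pi> \<circ> \<sigma>) = \<pi> \<circ> \<sigma>" for \<pi>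
    by (simp add: o_assoc permutes_inv_o[OF \<sigma>])
  have "polytabloid lam s = (\<Sum>\<pi>\<in>C. vec_scale (of_int (sign \<pi>))
     (basis_vec (tabloid_perm (\<sigma> \<circ> \<pi>) (tabloid lam t))))"
    unfolding polytabloid_def tab
  proof (rule sum.reindex_bij_witness[of _ "\<lambda>\<pi>. \<sigma> \<circ> \<pi> \<circ> inv \<sigma>" "\<lambda>\<pi>. inv \<sigma> \<circ> \<pi> \<circ> \<sigma>"])
    fix \<pi> assume \<pi>: "\<pi> \<in> column_stabilizer lam s"
    show "\<sigma> \<circ> (inv \<sigma> \<circ> \<pi> \<circ> \<sigma>) \<circ> inv \<sigma> = \<pi>"
      unfolding conj by (simp add: comp_assoc permutes_inv_o[OF \<sigma>])
    show "inv \<sigma> \<circ> \<pi> \<circ> \<sigma> \<in> C" using stab \<pi> by simp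
    have p: "\<pi> permutes A" using \<pi> by (simp add: column_stabilizer_def)
    have "sign (inv \<sigma> \<circ> \<pi> \<circ> \<sigma>) = sign (inv \<sigma>) * sign \<pi> * sign \<sigma>"
      using sign_comp \<sigma> inv\<sigma> p by (simp add: permutes_compose)
    also have "\<dots> = sign \<pi>"
      using sign_inverse[OF permutes_imp_permutation[OF _ \<sigma>]] by (simp add: mult.commute)
    finally show "vec_scale (of_int (sign (inv \<sigma> \<circ> \<pi> \<circ> \<sigma>)))
          (basis_vec (tabloid_perm (\<sigma> \<circ> (inv \<sigma> \<circ> \<pi> \<circ> \<sigma>)) (tabloid lam t))) =
         vec_scale (of_int (sign \<pi>)) (basis_vec (tabloid_perm \<pi> (tabloid_perm \<sigma> (tabloid lam t))))"
      unfolding conj by (simp add: tabloid_perm_comp)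
  next
    fix \<pi> assume \<pi>: "\<pi> \<in> C"
    have "inv \<sigma> \<circ> (\<sigma> \<circ> \<pi> \<circ> inv \<sigma>) \<circ> \<sigma> = (inv \<sigma> \<circ> \<sigma>) \<circ> \<pi> \<circ> (inv \<sigma> \<circ> \<sigma>)"
      by (simp only: comp_assoc)
    then show eq: "inv \<sigma> \<circ> (\<sigma> \<circ> \<pi> \<circ> inv \<sigma>) \<circ> \<sigma> = \<pi>" by (simp add: permutes_inv_o[OF \<sigma>])
    show "\<sigma> \<circ> \<pi> \<circ> inv \<sigma> \<in> column_stabilizer lam s" unfolding stab eq by (rule \<pi>)
  qed
  then show "polytabloid lam (restrict (\<sigma> \<circ> t) (diagram lam)) = perm_action \<sigma> e"
    unfolding perm_action_e[OF \<sigma>] s_def .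
qed

lemma tableau_translate:
  assumes "s \<in> tableaux lam"
  obtains \<sigma> where "\<sigma> permutes A" "s = restrict (\<sigma> \<circ> t) (diagram lam)"
proof
  define \<sigma> where "\<sigma> k = (if k \<in> A then s (cell k) else k)" for k
  have bs: "bij_betw s (diagram lam) A" using assms by (simp add: tableaux_def)
  have "bij_betw cell A (diagram lam)" unfolding cell_def using bij_t by (rule bij_betw_inv_into)
  from bij_betw_trans[OF this bs] have "bij_betw \<sigma> A A"
    by (rule bij_betw_cong[THEN iffD1, rotated]) (simp add: \<sigma>_def)
  then show "\<sigma> permutes A" by (rule bij_imp_permutes) (auto simp: \<sigma>_def)
  have "s \<in> extensional (diagram lam)" using assms by (simp add: tableaux_def)
  then show "s = restrict (\<sigma> \<circ> t) (diagram lam)"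
    using t_in by (intro extensionalityI[of _ "diagram lam"]) (auto simp: \<sigma>_def cell_t)
qed

end

context shape
begin

lemma polytabloid_action:
  assumes "s \<in> tableaux lam" "\<sigma> permutes A"
  shows "perm_action \<sigma> (polytabloid lam s) \<in> polytabloid lam ` tableaux lam"
proof -
  interpret tableau_of_shape lam s by unfold_locales (rule assms)
  show ?thesis using translate[OF assms(2)] by (metis imageI)
qed

sublocale permutation_rep A "specht_module lam" perm_action
proof
  show "\<exists>F. finite F \<and> specht_module lam \<subseteq> fun_space.span F"
    unfolding specht_module_def using finite_tableaux by blast
  fix \<sigma> :: "nat \<Rightarrow> nat" and v
  assume \<sigma>: "\<sigma> permutes A" and v: "v \<in> specht_module lam"
  have sub: "fun_space.subspace {v. perm_action \<sigma> v \<in> specht_module lam}"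
    unfolding fun_space.subspace_def
  proof (intro conjI ballI allI)
    have "perm_action \<sigma> 0 = 0" by (simp add: perm_action_def fun_eq_iff)
    then show "0 \<in> {v. perm_action \<sigma> v \<in> specht_module lam}"
      unfolding specht_module_def using fun_space.span_zero by simp
  qed (auto simp: perm_action_add perm_action_scale specht_module_def fun_space.span_add fun_space.span_scale
        simp del: plus_fun_apply)
  have "polytabloid lam ` tableaux lam \<subseteq> {v. perm_action \<sigma> v \<in> specht_module lam}"
    using polytabloid_action[OF _ \<sigma>] fun_space.span_superset by (fastforce simp: specht_module_def)
  from fun_space.span_minimal[OF this sub] show "perm_action \<sigma> v \<in> specht_module lam"
    using v unfolding specht_module_def by blast
qed (auto simp: specht_module_def perm_action_add perm_action_scale perm_action_comp permutes_bij
      simp del: plus_fun_apply)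

end

section \<open>Intertwiners are determined by column-strict words\<close>

context tableau_of_shape
begin

text \<open>Two measures by which extremal words are chosen: \<open>col_weight\<close> does not see permutations
  within columns, and \<open>row_weight\<close> does not see permutations within rows.\<close>

definition col_weight :: "(nat \<Rightarrow> nat) \<Rightarrow> nat" where
  "col_weight x = (\<Sum>k\<in>A. col k * x k)"

definition row_weight :: "(nat \<Rightarrow> nat) \<Rightarrow> nat" where
  "row_weight x = (\<Sum>k\<in>A. row k * x k)"

lemma e_in: "e \<in> specht_module lam"
  unfolding specht_module_def using tableau by (intro fun_space.span_base) auto

text \<open>\<open>P\<close> meets the rows of column \<open>j\<close> from \<open>i\<close> on and \<open>Q\<close> the rows up to \<open>i\<close>, so that the
  row \<open>i\<close> counts twice.\<close>

lemma card_columns: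
  assumes "(i, j) \<in> diagram lam" "(i, j') \<in> diagram lam" "j < j'"
  defines "P \<equiv> {k \<in> A. col k = j \<and> i \<le> row k}" and "Q \<equiv> {k \<in> A. col k = j' \<and> row k \<le> i}"
  shows "card {r. (r, j) \<in> diagram lam} < card (P \<union> Q)"
proof -
  define L where "L = {r. (r, j) \<in> diagram lam}"
  have finL: "finite L"
    by (rule finite_subset[OF _ finite_lessThan[of "length lam"]]) (auto simp: L_def diagram_def)
  have "P = t ` {c \<in> diagram lam. snd c = j \<and> i \<le> fst c}" unfolding P_def t_image ..
  also have "{c \<in> diagram lam. snd c = j \<and> i \<le> fst c} = (\<lambda>r. (r, j)) ` {r \<in> L. i \<le> r}"
    by (force simp: L_def)
  finally have P: "P = t ` (\<lambda>r. (r, j)) ` {r \<in> L. i \<le> r}" .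
  have "Q = t ` {c \<in> diagram lam. snd c = j' \<and> fst c \<le> i}" unfolding Q_def t_image ..
  also have "{c \<in> diagram lam. snd c = j' \<and> fst c \<le> i} = (\<lambda>r. (r, j')) ` {..i}"
    using diagram_down[OF assms(2)] by force
  finally have Q: "Q = t ` (\<lambda>r. (r, j')) ` {..i}" .
  have inj: "inj_on t (diagram lam)" using bij_t by (rule bij_betw_imp_inj_on)
  have "card P = card {r \<in> L. i \<le> r}"
    unfolding P image_image
    by (rule card_image) (auto intro!: inj_onI dest: inj_onD[OF inj] simp: L_def)
  moreover have "card Q = card {..i}"
    unfolding Q image_image
    by (rule card_image) (auto intro!: inj_onI dest: inj_onD[OF inj] intro: diagram_down[OF assms(2)])
  moreover have "card (P \<union> Q) = card P + card Q"
    using assms(3) unfolding P_def Q_def by (intro card_Un_disjoint) auto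
  moreover have "card L \<le> card {r \<in> L. i \<le> r} + card {..<i}"
  proof -
    have "card L \<le> card ({r \<in> L. i \<le> r} \<union> {..<i})"
      using finL by (intro card_mono) auto
    also have "\<dots> \<le> card {r \<in> L. i \<le> r} + card {..<i}" by (rule card_Un_le)
    finally show ?thesis .
  qed
  ultimately show ?thesis unfolding L_def[symmetric] by simp
qed

text \<open>A column permutation places the elements of \<open>D\<close> in rows that meet column \<open>j\<close>, because
  column \<open>j'\<close> is not longer than column \<open>j\<close>; by \<open>card_columns\<close> there are too few of these
  rows.\<close>

lemma column_clash:
  assumes "(i, j) \<in> diagram lam" "(i, j') \<in> diagram lam" "j < j'" "\<pi> \<in> C"
  defines "D \<equiv> {k \<in> A. col k = j \<and> i \<le> row k} \<union> {k \<in> A. col k = j' \<and> row k \<le> i}"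
  shows "\<exists>a\<in>D. \<exists>b\<in>D. a \<noteq> b \<and> row (inv \<pi> a) = row (inv \<pi> b)"
proof -
  define L where "L = {r. (r, j) \<in> diagram lam}"
  have finL: "finite L"
    by (rule finite_subset[OF _ finite_lessThan[of "length lam"]]) (auto simp: L_def diagram_def)
  have p: "inv \<pi> permutes A" using assms(4) by (intro permutes_inv C_permutes)
  have sub: "(\<lambda>k. row (inv \<pi> k)) ` D \<subseteq> L"
  proof
    fix r assume "r \<in> (\<lambda>k. row (inv \<pi> k)) ` D"
    then obtain k where k: "k \<in> D" "r = row (inv \<pi> k)" by blast
    have kA: "k \<in> A" using k by (auto simp: D_def)
    have "col (inv \<pi> k) = col k" using inv_in_C[OF assms(4)] kA unfolding C_iff by blast
    then have "cell (inv \<pi> k) = (r, col k)" using k by (simp add: prod_eq_iff)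
    then have "(r, col k) \<in> diagram lam" using cell_in[OF permutes_mem[OF p kA]] by simp
    moreover have "j \<le> col k" using k(1) assms(3) by (auto simp: D_def)
    ultimately have "(r, j) \<in> diagram lam" using diagram_down by blast
    then show "r \<in> L" by (simp add: L_def)
  qed
  then have "card ((\<lambda>k. row (inv \<pi> k)) ` D) < card D"
    using card_mono[OF finL sub] card_columns[OF assms(1-3)] unfolding D_def L_def by linarith
  then have "\<not> inj_on (\<lambda>k. row (inv \<pi> k)) D" by (rule pigeonhole)
  then show ?thesis unfolding inj_on_def by blast
qed

lemma col_weight_column: "\<pi> \<in> C \<Longrightarrow> col_weight (x \<circ> \<pi>) = col_weight x"
proof -
  assume \<pi>: "\<pi> \<in> C"
  have p: "\<pi> permutes A" using \<pi> by (rule C_permutes)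
  have "col_weight (x \<circ> \<pi>) = (\<Sum>k\<in>A. col (\<pi> k) * x (\<pi> k))"
    unfolding col_weight_def using \<pi> unfolding C_iff by (intro sum.cong refl) auto
  also have "\<dots> = col_weight x" unfolding col_weight_def
    using sum.permute[OF p, of "\<lambda>k. col k * x k"] by (simp add: comp_def)
  finally show ?thesis .
qed

text \<open>The exchange brings smaller values into the column \<open>j'\<close>, whose weight is larger.\<close>

lemma col_weight_exchange:
  assumes PQ: "P \<subseteq> {k \<in> A. col k = j}" "Q \<subseteq> {k \<in> A. col k = j'}" and "j < j'"
    and \<sigma>: "\<sigma> permutes (P \<union> Q)" and "\<sigma> ` Q \<noteq> Q"
    and less: "\<And>p q. p \<in> P \<Longrightarrow> q \<in> Q \<Longrightarrow> x p < x q"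
  shows "col_weight (x \<circ> \<sigma>) < col_weight x"
proof -
  have disj: "P \<inter> Q = {}" using PQ \<open>j < j'\<close> by auto
  have sub: "P \<union> Q \<subseteq> A" using PQ by blast
  have fin: "finite P" "finite Q" using sub by (auto intro: finite_subset)
  obtain d where d: "j' = j + d" "d > 0" using \<open>j < j'\<close> less_imp_add_positive by blast
  have weight: "col_weight y = (\<Sum>k\<in>A - (P \<union> Q). col k * y k) + j * sum y (P \<union> Q) + d * sum y Q" for y
  proof -
    have "col_weight y = (\<Sum>k\<in>A - (P \<union> Q). col k * y k) + (\<Sum>k\<in>P \<union> Q. col k * y k)"
      unfolding col_weight_def using sub by (intro sum.subset_diff) auto
    also have "(\<Sum>k\<in>P \<union> Q. col k * y k) = (\<Sum>k\<in>P. col k * y k) + (\<Sum>k\<in>Q. col k * y k)"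
      using fin disj by (rule sum.union_disjoint)
    also have "(\<Sum>k\<in>P. col k * y k) = (\<Sum>k\<in>P. j * y k)" using PQ by (intro sum.cong) auto
    also have "(\<Sum>k\<in>Q. col k * y k) = (\<Sum>k\<in>Q. j' * y k)" using PQ by (intro sum.cong) auto
    finally show ?thesis
      using fin disj by (simp add: d sum.union_disjoint sum.distrib sum_distrib_left algebra_simps)
  qed
  have "sum (x \<circ> \<sigma>) (P \<union> Q) = sum x (P \<union> Q)" using sum.permute[OF \<sigma>, of x] by simp
  moreover have "(\<Sum>k\<in>A - (P \<union> Q). col k * (x \<circ> \<sigma>) k) = (\<Sum>k\<in>A - (P \<union> Q). col k * x k)"
    using permutes_not_in[OF \<sigma>] by (intro sum.cong refl) simp
  moreover have "sum (x \<circ> \<sigma>) Q < sum x Q"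
  proof -
    have "sum (x \<circ> \<sigma>) Q = sum x (\<sigma> ` Q)"
      by (rule sum.reindex[OF permutes_inj_on[OF \<sigma>], symmetric])
    also have "\<dots> < sum x Q"
    proof (rule sum_exchange_less[OF fin(2) _ _ \<open>\<sigma> ` Q \<noteq> Q\<close>])
      show "card (\<sigma> ` Q) = card Q" using permutes_inj_on[OF \<sigma>] by (rule card_image)
      fix p q assume pq: "p \<in> \<sigma> ` Q - Q" "q \<in> Q"
      then have "p \<in> P" using permutes_image[OF \<sigma>] by blast
      then show "x p < x q" using less pq by blast
    qed (use fin in auto)
    finally show ?thesis .
  qed
  ultimately show ?thesis using d by (simp add: weight)
qed

lemma linear_on_zero: "linear_on \<theta> \<Longrightarrow> \<theta> 0 = 0"
  using linear_on_sum[of \<theta> "{}" "\<lambda>_. 0"] by simp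

lemma garnir_coefficients:
  assumes \<Theta>: "intertwiner X \<Theta>" and closed: "\<And>\<sigma> x. \<sigma> permutes A \<Longrightarrow> x \<in> X \<Longrightarrow> x \<circ> \<sigma> \<in> X"
    and x: "x \<in> X" and D: "D \<subseteq> A"
    and clash: "\<And>\<pi>. \<pi> \<in> C \<Longrightarrow> \<exists>a\<in>D. \<exists>b\<in>D. a \<noteq> b \<and> row (inv \<pi> a) = row (inv \<pi> b)"
  shows "(\<Sum>\<sigma> | \<sigma> permutes D. of_int (sign \<sigma>) * \<Theta> e (x \<circ> \<sigma>)) = 0"
proof -
  have lin: "linear_on (\<lambda>v. \<Theta> v x)" using \<Theta> x by (simp add: intertwiner_def)
  have DA: "\<sigma> permutes A" if "\<sigma> permutes D" for \<sigma> using that D by (rule permutes_subset)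
  have "0 = \<Theta> (\<Sum>\<sigma> | \<sigma> permutes D. vec_scale (of_int (sign \<sigma>)) (perm_action \<sigma> e)) x"
    by (simp only: garnir_relation[OF D clash] linear_on_zero[OF lin])
  also have "\<dots> = (\<Sum>\<sigma> | \<sigma> permutes D. \<Theta> (vec_scale (of_int (sign \<sigma>)) (perm_action \<sigma> e)) x)"
    by (rule linear_on_sum[OF lin]) (auto intro!: scale_mem act_closed e_in DA)
  also have "\<dots> = (\<Sum>\<sigma> | \<sigma> permutes D. of_int (sign \<sigma>) * \<Theta> e (x \<circ> \<sigma>))"
  proof (intro sum.cong refl)
    fix \<sigma> assume "\<sigma> \<in> {\<sigma>. \<sigma> permutes D}"
    then have \<sigma>: "\<sigma> permutes A" using DA by simp
    have "\<Theta> (vec_scale (of_int (sign \<sigma>)) (perm_action \<sigma> e)) x = of_int (sign \<sigma>) * \<Theta> (perm_action \<sigma> e) x"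
      using lin act_closed[OF \<sigma> e_in] unfolding linear_on_def by blast
    also have "\<Theta> (perm_action \<sigma> e) x = \<Theta> e (x \<circ> \<sigma>)"
      using \<Theta> \<sigma> e_in x unfolding intertwiner_def by blast
    finally show "\<Theta> (vec_scale (of_int (sign \<sigma>)) (perm_action \<sigma> e)) x = of_int (sign \<sigma>) * \<Theta> e (x \<circ> \<sigma>)" .
  qed
  finally show ?thesis by simp
qed

lemma column_coefficients:
  assumes \<Theta>: "intertwiner X \<Theta>" and x: "x \<in> X" and \<pi>: "\<pi> \<in> C"
  shows "\<Theta> e (x \<circ> \<pi>) = of_int (sign \<pi>) * \<Theta> e x"
proof -
  have "\<Theta> e (x \<circ> \<pi>) = \<Theta> (perm_action \<pi> e) x"
    using \<Theta> C_permutes[OF \<pi>] e_in x unfolding intertwiner_def by auto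
  also have "\<dots> = of_int (sign \<pi>) * \<Theta> e x"
    unfolding column_antisymmetry[OF \<pi>] using \<Theta> e_in x unfolding intertwiner_def linear_on_def by blast
  finally show ?thesis .
qed

text \<open>Garnir straightening, organized as a minimality argument. Suppose that some coefficient
  \<open>\<Theta> e x\<close> is nonzero, and choose such a word with the least \<open>col_weight\<close> and, subject to this,
  the least \<open>row_weight\<close>. Antisymmetry in the columns makes it strictly decreasing along
  columns, since exchanging two entries in the wrong order would lower \<open>row_weight\<close>. If it
  increases along some row, from column \<open>j\<close> to column \<open>j'\<close>, then the Garnir relation for this
  place applies: the permutations in it that do not preserve the columns lower \<open>col_weight\<close> and
  have coefficient zero, and all others contribute the coefficient of the chosen word itself,
  which therefore vanishes.\<close>

lemma intertwiner_vanishes: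
  fixes X :: "(nat \<Rightarrow> nat) set"
  assumes fin: "finite X" and closed: "\<And>\<sigma> x. \<sigma> permutes A \<Longrightarrow> x \<in> X \<Longrightarrow> x \<circ> \<sigma> \<in> X"
    and \<Theta>: "intertwiner X \<Theta>"
    and zero: "\<And>x. x \<in> X \<Longrightarrow> column_strict_pp lam (x \<circ> t) \<Longrightarrow> \<Theta> e x = 0"
    and x: "x \<in> X"
  shows "\<Theta> e x = 0"
proof (rule ccontr)
  assume "\<Theta> e x \<noteq> 0"
  define Y where "Y = {x \<in> X. \<Theta> e x \<noteq> 0}"
  have "x \<in> Y" using x \<open>\<Theta> e x \<noteq> 0\<close> by (simp add: Y_def)
  then obtain y0 where y0: "y0 \<in> Y" "\<And>y. y \<in> Y \<Longrightarrow> col_weight y0 \<le> col_weight y"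
    using ex_has_least_nat[of "\<lambda>y. y \<in> Y" x col_weight] by blast
  then obtain y where y: "y \<in> Y" "col_weight y = col_weight y0"
      and y_min: "\<And>z. z \<in> Y \<Longrightarrow> col_weight z = col_weight y0 \<Longrightarrow> row_weight y \<le> row_weight z"
    using ex_has_least_nat[of "\<lambda>y. y \<in> Y \<and> col_weight y = col_weight y0" y0 row_weight] by blast
  have yX: "y \<in> X" and nz: "\<Theta> e y \<noteq> 0" using y by (auto simp: Y_def)
  have strict: "y b < y a" if ab: "a \<in> A" "b \<in> A" "col a = col b" "row a < row b" for a b
  proof (rule ccontr)
    assume "\<not> y b < y a"
    define \<tau> where "\<tau> = transpose a b"
    have \<tau>: "\<tau> \<in> C" unfolding \<tau>_def using ab by (intro transpose_in_C)
    have "a \<noteq> b" using ab by auto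
    then have "sign \<tau> = -1" by (simp add: \<tau>_def sign_swap_id)
    then have neg: "\<Theta> e (y \<circ> \<tau>) = - \<Theta> e y" using column_coefficients[OF \<Theta> yX \<tau>] by simp
    have "y a \<noteq> y b"
    proof
      assume "y a = y b"
      then have "y \<circ> \<tau> = y" by (auto simp: \<tau>_def transpose_def fun_eq_iff)
      then show False using neg nz by simp
    qed
    then have "y a < y b" using \<open>\<not> y b < y a\<close> by simp
    then have "row_weight (y \<circ> \<tau>) < row_weight y"
      unfolding row_weight_def \<tau>_def comp_apply using ab by (intro sum_swap_less) auto
    moreover have "y \<circ> \<tau> \<in> Y" using neg nz closed[OF C_permutes[OF \<tau>] yX] by (simp add: Y_def)
    ultimately show False using y_min[of "y \<circ> \<tau>"] col_weight_column[OF \<tau>, of y] y(2) by simp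
  qed
  have weak: "y (t (i, j')) \<le> y (t (i, j))"
    if ij: "(i, j) \<in> diagram lam" "(i, j') \<in> diagram lam" "j < j'" for i j j'
  proof (rule ccontr)
    assume "\<not> y (t (i, j')) \<le> y (t (i, j))"
    then have lt: "y (t (i, j)) < y (t (i, j'))" by simp
    define P where "P = {k \<in> A. col k = j \<and> i \<le> row k}"
    define Q where "Q = {k \<in> A. col k = j' \<and> row k \<le> i}"
    have less: "y p < y q" if "p \<in> P" "q \<in> Q" for p q
    proof -
      have "y p \<le> y (t (i, j))"
      proof (cases "row p = i")
        case True
        then have "p = t (i, j)" using that t_cell[of p] by (auto simp: P_def prod_eq_iff intro: arg_cong[of _ _ t])
        then show ?thesis by simp
      next
        case False
        have "y p < y (t (i, j))"
          using that False t_in[OF ij(1)] by (intro strict) (auto simp: P_def cell_t[OF ij(1)])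
        then show ?thesis by simp
      qed
      also have "\<dots> < y (t (i, j'))" by (rule lt)
      also have "\<dots> \<le> y q"
      proof (cases "row q = i")
        case True
        then have "q = t (i, j')" using that t_cell[of q] by (auto simp: Q_def prod_eq_iff intro: arg_cong[of _ _ t])
        then show ?thesis by simp
      next
        case False
        have "y (t (i, j')) < y q"
          using that False t_in[OF ij(2)] by (intro strict) (auto simp: Q_def cell_t[OF ij(2)])
        then show ?thesis by simp
      qed
      finally show ?thesis .
    qed
    have sub: "P \<union> Q \<subseteq> A" by (auto simp: P_def Q_def)
    have finD: "finite (P \<union> Q)" using sub by (rule finite_subset) simp
    have DA: "\<sigma> permutes A" if "\<sigma> permutes (P \<union> Q)" for \<sigma> using that sub by (rule permutes_subset)
    have disj: "P \<inter> Q = {}" using ij(3) by (auto simp: P_def Q_def)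
    have "0 = (\<Sum>\<sigma> | \<sigma> permutes (P \<union> Q). of_int (sign \<sigma>) * \<Theta> e (y \<circ> \<sigma>))"
      using garnir_coefficients[OF \<Theta> closed yX sub] column_clash[OF ij] unfolding P_def Q_def by simp
    also have "\<dots> = (\<Sum>\<sigma> | \<sigma> permutes (P \<union> Q). if \<sigma> ` Q = Q then \<Theta> e y else 0)"
    proof (intro sum.cong refl)
      fix \<sigma> assume "\<sigma> \<in> {\<sigma>. \<sigma> permutes (P \<union> Q)}"
      then have \<sigma>: "\<sigma> permutes (P \<union> Q)" by simp
      show "of_int (sign \<sigma>) * \<Theta> e (y \<circ> \<sigma>) = (if \<sigma> ` Q = Q then \<Theta> e y else 0)"
      proof (cases "\<sigma> ` Q = Q")
        case True
        have imP: "\<sigma> ` P = P"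
        proof -
          have "P = (P \<union> Q) - Q" using disj by blast
          then have "\<sigma> ` P = \<sigma> ` (P \<union> Q) - \<sigma> ` Q"
            using image_set_diff[OF permutes_inj[OF \<sigma>]] by metis
          also have "\<sigma> ` (P \<union> Q) - \<sigma> ` Q = (P \<union> Q) - Q"
            by (simp only: True permutes_image[OF \<sigma>])
          finally show ?thesis using disj by blast
        qed
        have "col (\<sigma> k) = col k" if "k \<in> A" for k
        proof -
          consider "k \<in> P" | "k \<in> Q" | "k \<notin> P \<union> Q" by blast
          then show ?thesis
          proof cases
            case 1
            then have "\<sigma> k \<in> P" using imP by blast
            with 1 show ?thesis by (simp add: P_def)
          next
            case 2
            then have "\<sigma> k \<in> Q" using True by blast
            with 2 show ?thesis by (simp add: Q_def)
          qed (simp add: permutes_not_in[OF \<sigma>])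
        qed
        then have "\<sigma> \<in> C" using DA[OF \<sigma>] unfolding C_iff by blast
        then show ?thesis
          using column_coefficients[OF \<Theta> yX] True by (simp flip: of_int_mult mult.assoc)
      next
        case False
        have "col_weight (y \<circ> \<sigma>) < col_weight y"
          by (rule col_weight_exchange[OF _ _ ij(3) \<sigma> False less]) (auto simp: P_def Q_def)
        then have "y \<circ> \<sigma> \<notin> Y" using y0(2) y(2) by (metis leD)
        then have "\<Theta> e (y \<circ> \<sigma>) = 0" using closed[OF DA[OF \<sigma>] yX] by (simp add: Y_def)
        then show ?thesis using False by simp
      qed
    qed
    also have "\<dots> = of_nat (card {\<sigma>. \<sigma> permutes (P \<union> Q) \<and> \<sigma> ` Q = Q}) * \<Theta> e y"
      using finite_permutations[OF finD] by (simp add: sum.If_cases Int_def)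
    finally have "card {\<sigma>. \<sigma> permutes (P \<union> Q) \<and> \<sigma> ` Q = Q} = 0" using nz by simp
    moreover have "finite {\<sigma>. \<sigma> permutes (P \<union> Q) \<and> \<sigma> ` Q = Q}"
      using finite_permutations[OF finD] by simp
    moreover have "id \<in> {\<sigma>. \<sigma> permutes (P \<union> Q) \<and> \<sigma> ` Q = Q}" by (simp add: permutes_id)
    ultimately show False by (metis card_0_eq empty_iff)
  qed
  have "column_strict_pp lam (y \<circ> t)"
    unfolding column_strict_pp_def comp_apply
  proof (intro conjI allI impI)
    fix i i' j assume h: "(i, j) \<in> diagram lam \<and> (i', j) \<in> diagram lam \<and> i < i'"
    then show "y (t (i', j)) < y (t (i, j))"
      using t_in by (intro strict) (auto simp: cell_t)
  qed (use weak in blast)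
  then show False using zero[OF yX] nz by blast
qed

text \<open>The translates of \<open>e\<close> span the Specht module.\<close>

lemma intertwiner_determined:
  fixes X :: "(nat \<Rightarrow> nat) set"
  assumes closed: "\<And>\<sigma> x. \<sigma> permutes A \<Longrightarrow> x \<in> X \<Longrightarrow> x \<circ> \<sigma> \<in> X"
    and \<Theta>: "intertwiner X \<Theta>" and zero: "\<And>x. x \<in> X \<Longrightarrow> \<Theta> e x = 0"
    and v: "v \<in> specht_module lam" and x: "x \<in> X"
  shows "\<Theta> v x = 0"
proof -
  let ?Z = "{v \<in> specht_module lam. \<Theta> v x = 0}"
  have lin: "linear_on (\<lambda>v. \<Theta> v x)" using \<Theta> x by (simp add: intertwiner_def)
  have "fun_space.subspace ?Z"
    unfolding fun_space.subspace_def
  proof (intro conjI ballI allI)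
    show "0 \<in> ?Z" using zero_mem linear_on_zero[OF lin] by blast
    fix u w c assume u: "u \<in> ?Z"
    show "vec_scale c u \<in> ?Z" using u lin scale_mem unfolding linear_on_def by auto
    assume w: "w \<in> ?Z"
    have "\<Theta> (u + w) x = \<Theta> u x + \<Theta> w x" using lin u w unfolding linear_on_def by blast
    moreover have "u + w \<in> specht_module lam" using u w fun_space.subspace_add[OF subspace] by blast
    ultimately show "u + w \<in> ?Z" using u w by auto
  qed
  moreover have "polytabloid lam ` tableaux lam \<subseteq> ?Z"
  proof
    fix u assume "u \<in> polytabloid lam ` tableaux lam"
    then obtain s where s: "s \<in> tableaux lam" "u = polytabloid lam s" by blast
    obtain \<sigma> where \<sigma>: "\<sigma> permutes A" "s = restrict (\<sigma> \<circ> t) (diagram lam)"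
      using tableau_translate[OF s(1)] .
    have "u = perm_action \<sigma> e" using s(2) \<sigma>(2) translate(2)[OF \<sigma>(1)] by simp
    then have "\<Theta> u x = \<Theta> e (x \<circ> \<sigma>)" using \<Theta> \<sigma>(1) e_in x unfolding intertwiner_def by blast
    then have "\<Theta> u x = 0" using zero closed[OF \<sigma>(1) x] by simp
    moreover have "u \<in> specht_module lam"
      unfolding specht_module_def s(2) using s(1) by (intro fun_space.span_base) auto
    ultimately show "u \<in> ?Z" by blast
  qed
  ultimately have "specht_module lam \<subseteq> ?Z"
    unfolding specht_module_def[of lam] by (rule fun_space.span_minimal[rotated])
  then show ?thesis using v by blast
qed

end

section \<open>Semistandard homomorphisms\<close>

context tableau_of_shape
begin

text \<open>A topmost moved entry \<open>k\<close> has its image and its preimage \<open>k'\<close> strictly below itself;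
  but \<open>k\<close> is above \<open>k'\<close>, so \<open>\<pi> k\<close> should be above \<open>\<pi> k' = k\<close>.\<close>

lemma column_permutation_eq_id:
  assumes \<pi>: "\<pi> \<in> C" and incr: "\<And>k l. k \<in> A \<Longrightarrow> l \<in> A \<Longrightarrow> col k = col l \<Longrightarrow> row k < row l \<Longrightarrow> row (\<pi> k) < row (\<pi> l)"
  shows "\<pi> = id"
proof (rule ccontr)
  have p: "\<pi> permutes A" using \<pi> by (rule C_permutes)
  assume "\<pi> \<noteq> id"
  then obtain k0 where "\<pi> k0 \<noteq> k0" by (auto simp: fun_eq_iff)
  then obtain k where k: "\<pi> k \<noteq> k" and k_min: "\<And>l. \<pi> l \<noteq> l \<Longrightarrow> row k \<le> row l"
    using ex_has_least_nat[of "\<lambda>k. \<pi> k \<noteq> k" k0 row] by blast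
  have kA: "k \<in> A" using k permutes_not_in[OF p] by blast
  have distinct: "row k < row l" if "\<pi> l \<noteq> l" "l \<in> A" "col l = col k" "l \<noteq> k" for l
  proof -
    have "row l \<noteq> row k" using that cell_inj[OF that(2) kA] by (auto simp: prod_eq_iff)
    then show ?thesis using k_min[OF that(1)] by simp
  qed
  define k' where "k' = inv \<pi> k"
  have \<pi>k': "\<pi> k' = k" using permutes_inverses[OF p] by (simp add: k'_def)
  have k'A: "k' \<in> A" unfolding k'_def using permutes_mem[OF permutes_inv[OF p] kA] .
  have \<pi>kA: "\<pi> k \<in> A" using permutes_mem[OF p kA] .
  have "k' \<noteq> k" using k \<pi>k' by auto
  moreover have "col k' = col k" using \<pi> k'A \<pi>k' unfolding C_iff by metis
  ultimately have "row k < row k'" using k'A \<pi>k' by (intro distinct) auto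
  then have "row (\<pi> k) < row (\<pi> k')" using incr[OF kA k'A] \<open>col k' = col k\<close> by simp
  moreover have "row k < row (\<pi> k)"
  proof (rule distinct)
    show "\<pi> (\<pi> k) \<noteq> \<pi> k" using k injD[OF permutes_inj[OF p]] by blast
    show "col (\<pi> k) = col k" using \<pi> kA unfolding C_iff by blast
  qed (use k \<pi>kA in auto)
  ultimately show False using \<pi>k' by simp
qed

text \<open>A column permutation that minimizes the weight must sort the columns, as otherwise a
  transposition would improve it; since \<open>U\<close> is already sorted, only the identity does.\<close>

lemma row_weight_less:
  assumes U: "column_strict_pp lam (U \<circ> t)" and \<pi>: "\<pi> \<in> C" "\<pi> \<noteq> id"
  shows "row_weight U < row_weight (U \<circ> \<pi>)"
proof -
  have strict: "U l < U k" if "k \<in> A" "l \<in> A" "col k = col l" "row k < row l" for k l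
  proof -
    have "(row k, col k) \<in> diagram lam" "(row l, col k) \<in> diagram lam"
      using cell_in[OF that(1)] cell_in[OF that(2)] that(3) by (metis prod.collapse)+
    then have "(U \<circ> t) (row l, col k) < (U \<circ> t) (row k, col k)"
      using U that(4) unfolding column_strict_pp_def by blast
    then show ?thesis using t_cell[OF that(1)] t_cell[OF that(2)] that(3) by (metis comp_apply prod.collapse)
  qed
  obtain \<rho> where \<rho>: "\<rho> \<in> C" and \<rho>_min: "\<And>\<rho>'. \<rho>' \<in> C \<Longrightarrow> row_weight (U \<circ> \<rho>) \<le> row_weight (U \<circ> \<rho>')"
    using ex_has_least_nat[of "\<lambda>\<rho>. \<rho> \<in> C" \<pi> "\<lambda>\<rho>. row_weight (U \<circ> \<rho>)"] \<pi> by blast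
  have unique: "\<sigma> = id" if \<sigma>: "\<sigma> \<in> C" and \<sigma>_min: "row_weight (U \<circ> \<sigma>) = row_weight (U \<circ> \<rho>)" for \<sigma>
  proof (rule column_permutation_eq_id[OF \<sigma>])
    fix k l assume kl: "k \<in> A" "l \<in> A" "col k = col l" "row k < row l"
    have s: "\<sigma> permutes A" using \<sigma> by (rule C_permutes)
    have A: "\<sigma> k \<in> A" "\<sigma> l \<in> A" using permutes_mem[OF s] kl by blast+
    have cols: "col (\<sigma> k) = col (\<sigma> l)" using \<sigma> kl unfolding C_iff by metis
    show "row (\<sigma> k) < row (\<sigma> l)"
    proof (rule ccontr)
      assume "\<not> row (\<sigma> k) < row (\<sigma> l)"
      moreover have "row (\<sigma> k) \<noteq> row (\<sigma> l)"
        using cell_inj[OF A] cols injD[OF permutes_inj[OF s], of k l] kl by (auto simp: prod_eq_iff)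
      ultimately have "U (\<sigma> k) < U (\<sigma> l)" using strict[OF A(2,1)] cols by simp
      then have "row_weight ((U \<circ> \<sigma>) \<circ> transpose k l) < row_weight (U \<circ> \<sigma>)"
        unfolding row_weight_def comp_apply using kl by (intro sum_swap_less[where x = "\<lambda>k. U (\<sigma> k)"]) auto
      moreover have "row_weight (U \<circ> \<rho>) \<le> row_weight (U \<circ> (\<sigma> \<circ> transpose k l))"
        using kl by (intro \<rho>_min comp_in_C \<sigma> transpose_in_C)
      ultimately show False using \<sigma>_min by (simp add: comp_assoc)
    qed
  qed
  have "\<rho> = id" using unique[OF \<rho>] by simp
  then have "row_weight U \<le> row_weight (U \<circ> \<pi>)" using \<rho>_min[OF \<pi>(1)] by simp
  moreover have "row_weight (U \<circ> \<pi>) \<noteq> row_weight U" using unique[OF \<pi>(1)] \<pi>(2) \<open>\<rho> = id\<close> by auto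
  ultimately show ?thesis by simp
qed

definition row_equivalent :: "(nat \<Rightarrow> nat) \<Rightarrow> (nat \<Rightarrow> nat) \<Rightarrow> bool" where
  "row_equivalent x y \<longleftrightarrow> (\<forall>i<length lam. image_mset x (mset_set (rowset i)) = image_mset y (mset_set (rowset i)))"

lemma row_equivalent_weight:
  assumes "row_equivalent x y"
  shows "row_weight x = row_weight y"
proof -
  have rw: "row_weight x = (\<Sum>i<length lam. i * sum_mset (image_mset x (mset_set (rowset i))))" for x
  proof -
    have "row_weight x = (\<Sum>i<length lam. \<Sum>k\<in>rowset i. row k * x k)"
      unfolding row_weight_def using row_less
      by (intro sum.group[symmetric]) auto
    also have "\<dots> = (\<Sum>i<length lam. i * sum x (rowset i))"
      by (intro sum.cong refl) (simp add: sum_distrib_left)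
    finally show ?thesis by (simp add: sum_unfold_sum_mset)
  qed
  show ?thesis unfolding rw using assms by (intro sum.cong refl) (simp add: row_equivalent_def)
qed

lemma rowset_list: "i < length lam \<Longrightarrow> image_mset x (mset_set (rowset i)) = mset (map (\<lambda>j. x (t (i, j))) [0..<lam ! i])"
proof -
  assume i: "i < length lam"
  have "rowset i = t ` {c \<in> diagram lam. fst c = i}" unfolding t_image ..
  also have "{c \<in> diagram lam. fst c = i} = Pair i ` {0..<lam ! i}"
    using i by (auto simp: diagram_def)
  finally have "rowset i = (\<lambda>j. t (i, j)) ` {0..<lam ! i}" by (simp only: image_image)
  moreover have "inj_on (\<lambda>j. t (i, j)) {0..<lam ! i}"
    using i bij_betw_imp_inj_on[OF bij_t] by (auto intro!: inj_onI dest: inj_onD simp: diagram_def)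
  ultimately have "mset_set (rowset i) = image_mset (\<lambda>j. t (i, j)) (mset_set {0..<lam ! i})"
    by (simp only: image_mset_mset_set)
  then show ?thesis by (simp add: multiset.map_comp comp_def)
qed

text \<open>A weakly decreasing row is determined by the multiset of its entries.\<close>

lemma row_equivalent_eq:
  assumes "row_equivalent x y" and x: "column_strict_pp lam (x \<circ> t)" and y: "column_strict_pp lam (y \<circ> t)"
    and k: "k \<in> A"
  shows "x k = y k"
proof -
  have i: "row k < length lam" using k by (rule row_less)
  have sorted: "sorted (rev (map (\<lambda>j. z (t (row k, j))) [0..<lam ! row k]))"
    if "column_strict_pp lam (z \<circ> t)" for z
    unfolding sorted_wrt_rev
  proof (subst sorted_wrt_map, rule sorted_wrt_mono_rel[OF _ sorted_wrt_upt])
    fix a b assume "a \<in> set [0..<lam ! row k]" "b \<in> set [0..<lam ! row k]" "a < b"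
    then show "z (t (row k, b)) \<le> z (t (row k, a))"
      using that i unfolding column_strict_pp_def by (simp add: diagram_def)
  qed
  have "mset (rev (map (\<lambda>j. x (t (row k, j))) [0..<lam ! row k])) = mset (rev (map (\<lambda>j. y (t (row k, j))) [0..<lam ! row k]))"
    using assms(1) i unfolding row_equivalent_def mset_rev rowset_list[OF i, symmetric] by blast
  then have "rev (map (\<lambda>j. x (t (row k, j))) [0..<lam ! row k]) = rev (map (\<lambda>j. y (t (row k, j))) [0..<lam ! row k])"
    using properties_for_sort[OF _ sorted[OF y]] properties_for_sort[OF refl sorted[OF x]] by metis
  then have "\<forall>j<lam ! row k. x (t (row k, j)) = y (t (row k, j))" by simp
  moreover have "col k < lam ! row k" using cell_in[OF k] by (cases "cell k") (simp add: diagram_def)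
  ultimately have "x (t (row k, col k)) = y (t (row k, col k))" by blast
  then show ?thesis using t_cell[OF k] by simp
qed

definition tabloids :: "nat set list set" where
  "tabloids = {Y. set Y \<subseteq> Pow A \<and> length Y = length lam}"

abbreviation same_rows :: "(nat \<Rightarrow> nat) \<Rightarrow> nat set list \<Rightarrow> (nat \<Rightarrow> nat) \<Rightarrow> bool" where
  "same_rows T Y x \<equiv> \<forall>i<length lam. image_mset x (mset_set (Y ! i)) = image_mset T (mset_set (rowset i))"

text \<open>The homomorphism of James that takes a tabloid \<open>Y\<close> to the sum of all words with the
  same values on each row of \<open>Y\<close> as \<open>T\<close> has on the corresponding row of \<open>t\<close>, counted with
  multiplicity.\<close>

definition james_hom :: "(nat \<Rightarrow> nat) \<Rightarrow> (nat set list \<Rightarrow> complex) \<Rightarrow> (nat \<Rightarrow> nat) \<Rightarrow> complex" where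
  "james_hom T v x = (\<Sum>Y\<in>tabloids. v Y * of_bool (same_rows T Y x))"

lemma finite_tabloids: "finite tabloids"
  unfolding tabloids_def by (rule finite_lists_length_eq) simp

lemma tabloid_perm_tabloids:
  assumes "\<sigma> permutes A" "Y \<in> tabloids"
  shows "tabloid_perm \<sigma> Y \<in> tabloids"
  using assms permutes_image[OF assms(1)] unfolding tabloids_def tabloid_perm_def by auto

lemma image_mset_permuted: "\<sigma> permutes A \<Longrightarrow> image_mset x (mset_set (\<sigma> ` M)) = image_mset (x \<circ> \<sigma>) (mset_set M)"
  by (simp add: image_mset_mset_set[OF permutes_inj_on, symmetric] multiset.map_comp)

lemma intertwiner_james_hom: "intertwiner X (james_hom T)"
  unfolding intertwiner_def
proof (intro conjI ballI allI impI)
  fix x :: "nat \<Rightarrow> nat"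
  show "linear_on (\<lambda>v. james_hom T v x)"
    unfolding linear_on_def james_hom_def
    by (auto simp: sum.distrib sum_distrib_left distrib_right vec_scale_def mult.assoc)
next
  fix \<sigma> :: "nat \<Rightarrow> nat" and v x
  assume \<sigma>: "\<sigma> permutes A"
  have inv\<sigma>: "inv \<sigma> permutes A" using \<sigma> by (rule permutes_inv)
  show "james_hom T (perm_action \<sigma> v) x = james_hom T v (x \<circ> \<sigma>)"
    unfolding james_hom_def perm_action_def
  proof (rule sum.reindex_bij_witness[of _ "tabloid_perm \<sigma>" "tabloid_perm (inv \<sigma>)"])
    fix Y
    show "tabloid_perm \<sigma> (tabloid_perm (inv \<sigma>) Y) = Y" "tabloid_perm (inv \<sigma>) (tabloid_perm \<sigma> Y) = Y"
      by (simp_all add: tabloid_perm_comp[symmetric] permutes_inv_o[OF \<sigma>])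
    assume Y: "Y \<in> tabloids"
    show "tabloid_perm \<sigma> Y \<in> tabloids" "tabloid_perm (inv \<sigma>) Y \<in> tabloids"
      using Y \<sigma> inv\<sigma> tabloid_perm_tabloids by blast+
    have "image_mset (x \<circ> \<sigma>) (mset_set (tabloid_perm (inv \<sigma>) Y ! i)) = image_mset x (mset_set (Y ! i))"
      if "i < length lam" for i
    proof -
      have "tabloid_perm (inv \<sigma>) Y ! i = inv \<sigma> ` (Y ! i)"
        using that Y by (simp add: tabloid_perm_def tabloids_def)
      then show ?thesis
        by (simp add: image_mset_permuted[OF inv\<sigma>] comp_assoc permutes_inv_o[OF \<sigma>])
    qed
    then show "v (tabloid_perm (inv \<sigma>) Y) * of_bool (same_rows T (tabloid_perm (inv \<sigma>) Y) (x \<circ> \<sigma>))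
      = v (tabloid_perm (inv \<sigma>) Y) * of_bool (same_rows T Y x)"
      by simp
  qed
qed

lemma james_hom_e:
  "james_hom T e U = (\<Sum>\<pi>\<in>C. of_int (sign \<pi>) * of_bool (row_equivalent (U \<circ> \<pi>) T))"
proof -
  have "james_hom T e U = (\<Sum>Y\<in>tabloids. \<Sum>\<pi>\<in>C. (if Y = tabloid_perm \<pi> (tabloid lam t) then
     of_int (sign \<pi>) * of_bool (same_rows T Y U) else 0))"
    unfolding james_hom_def polytabloid_def sum_fun_apply sum_distrib_right
    by (intro sum.cong refl) (simp add: vec_scale_def basis_vec_def)
  also have "\<dots> = (\<Sum>\<pi>\<in>C. of_int (sign \<pi>) * of_bool (same_rows T (tabloid_perm \<pi> (tabloid lam t)) U))"
  proof (subst sum.swap, intro sum.cong refl)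
    fix \<pi> assume "\<pi> \<in> C"
    moreover have "tabloid lam t \<in> tabloids" by (auto simp: tabloid_eq tabloids_def)
    ultimately have "tabloid_perm \<pi> (tabloid lam t) \<in> tabloids" using tabloid_perm_tabloids C_permutes by blast
    then show "(\<Sum>Y\<in>tabloids. (if Y = tabloid_perm \<pi> (tabloid lam t) then
     of_int (sign \<pi>) * of_bool (same_rows T Y U) else 0)) =
       (of_int (sign \<pi>) * of_bool (same_rows T (tabloid_perm \<pi> (tabloid lam t)) U) :: complex)"
      by (subst sum.delta[OF finite_tabloids]) simp
  qed
  also have "\<dots> = (\<Sum>\<pi>\<in>C. of_int (sign \<pi>) * of_bool (row_equivalent (U \<circ> \<pi>) T))"
  proof (intro sum.cong refl)
    fix \<pi> assume "\<pi> \<in> C"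
    then have p: "\<pi> permutes A" by (rule C_permutes)
    have "tabloid_perm \<pi> (tabloid lam t) ! i = \<pi> ` rowset i" if "i < length lam" for i
      using that by (simp add: tabloid_perm_def tabloid_eq)
    then show "of_int (sign \<pi>) * of_bool (same_rows T (tabloid_perm \<pi> (tabloid lam t)) U)
      = (of_int (sign \<pi>) * of_bool (row_equivalent (U \<circ> \<pi>) T) :: complex)"
      unfolding row_equivalent_def by (simp add: image_mset_permuted[OF p])
  qed
  finally show ?thesis .
qed

lemma james_hom_self:
  assumes T: "column_strict_pp lam (T \<circ> t)"
  shows "james_hom T e T = 1"
proof -
  have "james_hom T e T = (\<Sum>\<pi>\<in>C. if \<pi> = id then 1 else 0)"
    unfolding james_hom_e
  proof (intro sum.cong refl)
    fix \<pi> assume \<pi>: "\<pi> \<in> C"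
    have "row_equivalent (T \<circ> \<pi>) T \<longleftrightarrow> \<pi> = id"
    proof
      assume "row_equivalent (T \<circ> \<pi>) T"
      from row_equivalent_weight[OF this] show "\<pi> = id" using row_weight_less[OF T \<pi>] by force
    qed (simp add: row_equivalent_def)
    then show "of_int (sign \<pi>) * of_bool (row_equivalent (T \<circ> \<pi>) T) = (if \<pi> = id then 1 else 0 :: complex)"
      by simp
  qed
  then show ?thesis using finite_C id_in_C by simp
qed

text \<open>If \<open>U\<close> occurs, then \<open>T\<close> is row equivalent to a rearrangement of \<open>U\<close> within its columns,
  and such a rearrangement raises \<open>row_weight\<close>.\<close>

lemma james_hom_triangular:
  assumes "column_strict_pp lam (T \<circ> t)" "column_strict_pp lam (U \<circ> t)"
    and "james_hom T e U \<noteq> 0" and "k \<in> A" "U k \<noteq> T k"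
  shows "row_weight U < row_weight T"
proof -
  obtain \<pi> where \<pi>: "\<pi> \<in> C" "row_equivalent (U \<circ> \<pi>) T"
  proof -
    have "\<exists>\<pi>\<in>C. row_equivalent (U \<circ> \<pi>) T"
    proof (rule ccontr)
      assume "\<not> (\<exists>\<pi>\<in>C. row_equivalent (U \<circ> \<pi>) T)"
      then have "james_hom T e U = (\<Sum>\<pi>\<in>C. 0)"
        unfolding james_hom_e by (intro sum.cong refl) auto
      then show False using assms(3) by simp
    qed
    then show ?thesis using that by blast
  qed
  have "\<pi> \<noteq> id" using row_equivalent_eq[of U T k] \<pi>(2) assms by auto
  then have "row_weight U < row_weight (U \<circ> \<pi>)" using row_weight_less assms(2) \<pi>(1) by blast
  then show ?thesis using row_equivalent_weight[OF \<pi>(2)] by simp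
qed

text \<open>Young's rule: the multiplicity of the Specht module in the permutation representation
  on \<open>X\<close> is the number of column-strict fillings in \<open>X\<close>. Injectivity of the evaluation at \<open>e\<close>
  comes from Garnir straightening, surjectivity from the triangularity of the semistandard
  homomorphisms.\<close>

theorem specht_fixed_words:
  fixes X :: "(nat \<Rightarrow> nat) set"
  assumes fin: "finite X" and closed: "\<And>\<sigma> x. \<sigma> permutes A \<Longrightarrow> x \<in> X \<Longrightarrow> x \<circ> \<sigma> \<in> X"
    and support: "\<And>x k. x \<in> X \<Longrightarrow> k \<notin> A \<Longrightarrow> x k = 0"
  shows "(\<Sum>\<sigma> | \<sigma> permutes A. trace_on (specht_module lam) (perm_action \<sigma>) * of_nat (card {x \<in> X. x \<circ> \<sigma> = x}))
    = fact n * of_nat (card {x \<in> X. column_strict_pp lam (x \<circ> t)})"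
proof -
  define K where "K = {x \<in> X. column_strict_pp lam (x \<circ> t)}"
  have finK: "finite K" using fin by (simp add: K_def)
  have surj: "\<exists>\<Psi>. intertwiner X \<Psi> \<and> (\<forall>U\<in>K. \<Psi> e U = (if U = T then 1 else 0))" if "T \<in> K" for T
  proof (rule intertwiner_dual_basis[where \<Theta> = james_hom and rank = row_weight])
    show "finite K" "T \<in> K" by fact+
    show "intertwiner X (james_hom T)" for T by (rule intertwiner_james_hom)
    show "james_hom T e T = 1" if "T \<in> K" for T
      using that by (intro james_hom_self) (simp add: K_def)
    show "row_weight U < row_weight T"
      if TU: "T \<in> K" "U \<in> K" "U \<noteq> T" "james_hom T e U \<noteq> 0" for T U
    proof -
      obtain k where k: "U k \<noteq> T k" using TU(3) by (auto simp: fun_eq_iff)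
      have "T \<in> X" "U \<in> X" using TU by (simp_all add: K_def)
      then have "k \<in> A" using k support[of T k] support[of U k] by metis
      then show ?thesis
        using TU by (intro james_hom_triangular[OF _ _ TU(4) _ k]) (simp_all add: K_def)
    qed
  qed
  have inj: "\<Theta> v x = 0"
    if \<Theta>: "intertwiner X \<Theta>" and zero: "\<forall>T\<in>K. \<Theta> e T = 0" and v: "v \<in> specht_module lam" and x: "x \<in> X" for \<Theta> v x
  proof -
    have K_zero: "\<Theta> e y = 0" if "y \<in> X" "column_strict_pp lam (y \<circ> t)" for y
      using zero that by (simp add: K_def)
    have "\<Theta> e y = 0" if "y \<in> X" for y
      using intertwiner_vanishes[OF fin closed \<Theta> K_zero that] by blast
    then show ?thesis using intertwiner_determined[OF closed \<Theta> _ v x] by blast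
  qed
  have "K \<subseteq> X" by (auto simp: K_def)
  have "(\<Sum>\<sigma> | \<sigma> permutes A. trace_on (specht_module lam) (perm_action \<sigma>) * of_nat (card {x \<in> X. x \<circ> \<sigma> = x}))
    = fact (card A) * of_nat (card K)"
  proof (rule trace_fixed_words[of X K e])
    show "\<Theta> v x = 0"
      if "intertwiner X \<Theta>" "\<forall>T\<in>K. \<Theta> e T = 0" "v \<in> specht_module lam" "x \<in> X" for \<Theta> v x
      using that by (rule inj)
    show "\<exists>\<Theta>. intertwiner X \<Theta> \<and> (\<forall>U\<in>K. \<Theta> e U = (if U = T then 1 else 0))" if "T \<in> K" for T
      using that by (rule surj)
  qed (fact fin closed \<open>K \<subseteq> X\<close> e_in)+
  then show ?thesis by (simp add: K_def)
qed

lemma e_nonzero: "e \<noteq> 0"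
proof
  \<comment> \<open>the simplest column-strict filling, constant along rows\<close>
  define T where "T k = length lam - row k" for k
  have "column_strict_pp lam (T \<circ> t)"
    unfolding column_strict_pp_def T_def by (auto simp: cell_t) (auto simp: diagram_def)
  then have "james_hom T e T = 1" by (rule james_hom_self)
  moreover assume "e = 0"
  ultimately show False by (simp add: james_hom_def)
qed

end

section \<open>Generating functions of words\<close>

lemma has_sum_geometric_product:
  fixes z :: "'a \<Rightarrow> complex"
  assumes "finite I" and less: "\<And>a. a \<in> I \<Longrightarrow> norm (z a) < 1"
  shows "((\<lambda>g. \<Prod>a\<in>I. z a ^ g a) has_sum (\<Prod>a\<in>I. 1 / (1 - z a))) (PiE I (\<lambda>_. UNIV :: nat set))"
proof -
  have abs: "Infinite_Sum.abs_summable_on (\<lambda>k. z a ^ k) UNIV" if "a \<in> I" for a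
    using less[OF that] by (simp add: norm_power summable_on_UNIV_nonneg_real_iff summable_geometric)
  have "Infinite_Set_Sum.abs_summable_on (\<lambda>g. \<Prod>a\<in>I. z a ^ g a) (PiE I (\<lambda>_. UNIV :: nat set))"
    using abs \<open>finite I\<close> by (intro abs_summable_on_prod_PiE) (auto simp: abs_summable_equivalent[symmetric])
  then have "(\<lambda>g. \<Prod>a\<in>I. z a ^ g a) summable_on (PiE I (\<lambda>_. UNIV :: nat set))"
    unfolding abs_summable_equivalent[symmetric] by (rule abs_summable_summable)
  moreover have "infsum (\<lambda>g. \<Prod>a\<in>I. z a ^ g a) (PiE I (\<lambda>_. UNIV :: nat set)) = (\<Prod>a\<in>I. 1 / (1 - z a))"
  proof -
    have "infsum (\<lambda>g. \<Prod>a\<in>I. z a ^ g a) (PiE I (\<lambda>_. UNIV :: nat set)) = (\<Prod>a\<in>I. infsum (\<lambda>k. z a ^ k) UNIV)"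
      using abs by (intro infsum_prod_PiE_abs \<open>finite I\<close>)
    also have "\<dots> = (\<Prod>a\<in>I. 1 / (1 - z a))"
    proof (intro prod.cong refl)
      fix a assume a: "a \<in> I"
      have "((\<lambda>k. z a ^ k) has_sum (1 / (1 - z a))) UNIV"
        using norm_summable_imp_has_sum[OF _ geometric_sums[OF less[OF a]]] less[OF a]
        by (simp add: norm_power summable_geometric)
      then show "infsum (\<lambda>k. z a ^ k) UNIV = 1 / (1 - z a)" by (rule infsumI)
    qed
    finally show ?thesis .
  qed
  ultimately show ?thesis using has_sum_infsum by fastforce
qed

text \<open>Comparing coefficients of \<open>q ^ d\<close> reduces identities between infinite sets of words to
  the finite sets to which \<open>specht_fixed_words\<close> applies.\<close>

lemma has_sum_by_degree:
  fixes q :: complex and deg :: "'x \<Rightarrow> nat"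
  assumes "((\<lambda>x. q ^ deg x) has_sum S) M" and fin: "\<And>d. finite {x \<in> M. deg x = d}"
  shows "((\<lambda>d. of_nat (card {x \<in> M. deg x = d}) * q ^ d) has_sum S) UNIV"
proof -
  have "((\<lambda>(d, x). q ^ d) has_sum S) (SIGMA d:UNIV. {x \<in> M. deg x = d})"
    by (rule has_sum_reindex_bij_witness[of _ "\<lambda>x. (deg x, x)" snd "M" "\<lambda>x. q ^ deg x", THEN iffD2, OF _ _ _ _ _ refl assms(1)]) auto
  then show ?thesis
  proof (rule has_sum_SigmaD)
    fix d :: nat
    show "((\<lambda>y. case (d, y) of (d, x) \<Rightarrow> q ^ d) has_sum of_nat (card {x \<in> M. deg x = d}) * q ^ d) {x \<in> M. deg x = d}"
      using fin[of d] by (intro has_sum_finiteI) auto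
  qed
qed

lemma permutes_orbit:
  assumes "\<sigma> permutes A" "finite A" "k \<in> A"
  shows "k \<in> orbit \<sigma> k" "orbit \<sigma> k \<subseteq> A" "l \<in> orbit \<sigma> k \<longleftrightarrow> l \<in> A \<and> orbit \<sigma> l = orbit \<sigma> k"
proof -
  have p: "permutation \<sigma>" using assms(1,2) by (rule permutes_imp_permutation[rotated])
  show self: "k \<in> orbit \<sigma> k" using p by (rule permutation_self_in_orbit)
  show sub: "orbit \<sigma> k \<subseteq> A" using assms(1,3) by (rule permutes_orbit_subset)
  have "l \<in> orbit \<sigma> l" using p by (rule permutation_self_in_orbit)
  moreover have "orbit \<sigma> l = orbit \<sigma> k" if "l \<in> orbit \<sigma> k"
    using that cyclic_on_orbit[OF assms(1,2)] by (metis orbit_cyclic_eq3)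
  ultimately show "l \<in> orbit \<sigma> k \<longleftrightarrow> l \<in> A \<and> orbit \<sigma> l = orbit \<sigma> k" using sub by blast
qed

text \<open>A word fixed by \<open>\<sigma>\<close> is an arbitrary choice of one value for each cycle, and the value
  on the cycle \<open>B\<close> is counted \<open>card B\<close> times.\<close>

lemma has_sum_fixed_words:
  fixes q :: complex and A :: "'k set"
  assumes \<sigma>: "\<sigma> permutes A" and fin: "finite A" and q: "norm q < 1"
  shows "((\<lambda>x. q ^ sum x A) has_sum (\<Prod>B\<in>orbit \<sigma> ` A. 1 / (1 - q ^ card B)))
    {x :: 'k \<Rightarrow> nat. (\<forall>k. k \<notin> A \<longrightarrow> x k = 0) \<and> x \<circ> \<sigma> = x}"
proof -
  note orbit = permutes_orbit[OF \<sigma> fin]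
  define to_word where "to_word g k = (if k \<in> A then g (orbit \<sigma> k) else (0 :: nat))" for g k
  define from_word where "from_word x = restrict (\<lambda>B. x (SOME k. k \<in> B)) (orbit \<sigma> ` A)" for x :: "'k \<Rightarrow> nat"
  have less: "norm (q ^ card B) < 1" if B: "B \<in> orbit \<sigma> ` A" for B
  proof -
    obtain k where k: "k \<in> A" "B = orbit \<sigma> k" using B by blast
    then have "finite B" "B \<noteq> {}" using orbit(1,2)[OF k(1)] fin finite_subset by auto
    then have "0 < card B" by (simp add: card_gt_0_iff)
    then show ?thesis using q by (simp add: norm_power power_less_one_iff)
  qed
  have some: "(SOME k. k \<in> B) \<in> A \<and> orbit \<sigma> (SOME k. k \<in> B) = B" if B: "B \<in> orbit \<sigma> ` A" for B
  proof -
    obtain k where k: "k \<in> A" "B = orbit \<sigma> k" using B by blast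
    then have "(SOME k. k \<in> B) \<in> B" using orbit(1)[OF k(1)] by (metis someI)
    then show ?thesis using orbit(3)[OF k(1)] k(2) by blast
  qed
  have const: "x l = x k" if "l \<in> orbit \<sigma> k" "x \<circ> \<sigma> = x" for x :: "'k \<Rightarrow> nat" and k l
    using that(1) by induction (metis comp_apply that(2))+
  have "((\<lambda>g. \<Prod>B\<in>orbit \<sigma> ` A. (q ^ card B) ^ g B) has_sum (\<Prod>B\<in>orbit \<sigma> ` A. 1 / (1 - q ^ card B)))
      (PiE (orbit \<sigma> ` A) (\<lambda>_. UNIV))"
    using fin less by (intro has_sum_geometric_product) auto
  also have "?this \<longleftrightarrow> ?thesis"
  proof (rule has_sum_reindex_bij_witness[of _ from_word to_word])
    fix g :: "'k set \<Rightarrow> nat" assume g: "g \<in> PiE (orbit \<sigma> ` A) (\<lambda>_. UNIV)"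
    show "from_word (to_word g) = g"
      using g some by (intro extensionalityI[of _ "orbit \<sigma> ` A"]) (auto simp: from_word_def to_word_def PiE_def)
    have "to_word g (\<sigma> k) = to_word g k" for k
    proof (cases "k \<in> A")
      case True
      have "\<sigma> k \<in> orbit \<sigma> k" by (rule orbit.base)
      then show ?thesis using orbit(3)[OF True, of "\<sigma> k"] True by (simp add: to_word_def)
    qed (simp add: permutes_not_in[OF \<sigma>])
    then show "to_word g \<in> {x. (\<forall>k. k \<notin> A \<longrightarrow> x k = 0) \<and> x \<circ> \<sigma> = x}"
      by (auto simp: to_word_def fun_eq_iff)
    have "sum (to_word g) A = (\<Sum>B\<in>orbit \<sigma> ` A. \<Sum>k\<in>{k \<in> A. orbit \<sigma> k = B}. to_word g k)"
      using fin by (rule sum.image_gen)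
    also have "\<dots> = (\<Sum>B\<in>orbit \<sigma> ` A. card B * g B)"
    proof (intro sum.cong refl)
      fix B assume "B \<in> orbit \<sigma> ` A"
      then obtain k where k: "k \<in> A" "B = orbit \<sigma> k" by blast
      have "{l \<in> A. orbit \<sigma> l = B} = B" using orbit(3)[OF k(1)] k(2) by blast
      moreover have "(\<Sum>l\<in>{l \<in> A. orbit \<sigma> l = B}. to_word g l) = (\<Sum>l\<in>{l \<in> A. orbit \<sigma> l = B}. g B)"
        by (intro sum.cong) (auto simp: to_word_def)
      ultimately show "(\<Sum>l\<in>{l \<in> A. orbit \<sigma> l = B}. to_word g l) = card B * g B" by simp
    qed
    finally show "q ^ sum (to_word g) A = (\<Prod>B\<in>orbit \<sigma> ` A. (q ^ card B) ^ g B)"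
      by (simp add: power_sum power_mult)
  next
    fix x :: "'k \<Rightarrow> nat" assume x: "x \<in> {x. (\<forall>k. k \<notin> A \<longrightarrow> x k = 0) \<and> x \<circ> \<sigma> = x}"
    show "from_word x \<in> PiE (orbit \<sigma> ` A) (\<lambda>_. UNIV)" by (simp add: from_word_def)
    show "to_word (from_word x) = x"
    proof
      fix k
      show "to_word (from_word x) k = x k"
      proof (cases "k \<in> A")
        case True
        have "(SOME l. l \<in> orbit \<sigma> k) \<in> orbit \<sigma> k" using orbit(1)[OF True] by (rule someI)
        then show ?thesis using True const x by (auto simp: to_word_def from_word_def)
      qed (use x in \<open>auto simp: to_word_def\<close>)
    qed
  qed simp
  finally show ?thesis .
qed

definition descending :: "nat \<Rightarrow> nat set \<Rightarrow> (nat \<Rightarrow> nat) set" where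
  "descending n D = {c. (\<forall>i. i \<notin> {1..n} \<longrightarrow> c i = 0) \<and> (\<forall>i. 1 \<le> i \<and> i < n \<longrightarrow> c (i + 1) + of_bool (i \<in> D) \<le> c i)}"

text \<open>A descending sequence is determined by its differences \<open>c k - c (k + 1)\<close>, where
  \<open>c (n + 1) = 0\<close>. These are arbitrary up to the forced steps at \<open>D\<close>, and a unit step at \<open>k\<close>
  adds 1 to each of the first \<open>k\<close> terms.\<close>

lemma has_sum_descending:
  fixes q :: complex
  assumes D: "D \<subseteq> {1..<n}" and q: "norm q < 1"
  shows "((\<lambda>c. q ^ sum c {1..n}) has_sum (q ^ \<Sum> D * (\<Prod>i\<in>{1..n}. 1 / (1 - q ^ i)))) (descending n D)"
proof -
  define step where "step d k = d k + of_bool (k \<in> D)" for d :: "nat \<Rightarrow> nat" and k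
  define to_seq where "to_seq d i = (if i \<in> {1..n} then \<Sum>k\<in>{i..n}. step d k else 0)" for d i
  define from_seq where "from_seq c = restrict (\<lambda>k. c k - c (k + 1) - of_bool (k \<in> D)) {1..n}" for c :: "nat \<Rightarrow> nat"
  have rec: "to_seq d i = to_seq d (i + 1) + step d i" if "i \<in> {1..n}" for d i
  proof -
    have "{i..n} = insert i {i + 1..n}" using that by auto
    then show ?thesis using that by (simp add: to_seq_def)
  qed
  have D_n: "n \<notin> D" using D by auto
  have "((\<lambda>d. \<Prod>k\<in>{1..n}. (q ^ k) ^ d k) has_sum (\<Prod>k\<in>{1..n}. 1 / (1 - q ^ k))) (PiE {1..n} (\<lambda>_. UNIV))"
    using q by (intro has_sum_geometric_product) (auto simp: norm_power power_less_one_iff)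
  then have "((\<lambda>d. q ^ \<Sum> D * (\<Prod>k\<in>{1..n}. (q ^ k) ^ d k)) has_sum
      (q ^ \<Sum> D * (\<Prod>k\<in>{1..n}. 1 / (1 - q ^ k)))) (PiE {1..n} (\<lambda>_. UNIV))"
    by (rule has_sum_cmult_right)
  also have "?this \<longleftrightarrow> ?thesis"
  proof (rule has_sum_reindex_bij_witness[of _ from_seq to_seq])
    fix d :: "nat \<Rightarrow> nat" assume d: "d \<in> PiE {1..n} (\<lambda>_. UNIV)"
    show "from_seq (to_seq d) = d"
    proof (rule extensionalityI[of _ "{1..n}"])
      show "from_seq (to_seq d) k = d k" if "k \<in> {1..n}" for k
        using that by (simp add: from_seq_def rec step_def)
    qed (use d in \<open>auto simp: from_seq_def PiE_def\<close>)
    show "to_seq d \<in> descending n D"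
      unfolding descending_def
    proof (intro CollectI conjI allI impI)
      show "to_seq d i = 0" if "i \<notin> {1..n}" for i using that unfolding to_seq_def by (rule if_not_P)
      show "to_seq d (i + 1) + of_bool (i \<in> D) \<le> to_seq d i" if "1 \<le> i \<and> i < n" for i
        using that by (simp add: rec step_def)
    qed
    have "sum (to_seq d) {1..n} = (\<Sum>i\<in>{1..n}. \<Sum>k\<in>{1..n}. if i \<le> k then step d k else 0)"
    proof (intro sum.cong refl)
      fix i assume i: "i \<in> {1..n}"
      have "{k \<in> {1..n}. i \<le> k} = {i..n}" using i by auto
      then show "to_seq d i = (\<Sum>k\<in>{1..n}. if i \<le> k then step d k else 0)"
        using i by (simp add: to_seq_def sum.inter_filter[symmetric])
    qed
    also have "\<dots> = (\<Sum>k\<in>{1..n}. k * step d k)"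
    proof (subst sum.swap, intro sum.cong refl)
      fix k assume k: "k \<in> {1..n}"
      have "{i \<in> {1..n}. i \<le> k} = {1..k}" using k by auto
      then show "(\<Sum>i\<in>{1..n}. if i \<le> k then step d k else 0) = k * step d k"
        by (simp add: sum.inter_filter[symmetric])
    qed
    also have "\<dots> = (\<Sum>k\<in>{1..n}. k * d k) + (\<Sum>k\<in>{1..n}. k * of_bool (k \<in> D))"
      by (simp add: step_def algebra_simps sum.distrib)
    also have "(\<Sum>k\<in>{1..n}. k * of_bool (k \<in> D)) = \<Sum> D"
      using D by (intro sum.mono_neutral_cong_right) auto
    finally show "q ^ sum (to_seq d) {1..n} = q ^ \<Sum> D * (\<Prod>k\<in>{1..n}. (q ^ k) ^ d k)"
      by (simp add: power_add power_sum power_mult)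
  next
    fix c :: "nat \<Rightarrow> nat" assume c: "c \<in> descending n D"
    show "from_seq c \<in> PiE {1..n} (\<lambda>_. UNIV)" by (simp add: from_seq_def)
    have out: "c i = 0" if "i \<notin> {1..n}" for i using c that unfolding descending_def by blast
    have le: "c (k + 1) + of_bool (k \<in> D) \<le> c k" if "k \<in> {1..n}" for k
    proof (cases "k = n")
      case True
      then show ?thesis using D_n out[of "n + 1"] by simp
    next
      case False
      then show ?thesis using that c by (simp add: descending_def)
    qed
    have step: "step (from_seq c) k = c k - c (k + 1)" if "k \<in> {1..n}" for k
      using that le[OF that] by (simp add: step_def from_seq_def)
    have "to_seq (from_seq c) i = c i" if "i \<le> n + 1" "1 \<le> i" for i
      using that
    proof (induction i rule: inc_induct)
      case base
      then show ?case using out[of "n + 1"] by (simp add: to_seq_def)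
    next
      case (step i)
      then have i: "i \<in> {1..n}" by simp
      have "to_seq (from_seq c) i = c (i + 1) + step (from_seq c) i" using rec[OF i] step.IH step.prems by (simp add: Suc_eq_plus1)
      then show ?case using \<open>i \<in> {1..n}\<close> le[OF i] \<open>\<And>k. k \<in> {1..n} \<Longrightarrow> step (from_seq c) k = c k - c (k + 1)\<close> by simp
    qed
    then show "to_seq (from_seq c) = c"
      using out by (intro ext) (metis atLeastAtMost_iff le_add1 order_trans to_seq_def)
  qed simp
  finally show ?thesis .
qed

section \<open>Standardization\<close>

context shape
begin

definition fillings :: "(nat \<times> nat \<Rightarrow> nat) set" where
  "fillings = {P. (\<forall>c. c \<notin> diagram lam \<longrightarrow> P c = 0) \<and> column_strict_pp lam P}"

text \<open>The order in which the standardization numbers the cells: larger values come first, and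
  equal values, which lie in different columns, are taken from left to right.\<close>

definition before :: "(nat \<times> nat \<Rightarrow> nat) \<Rightarrow> nat \<times> nat \<Rightarrow> nat \<times> nat \<Rightarrow> bool" where
  "before P p q \<longleftrightarrow> P q < P p \<or> P p = P q \<and> snd p < snd q"

definition standardization :: "(nat \<times> nat \<Rightarrow> nat) \<Rightarrow> nat \<times> nat \<Rightarrow> nat" where
  "standardization P = restrict (\<lambda>p. 1 + card {q \<in> diagram lam. before P q p}) (diagram lam)"

lemma column_strict_ppD:
  assumes "column_strict_pp lam P" "(i, j) \<in> diagram lam"
  shows "(i, j') \<in> diagram lam \<Longrightarrow> j < j' \<Longrightarrow> P (i, j') \<le> P (i, j)"
    and "(i', j) \<in> diagram lam \<Longrightarrow> i < i' \<Longrightarrow> P (i', j) < P (i, j)"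
  using assms unfolding column_strict_pp_def by blast+

lemma before_total:
  assumes P: "column_strict_pp lam P" and "p \<in> diagram lam" "q \<in> diagram lam" "p \<noteq> q"
  shows "before P p q \<or> before P q p"
proof (rule ccontr)
  assume "\<not> (before P p q \<or> before P q p)"
  then have eq: "P p = P q" "snd p = snd q" by (auto simp: before_def)
  then have "fst p \<noteq> fst q" using assms(4) by (simp add: prod_eq_iff)
  obtain i i' j where pq: "p = (i, j)" "q = (i', j)" using eq(2) by (cases p, cases q) simp
  have "P (i', j) < P (i, j)" if "i < i'" using column_strict_ppD(2)[OF P] assms(2,3) pq that by blast
  moreover have "P (i, j) < P (i', j)" if "i' < i" using column_strict_ppD(2)[OF P] assms(2,3) pq that by blast
  ultimately show False using eq \<open>fst p \<noteq> fst q\<close> pq by (cases "i < i'") auto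
qed

lemma before_trans: "before P p q \<Longrightarrow> before P q r \<Longrightarrow> before P p r"
  by (auto simp: before_def)

lemma before_irrefl: "\<not> before P p p"
  by (simp add: before_def)

lemma SYT_tableau: "T \<in> SYT lam \<Longrightarrow> tableau_of_shape lam T"
  using partition by unfold_locales (simp_all add: SYT_def)

lemma SYT_bij: "T \<in> SYT lam \<Longrightarrow> bij_betw T (diagram lam) A"
  by (simp add: SYT_def tableaux_def)

lemma SYT_less:
  assumes T: "T \<in> SYT lam" and in_diagram: "(i, j) \<in> diagram lam" "(i', j') \<in> diagram lam"
    and le: "i \<le> i'" "j < j'"
  shows "T (i, j) < T (i', j')"
proof -
  have corner: "(i, j') \<in> diagram lam" using diagram_down[OF in_diagram(2)] le by simp
  have "T (i, j) < T (i, j')" using T in_diagram(1) corner le(2) unfolding SYT_def by blast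
  also have "T (i, j') \<le> T (i', j')"
  proof (cases "i = i'")
    case False
    then have "i < i'" using le(1) by simp
    then have "T (i, j') < T (i', j')" using T in_diagram(2) corner unfolding SYT_def by blast
    then show ?thesis by simp
  qed simp
  finally show ?thesis .
qed

lemma row_of_T: "T \<in> SYT lam \<Longrightarrow> p \<in> diagram lam \<Longrightarrow> row_of lam T (T p) = fst p"
  unfolding row_of_def using SYT_bij by (metis bij_betw_inv_into_left)

lemma T_in: "T \<in> SYT lam \<Longrightarrow> p \<in> diagram lam \<Longrightarrow> 1 \<le> T p \<and> T p \<le> n"
  using SYT_bij bij_betwE by fastforce

lemma descending_antimono:
  assumes c: "c \<in> descending m D" and "a \<le> b" "1 \<le> a" "b \<le> m"
  shows "c b \<le> c a"
  using assms(2,4)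
proof (induction b rule: dec_induct)
  case (step b)
  then have "1 \<le> b \<and> b < m" using assms(3) by simp
  then have "c (b + 1) + of_bool (b \<in> D) \<le> c b" using c unfolding descending_def by blast
  then show ?case using step by (simp add: Suc_eq_plus1)
qed simp

abbreviation compatible :: "(nat \<times> nat \<Rightarrow> nat) \<Rightarrow> (nat \<Rightarrow> nat) set" where
  "compatible T \<equiv> descending n (descents lam T)"

text \<open>Where \<open>c\<close> is constant there is no descent, so larger entries of \<open>T\<close> lie weakly
  higher.\<close>

lemma descending_const_row:
  assumes T: "T \<in> SYT lam" and c: "c \<in> compatible T"
    and "a \<le> b" "1 \<le> a" "b \<le> n" and "c a = c b"
  shows "row_of lam T b \<le> row_of lam T a"
  using assms(3,5,6)
proof (induction b rule: dec_induct)
  case (step b)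
  have le: "c (b + 1) + of_bool (b \<in> descents lam T) \<le> c b"
    using c assms(4) step by (auto simp: descending_def)
  have "c b \<le> c a" using descending_antimono[OF c step(1) assms(4)] step by simp
  then have "c a = c b" and "b \<notin> descents lam T" using le step by (auto simp: Suc_eq_plus1)
  then have "row_of lam T (b + 1) \<le> row_of lam T b"
    using assms(4) step by (auto simp: descents_def)
  also have "\<dots> \<le> row_of lam T a" using step \<open>c a = c b\<close> by simp
  finally show ?case by (simp add: Suc_eq_plus1)
qed simp

definition fill :: "(nat \<times> nat \<Rightarrow> nat) \<Rightarrow> (nat \<Rightarrow> nat) \<Rightarrow> nat \<times> nat \<Rightarrow> nat" where
  "fill T c = (\<lambda>p. if p \<in> diagram lam then c (T p) else 0)"

lemma fill_in_fillings:
  assumes T: "T \<in> SYT lam" and c: "c \<in> compatible T"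
  shows "fill T c \<in> fillings"
proof -
  have mono: "c (T q) \<le> c (T p)" if "p \<in> diagram lam" "q \<in> diagram lam" "T p < T q" for p q
    using descending_antimono[OF c, of "T p" "T q"] T_in[OF T that(1)] T_in[OF T that(2)] that(3) by simp
  have "column_strict_pp lam (fill T c)"
    unfolding column_strict_pp_def
  proof (intro conjI allI impI)
    fix i j j' assume h: "(i, j) \<in> diagram lam \<and> (i, j') \<in> diagram lam \<and> j < j'"
    then have "T (i, j) < T (i, j')" using SYT_less[OF T] by simp
    then show "fill T c (i, j') \<le> fill T c (i, j)" using mono h by (simp add: fill_def)
  next
    fix i i' j assume h: "(i, j) \<in> diagram lam \<and> (i', j) \<in> diagram lam \<and> i < i'"
    then have less: "T (i, j) < T (i', j)" using T unfolding SYT_def by blast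
    have "c (T (i, j)) \<noteq> c (T (i', j))"
    proof
      assume "c (T (i, j)) = c (T (i', j))"
      then have "row_of lam T (T (i', j)) \<le> row_of lam T (T (i, j))"
        using descending_const_row[OF T c] T_in[OF T] h less by (meson less_imp_le)
      then show False using row_of_T[OF T] h by simp
    qed
    then show "fill T c (i', j) < fill T c (i, j)" using mono less h by (simp add: fill_def order.strict_iff_order)
  qed
  then show ?thesis by (auto simp: fillings_def fill_def)
qed

text \<open>Among the cells with the same value, \<open>descending_const_row\<close> says that larger entries of
  \<open>T\<close> are weakly higher; in a standard tableau they must then be further to the right.\<close>

lemma fill_before:
  assumes T: "T \<in> SYT lam" and c: "c \<in> compatible T"
    and p: "p \<in> diagram lam" and q: "q \<in> diagram lam"
  shows "before (fill T c) p q \<longleftrightarrow> T p < T q"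
proof -
  have less: "T p < T q"
    if p: "p \<in> diagram lam" and q: "q \<in> diagram lam" and "before (fill T c) p q" for p q
  proof (rule ccontr)
    assume "\<not> T p < T q"
    then have le: "T q \<le> T p" by simp
    then have "c (T p) \<le> c (T q)"
      using descending_antimono[OF c le] T_in[OF T p] T_in[OF T q] by simp
    then have eq: "c (T q) = c (T p)" and col: "snd p < snd q"
      using that(3) p q by (auto simp: before_def fill_def)
    have "row_of lam T (T p) \<le> row_of lam T (T q)"
      using descending_const_row[OF T c le _ _ eq] T_in[OF T p] T_in[OF T q] by simp
    then have "fst p \<le> fst q" using row_of_T[OF T] p q by simp
    then have "T p < T q" using SYT_less[OF T, of "fst p" "snd p" "fst q" "snd q"] p q col by simp
    then show False using le by simp
  qed
  have "column_strict_pp lam (fill T c)" using fill_in_fillings[OF T c] by (simp add: fillings_def)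
  show ?thesis
  proof
    assume "T p < T q"
    then have "p \<noteq> q" by auto
    then have "before (fill T c) p q \<or> before (fill T c) q p"
      using before_total \<open>column_strict_pp lam (fill T c)\<close> p q by blast
    then show "before (fill T c) p q" using less[OF q p] \<open>T p < T q\<close> by auto
  qed (use less p q in blast)
qed

lemma standardization_fill:
  assumes T: "T \<in> SYT lam" and c: "c \<in> compatible T"
  shows "standardization (fill T c) = T"
proof (rule extensionalityI[of _ "diagram lam"])
  show "T \<in> extensional (diagram lam)" using T by (simp add: SYT_def tableaux_def)
  show "standardization (fill T c) \<in> extensional (diagram lam)" by (simp add: standardization_def)
  fix p assume p: "p \<in> diagram lam"
  have inj: "inj_on T (diagram lam)" using SYT_bij[OF T] by (rule bij_betw_imp_inj_on)
  have "card {q \<in> diagram lam. before (fill T c) q p} = card {q \<in> diagram lam. T q < T p}"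
    using fill_before[OF T c _ p] by (metis (lifting))
  also have "\<dots> = card (T ` {q \<in> diagram lam. T q < T p})"
    using inj by (intro card_image[symmetric]) (auto intro: inj_on_subset)
  also have "T ` {q \<in> diagram lam. T q < T p} = {1..<T p}"
  proof (intro set_eqI iffI)
    fix k assume "k \<in> {1..<T p}"
    moreover have "k \<in> T ` diagram lam" if "k \<in> A" for k
      using that SYT_bij[OF T] by (simp add: bij_betw_def)
    ultimately have "k \<in> T ` diagram lam" using T_in[OF T p] by simp
    then show "k \<in> T ` {q \<in> diagram lam. T q < T p}" using \<open>k \<in> {1..<T p}\<close> by auto
  qed (use T_in[OF T] in auto)
  finally show "standardization (fill T c) p = T p"
    using T_in[OF T p] p by (simp add: standardization_def)
qed

lemma standardization_less:
  assumes "p \<in> diagram lam" "q \<in> diagram lam" "before P p q"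
  shows "standardization P p < standardization P q"
proof -
  have "{r \<in> diagram lam. before P r p} \<subset> {r \<in> diagram lam. before P r q}"
    using assms before_trans before_irrefl by blast
  then have "card {r \<in> diagram lam. before P r p} < card {r \<in> diagram lam. before P r q}"
    using finite_diagram by (intro psubset_card_mono) auto
  then show ?thesis using assms by (simp add: standardization_def)
qed

lemma standardization_SYT:
  assumes P: "column_strict_pp lam P"
  shows "standardization P \<in> SYT lam"
proof -
  have inj: "inj_on (standardization P) (diagram lam)"
    using before_total[OF P] standardization_less by (metis inj_onI less_irrefl)
  have "standardization P ` diagram lam \<subseteq> A"
  proof
    fix k assume "k \<in> standardization P ` diagram lam"
    then obtain p where p: "p \<in> diagram lam" "k = standardization P p" by blast
    have "{q \<in> diagram lam. before P q p} \<subset> diagram lam" using p before_irrefl by blast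
    then have "card {q \<in> diagram lam. before P q p} < n"
      using psubset_card_mono[OF finite_diagram] card_diagram by metis
    then show "k \<in> A" using p by (simp add: standardization_def)
  qed
  moreover have "card (standardization P ` diagram lam) = card A"
    using card_image[OF inj] card_diagram by simp
  ultimately have "standardization P ` diagram lam = A" by (intro card_subset_eq) auto
  then have "standardization P \<in> tableaux lam"
    using inj by (simp add: tableaux_def bij_betw_def standardization_def)
  moreover have "standardization P (i, j) < standardization P (i, j')"
    if "(i, j) \<in> diagram lam" "(i, j') \<in> diagram lam" "j < j'" for i j j'
  proof (rule standardization_less[OF that(1,2)])
    show "before P (i, j) (i, j')" using column_strict_ppD(1)[OF P that] that(3) by (auto simp: before_def)
  qed
  moreover have "standardization P (i, j) < standardization P (i', j)"
    if "(i, j) \<in> diagram lam" "(i', j) \<in> diagram lam" "i < i'" for i i' j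
  proof (rule standardization_less[OF that(1,2)])
    show "before P (i, j) (i', j)" using column_strict_ppD(2)[OF P that] by (auto simp: before_def)
  qed
  ultimately show ?thesis unfolding SYT_def by blast
qed

definition values_of :: "(nat \<times> nat \<Rightarrow> nat) \<Rightarrow> nat \<Rightarrow> nat" where
  "values_of P i = (if i \<in> A then P (inv_into (diagram lam) (standardization P) i) else 0)"

text \<open>The point is strictness at a descent \<open>i\<close>. If \<open>i\<close> and \<open>i + 1\<close> had the same value, then
  \<open>i + 1\<close> would lie strictly below and strictly to the right of \<open>i\<close>. The cell in the row of \<open>i\<close>
  and the column of \<open>i + 1\<close> would have at most the value of \<open>i\<close> but more than the value of
  \<open>i + 1\<close>.\<close>

lemma values_of_standardization:
  assumes P: "P \<in> fillings"
  shows "values_of P \<in> descending n (descents lam (standardization P))"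
    and "fill (standardization P) (values_of P) = P"
proof -
  have csp: "column_strict_pp lam P" using P by (simp add: fillings_def)
  define T where "T = standardization P"
  have T: "T \<in> SYT lam" unfolding T_def using csp by (rule standardization_SYT)
  interpret tableau_of_shape lam T using T by (rule SYT_tableau)
  have val: "values_of P i = P (cell i)" if "i \<in> A" for i
    using that unfolding values_of_def T_def[symmetric] cell_def by simp
  have "fill T (values_of P) p = P p" for p
  proof (cases "p \<in> diagram lam")
    case True
    then show ?thesis using val[OF t_in[OF True]] cell_t[OF True] by (simp add: fill_def)
  next
    case False
    then show ?thesis using P by (cases p) (simp add: fill_def fillings_def)
  qed
  then show "fill (standardization P) (values_of P) = P" unfolding T_def by blast
  have "values_of P (i + 1) + of_bool (i \<in> descents lam T) \<le> values_of P i" if i: "1 \<le> i \<and> i < n" for i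
  proof -
    have iA: "i \<in> A" "i + 1 \<in> A" using i by auto
    note d = cell_in[OF iA(1)] cell_in[OF iA(2)]
    have "T (cell i) < T (cell (i + 1))" using t_cell[OF iA(1)] t_cell[OF iA(2)] by simp
    then have bef: "before P (cell i) (cell (i + 1))"
      using before_total[OF csp d] standardization_less[OF d(2,1), of P] unfolding T_def[symmetric]
      by (metis less_asym less_irrefl)
    have "P (cell (i + 1)) \<noteq> P (cell i)" if desc: "i \<in> descents lam T"
    proof
      assume eq: "P (cell (i + 1)) = P (cell i)"
      then have col: "col i < col (i + 1)" using bef by (simp add: before_def)
      have row: "row i < row (i + 1)" using desc by (simp add: descents_def row_of_def cell_def)
      have corner: "(row i, col (i + 1)) \<in> diagram lam"
        using diagram_down[of "row (i + 1)" "col (i + 1)"] d(2) row by simp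
      have "P (row (i + 1), col (i + 1)) < P (row i, col (i + 1))"
        using column_strict_ppD(2)[OF csp corner _ row] d(2) by simp
      also have "\<dots> \<le> P (row i, col i)"
        using column_strict_ppD(1)[OF csp _ corner col] d(1) by simp
      finally show False using eq by simp
    qed
    then show ?thesis using val[OF iA(1)] val[OF iA(2)] bef by (auto simp: before_def)
  qed
  then show "values_of P \<in> descending n (descents lam (standardization P))"
    unfolding descending_def T_def by (auto simp: values_of_def)
qed

lemma values_of_fill:
  assumes T: "T \<in> SYT lam" and c: "c \<in> compatible T"
  shows "values_of (fill T c) = c"
proof
  fix i
  interpret tableau_of_shape lam T using T by (rule SYT_tableau)
  show "values_of (fill T c) i = c i"
  proof (cases "i \<in> A")
    case True
    then have "values_of (fill T c) i = fill T c (cell i)"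
      unfolding values_of_def standardization_fill[OF T c] cell_def by simp
    then show ?thesis using cell_in[OF True] t_cell[OF True] by (simp add: fill_def)
  next
    case False
    then show ?thesis using c unfolding values_of_def descending_def by (metis (mono_tags, lifting) mem_Collect_eq)
  qed
qed

abbreviation fillings_of :: "nat \<Rightarrow> (nat \<times> nat \<Rightarrow> nat) set" where
  "fillings_of d \<equiv> {P \<in> fillings. sum P (diagram lam) = d}"

abbreviation sequences_of :: "(nat \<times> nat \<Rightarrow> nat) \<Rightarrow> nat \<Rightarrow> (nat \<Rightarrow> nat) set" where
  "sequences_of T d \<equiv> {c \<in> compatible T. sum c A = d}"

text \<open>The decomposition of column-strict plane partitions by their standardization (an
  instance of Stanley's theory of \<open>P\<close>-partitions).\<close>

theorem bij_fill:
  "bij_betw (\<lambda>(T, c). fill T c) (SIGMA T:SYT lam. sequences_of T d) (fillings_of d)"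
proof (rule bij_betw_byWitness[where f' = "\<lambda>P. (standardization P, values_of P)"])
  have sum_fill: "sum (fill T c) (diagram lam) = sum c A" if "T \<in> SYT lam" for T c
    using sum.reindex_bij_betw[OF SYT_bij[OF that], of c] by (simp add: fill_def)
  show "\<forall>a\<in>SIGMA T:SYT lam. sequences_of T d.
      (standardization (case a of (T, c) \<Rightarrow> fill T c), values_of (case a of (T, c) \<Rightarrow> fill T c)) = a"
    using standardization_fill values_of_fill by auto
  show "\<forall>P\<in>fillings_of d. (case (standardization P, values_of P) of (T, c) \<Rightarrow> fill T c) = P"
    using values_of_standardization(2) by auto
  show "(\<lambda>(T, c). fill T c) ` (SIGMA T:SYT lam. sequences_of T d) \<subseteq> fillings_of d"
    using fill_in_fillings sum_fill by auto
  show "(\<lambda>P. (standardization P, values_of P)) ` fillings_of d \<subseteq> (SIGMA T:SYT lam. sequences_of T d)"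
  proof
    fix z assume "z \<in> (\<lambda>P. (standardization P, values_of P)) ` fillings_of d"
    then obtain P where P: "P \<in> fillings" "sum P (diagram lam) = d" "z = (standardization P, values_of P)" by blast
    have "standardization P \<in> SYT lam" using P(1) by (intro standardization_SYT) (simp add: fillings_def)
    then show "z \<in> (SIGMA T:SYT lam. sequences_of T d)"
      using P values_of_standardization[OF P(1)] sum_fill[of "standardization P" "values_of P"] by simp
  qed
qed

lemma finite_SYT: "finite (SYT lam)"
  using finite_tableaux by (rule finite_subset[rotated]) (auto simp: SYT_def)

definition words :: "nat \<Rightarrow> (nat \<Rightarrow> nat) set" where
  "words d = {x. (\<forall>k. k \<notin> A \<longrightarrow> x k = 0) \<and> sum x A = d}"

lemma finite_words: "finite (words d)"
proof (rule finite_subset)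
  show "words d \<subseteq> {x. \<forall>k. (k \<in> A \<longrightarrow> x k \<in> {..d}) \<and> (k \<notin> A \<longrightarrow> x k = 0)}"
  proof (intro subsetI CollectI allI conjI impI)
    fix x k assume x: "x \<in> words d"
    show "x k = 0" if "k \<notin> A" using x that by (simp add: words_def)
    assume k: "k \<in> A"
    have "x k \<le> sum x A" using k by (intro member_le_sum) auto
    then show "x k \<in> {..d}" using x by (simp add: words_def)
  qed
  show "finite {x. \<forall>k. (k \<in> A \<longrightarrow> x k \<in> {..d}) \<and> (k \<notin> A \<longrightarrow> x k = (0::nat))}"
    by (rule finite_set_of_finite_funs) auto
qed

lemma words_closed: "\<sigma> permutes A \<Longrightarrow> x \<in> words d \<Longrightarrow> x \<circ> \<sigma> \<in> words d"
  using sum.permute[of \<sigma> A x] by (auto simp: words_def permutes_not_in)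

end

abbreviation (in tableau_of_shape) strict_words :: "nat \<Rightarrow> (nat \<Rightarrow> nat) set" where
  "strict_words d \<equiv> {x \<in> words d. column_strict_pp lam (x \<circ> t)}"

lemma (in tableau_of_shape) card_column_strict_words:
  "card (strict_words d) = (\<Sum>T\<in>SYT lam. card (sequences_of T d))"
proof -
  have cong: "column_strict_pp lam P \<longleftrightarrow> column_strict_pp lam Q"
    if "\<And>c. c \<in> diagram lam \<Longrightarrow> P c = Q c" for P Q
    unfolding column_strict_pp_def
    by (intro arg_cong2[where f = "(\<and>)"] iff_allI imp_cong refl) (simp_all add: that)
  have "bij_betw (\<lambda>x p. if p \<in> diagram lam then x (t p) else 0)
      (strict_words d) (fillings_of d)"
  proof (rule bij_betw_byWitness[where f' = "\<lambda>P k. if k \<in> A then P (cell k) else 0"])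
    show "\<forall>x\<in>strict_words d.
        (\<lambda>k. if k \<in> A then if cell k \<in> diagram lam then x (t (cell k)) else 0 else 0) = x"
      using cell_in t_cell by (auto simp: words_def fun_eq_iff)
    show "\<forall>P\<in>fillings_of d.
        (\<lambda>p. if p \<in> diagram lam then if t p \<in> A then P (cell (t p)) else 0 else 0) = P"
      using cell_t t_in by (auto simp: fillings_def fun_eq_iff)
    show "(\<lambda>x p. if p \<in> diagram lam then x (t p) else 0) ` strict_words d \<subseteq> fillings_of d"
    proof (rule image_subsetI)
      fix x assume x: "x \<in> strict_words d"
      have "column_strict_pp lam (\<lambda>p. if p \<in> diagram lam then x (t p) else 0)"
        using x cong[of "x \<circ> t" "\<lambda>p. if p \<in> diagram lam then x (t p) else 0"] by simp
      moreover have "(\<Sum>p\<in>diagram lam. if p \<in> diagram lam then x (t p) else 0) = d"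
        using x sum.reindex_bij_betw[OF bij_t, of x] by (simp add: words_def)
      ultimately show "(\<lambda>p. if p \<in> diagram lam then x (t p) else 0) \<in> fillings_of d"
        by (simp add: fillings_def)
    qed
    show "(\<lambda>P k. if k \<in> A then P (cell k) else 0) ` fillings_of d \<subseteq> strict_words d"
    proof (rule image_subsetI)
      fix P assume P: "P \<in> fillings_of d"
      define x where "x k = (if k \<in> A then P (cell k) else 0)" for k
      have xt: "x (t p) = P p" if "p \<in> diagram lam" for p using t_in[OF that] cell_t[OF that] by (simp add: x_def)
      have "column_strict_pp lam (x \<circ> t)" using P cong[of "x \<circ> t" P] xt by (simp add: fillings_def)
      moreover have "sum x A = d" using P xt sum.reindex_bij_betw[OF bij_t, of x] by simp
      ultimately have "x \<in> strict_words d" by (simp add: words_def x_def)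
      then show "(\<lambda>k. if k \<in> A then P (cell k) else 0) \<in> strict_words d"
        unfolding x_def .
    qed
  qed
  then have "card (strict_words d) = card (fillings_of d)"
    by (rule bij_betw_same_card)
  also have "\<dots> = card (SIGMA T:SYT lam. sequences_of T d)"
    using bij_betw_same_card[OF bij_fill] by simp
  also have "\<dots> = (\<Sum>T\<in>SYT lam. card (sequences_of T d))"
  proof (rule card_SigmaI[OF finite_SYT], rule ballI)
    fix T
    show "finite (sequences_of T d)"
      by (rule finite_subset[OF _ finite_words[of d]]) (auto simp: descending_def words_def)
  qed
  finally show ?thesis .
qed

context shape
begin

definition character :: "(nat \<Rightarrow> nat) \<Rightarrow> complex" where
  "character \<sigma> = trace_on (specht_module lam) (perm_action \<sigma>)"

abbreviation cycle_product :: "(nat \<Rightarrow> nat) \<Rightarrow> complex \<Rightarrow> complex" where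
  "cycle_product \<sigma> q \<equiv> (\<Prod>B\<in>orbit \<sigma> ` A. 1 / (1 - q ^ card B))"

text \<open>The coefficient of \<open>q ^ d\<close> on either side is \<open>n!\<close> times the multiplicity of the Specht
  module in the homogeneous polynomials of degree \<open>d\<close> in \<open>n\<close> variables, whose monomials are the
  elements of \<open>words d\<close>. On the left it is computed from characters, on the right from
  column-strict plane partitions.\<close>

theorem major_index_identity:
  fixes q :: complex
  assumes q: "norm q < 1"
  shows "(\<Sum>\<sigma> | \<sigma> permutes A. character \<sigma> * cycle_product \<sigma> q)
    = fact n * (\<Sum>T\<in>SYT lam. q ^ maj lam T) * (\<Prod>i\<in>A. 1 / (1 - q ^ i))"
proof -
  obtain t where "t \<in> tableaux lam" using tableaux_nonempty by blast
  then interpret tableau_of_shape lam t by unfold_locales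
  define cw where "cw \<sigma> d = card {x \<in> words d. x \<circ> \<sigma> = x}" for \<sigma> :: "nat \<Rightarrow> nat" and d
  define cs where "cs T d = card (sequences_of T d)" for T d
  have words: "(\<lambda>d. of_nat (cw \<sigma> d) * q ^ d) sums cycle_product \<sigma> q"
    if \<sigma>: "\<sigma> permutes A" for \<sigma>
  proof -
    define M where "M = {x :: nat \<Rightarrow> nat. (\<forall>k. k \<notin> A \<longrightarrow> x k = 0) \<and> x \<circ> \<sigma> = x}"
    have eq: "{x \<in> M. sum x A = d} = {x \<in> words d. x \<circ> \<sigma> = x}" for d
      by (auto simp: M_def words_def)
    have "((\<lambda>x. q ^ sum x A) has_sum cycle_product \<sigma> q) M"
      unfolding M_def using \<sigma> q by (intro has_sum_fixed_words) auto
    from has_sum_by_degree[OF this]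
    have "((\<lambda>d. of_nat (cw \<sigma> d) * q ^ d) has_sum cycle_product \<sigma> q) UNIV"
      unfolding eq cw_def using finite_words by simp
    then show ?thesis by (rule has_sum_imp_sums)
  qed
  have desc: "(\<lambda>d. of_nat (cs T d) * q ^ d) sums (q ^ maj lam T * (\<Prod>i\<in>A. 1 / (1 - q ^ i)))" for T
  proof -
    have D: "descents lam T \<subseteq> {1..<n}" by (auto simp: descents_def)
    have fin: "finite (sequences_of T d)" for d
      by (rule finite_subset[OF _ finite_words[of d]]) (auto simp: descending_def words_def)
    have "((\<lambda>d. of_nat (cs T d) * q ^ d) has_sum (q ^ maj lam T * (\<Prod>i\<in>A. 1 / (1 - q ^ i)))) UNIV"
      unfolding cs_def maj_def by (rule has_sum_by_degree[OF has_sum_descending[OF D q] fin])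
    then show ?thesis by (rule has_sum_imp_sums)
  qed
  have "(\<lambda>d. \<Sum>\<sigma> | \<sigma> permutes A. character \<sigma> * (of_nat (cw \<sigma> d) * q ^ d))
      sums (\<Sum>\<sigma> | \<sigma> permutes A. character \<sigma> * cycle_product \<sigma> q)"
    using words by (intro sums_sum sums_mult) auto
  moreover have "(\<Sum>\<sigma> | \<sigma> permutes A. character \<sigma> * (of_nat (cw \<sigma> d) * q ^ d))
      = fact n * (\<Sum>T\<in>SYT lam. of_nat (cs T d) * q ^ d)" for d
  proof -
    have "(\<Sum>\<sigma> | \<sigma> permutes A. character \<sigma> * (of_nat (cw \<sigma> d) * q ^ d))
        = (\<Sum>\<sigma> | \<sigma> permutes A. character \<sigma> * of_nat (cw \<sigma> d)) * q ^ d"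
      by (simp add: sum_distrib_right mult.assoc)
    also have "(\<Sum>\<sigma> | \<sigma> permutes A. character \<sigma> * of_nat (cw \<sigma> d))
        = fact n * of_nat (card (strict_words d))"
      unfolding character_def cw_def
      by (rule specht_fixed_words[OF finite_words words_closed]) (auto simp: words_def)
    also have "of_nat (card (strict_words d)) = (\<Sum>T\<in>SYT lam. of_nat (cs T d) :: complex)"
      unfolding card_column_strict_words cs_def by simp
    finally show ?thesis by (simp add: sum_distrib_right mult.assoc)
  qed
  moreover have "(\<lambda>d. fact n * (\<Sum>T\<in>SYT lam. of_nat (cs T d) * q ^ d))
      sums (fact n * (\<Sum>T\<in>SYT lam. q ^ maj lam T * (\<Prod>i\<in>A. 1 / (1 - q ^ i))))"
    using desc by (intro sums_mult sums_sum)
  ultimately have "(\<Sum>\<sigma> | \<sigma> permutes A. character \<sigma> * cycle_product \<sigma> q)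
     = fact n * (\<Sum>T\<in>SYT lam. q ^ maj lam T * (\<Prod>i\<in>A. 1 / (1 - q ^ i)))"
    by (simp add: sums_unique2)
  then show ?thesis by (simp add: sum_distrib_right mult.assoc)
qed

end

section \<open>Roots of unity and Ramanujan sums\<close>

definition primitive_root :: "nat \<Rightarrow> complex \<Rightarrow> bool" where
  "primitive_root l \<omega> \<longleftrightarrow> (\<forall>k. \<omega> ^ k = 1 \<longleftrightarrow> l dvd k)"

lemma primitive_rootD: "primitive_root l \<omega> \<Longrightarrow> \<omega> ^ k = 1 \<longleftrightarrow> l dvd k"
  by (simp add: primitive_root_def)

lemma ex_primitive_root:
  assumes "l \<ge> 1"
  obtains \<omega> where "primitive_root l \<omega>"
proof
  show "primitive_root l (exp (2 * of_real pi * \<i> / of_nat l))"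
    unfolding primitive_root_def
  proof
    fix k
    have "exp (2 * of_real pi * \<i> / of_nat l) ^ k = exp (2 * of_real pi * \<i> * of_nat k / of_nat l)"
      by (simp add: exp_of_nat_mult[symmetric] field_simps)
    then show "exp (2 * of_real pi * \<i> / of_nat l) ^ k = 1 \<longleftrightarrow> l dvd k"
      using complex_root_unity_eq_1[OF assms, of k] by simp
  qed
qed

lemma primitive_root_power:
  assumes \<omega>: "primitive_root n \<omega>" and n: "n > 0"
  shows "primitive_root (n div gcd s n) (\<omega> ^ s)"
  unfolding primitive_root_def
proof
  fix k
  define g where "g = gcd s n"
  have g: "g > 0" using n by (simp add: g_def)
  obtain a b where ab: "s = a * g" "n = b * g" "coprime a b"
    using gcd_coprime_exists[of s n] n unfolding g_def by auto
  have "(\<omega> ^ s) ^ k = 1 \<longleftrightarrow> n dvd s * k"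
    using primitive_rootD[OF \<omega>] by (simp add: power_mult[symmetric])
  also have "\<dots> \<longleftrightarrow> b dvd a * k" using g by (simp add: ab mult.commute mult.left_commute)
  also have "\<dots> \<longleftrightarrow> b dvd k" using ab(3) by (simp add: coprime_commute coprime_dvd_mult_right_iff)
  finally show "(\<omega> ^ s) ^ k = 1 \<longleftrightarrow> n div gcd s n dvd k"
    using g unfolding g_def[symmetric] by (simp add: ab(2))
qed

lemma primitive_root_power_div:
  assumes "primitive_root n \<omega>" "n > 0" "d dvd n"
  shows "primitive_root d (\<omega> ^ (n div d))"
proof -
  obtain q where q: "n = d * q" using assms(3) by blast
  then have "d > 0" "q > 0" using assms(2) by simp_all
  then have "n div d = q" "n div gcd q n = d" using q by simp_all
  then show ?thesis using primitive_root_power[OF assms(1,2), of q] by simp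
qed

lemma primitive_root_power_coprime:
  assumes "primitive_root n \<omega>" "n > 0" "coprime s n"
  shows "primitive_root n (\<omega> ^ s)"
  using primitive_root_power[OF assms(1,2), of s] assms(3) by (simp add: coprime_iff_gcd_eq_1)

lemma sum_powers_primitive_root:
  assumes \<omega>: "primitive_root n \<omega>"
  shows "(\<Sum>s\<in>{0<..n}. (\<omega> ^ k) ^ s) = (if n dvd k then of_nat n else 0)"
proof (cases "n dvd k")
  case True
  then have "\<omega> ^ k = 1" using primitive_rootD[OF \<omega>] by simp
  then show ?thesis using True by simp
next
  case False
  then have z: "\<omega> ^ k \<noteq> 1" using primitive_rootD[OF \<omega>] by simp
  have "(\<omega> ^ k) ^ n = 1" using primitive_rootD[OF \<omega>, of "k * n"] by (simp add: power_mult)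
  then have "(\<Sum>s<n. (\<omega> ^ k) ^ s) = 0" using z by (simp add: geometric_sum)
  moreover have "(\<Sum>s\<in>{0<..n}. (\<omega> ^ k) ^ s) = (\<omega> ^ k) * (\<Sum>s<n. (\<omega> ^ k) ^ s)"
  proof -
    have "(\<Sum>s\<in>{0<..n}. (\<omega> ^ k) ^ s) = (\<Sum>s<n. (\<omega> ^ k) ^ Suc s)"
      by (rule sum.reindex_bij_witness[of _ Suc "\<lambda>s. s - 1"]) (auto simp: One_nat_def)
    then show ?thesis by (simp add: sum_distrib_left)
  qed
  ultimately show ?thesis using False by simp
qed

lemma sum_group_by_gcd:
  fixes f :: "nat \<Rightarrow> 'a :: comm_monoid_add"
  assumes "n > 0"
  shows "(\<Sum>s\<in>{0<..n}. f s) = (\<Sum>l | l dvd n. \<Sum>j\<in>totatives l. f (j * (n div l)))"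
proof -
  have "(\<Sum>s\<in>{0<..n}. f s) = (\<Sum>d | d dvd n. \<Sum>s\<in>{s \<in> {0<..n}. gcd s n = d}. f s)"
    using assms by (intro sum.group[symmetric]) auto
  also have "\<dots> = (\<Sum>d | d dvd n. \<Sum>j\<in>totatives (n div d). f (j * d))"
  proof (rule sum.cong[OF refl])
    fix d assume "d \<in> {d. d dvd n}"
    then have "d dvd n" by simp
    from sum.reindex_bij_betw[OF bij_betw_totatives_gcd_eq[OF this assms], of f]
    show "(\<Sum>s\<in>{s \<in> {0<..n}. gcd s n = d}. f s) = (\<Sum>j\<in>totatives (n div d). f (j * d))" ..
  qed
  also have "\<dots> = (\<Sum>l | l dvd n. \<Sum>j\<in>totatives l. f (j * (n div l)))"
    by (rule sum.reindex_bij_witness[of _ "\<lambda>l. n div l" "\<lambda>l. n div l"]) (use assms in auto)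
  finally show ?thesis .
qed

lemma moebius_prime_mult:
  assumes p: "prime p" "\<not> p dvd d" and d: "d > 0"
  shows "moebius (p * d) = - moebius d"
proof -
  have cop: "coprime p d" using p by (simp add: prime_imp_coprime)
  have "squarefree (p * d) \<longleftrightarrow> squarefree d"
    using squarefree_mult_coprime[OF cop squarefree_prime] squarefree_multD(2)[of p d] p by auto
  moreover have "prime_factors (p * d) = insert p (prime_factors d)"
    using p d by (subst prime_factors_product) (auto simp: prime_factorization_prime)
  moreover have "p \<notin> prime_factors d" using p(2) by auto
  ultimately show ?thesis by (simp add: moebius_def)
qed

text \<open>For a prime \<open>p\<close> dividing \<open>n\<close>, the squarefree divisors prime to \<open>p\<close> cancel against their
  products with \<open>p\<close>.\<close>

lemma sum_moebius_divisors:
  assumes "n > 0"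
  shows "(\<Sum>d | d dvd n. moebius d) = (if n = 1 then 1 else 0)"
proof (cases "n = 1")
  case True
  then show ?thesis by (simp add: moebius_def)
next
  case False
  then obtain p where p: "prime p" "p dvd n" using prime_factor_nat by blast
  define E where "E = {d. d dvd n \<and> squarefree d \<and> \<not> p dvd d}"
  define F where "F = {d. d dvd n \<and> squarefree d \<and> p dvd d}"
  have fin: "finite {d. d dvd n}" using assms by simp
  have "(\<Sum>d | d dvd n. moebius d) = (\<Sum>d\<in>E \<union> F. moebius d)"
    using fin by (intro sum.mono_neutral_right) (auto simp: E_def F_def moebius_def)
  also have "\<dots> = (\<Sum>d\<in>E. moebius d) + (\<Sum>d\<in>F. moebius d)"
    using fin by (intro sum.union_disjoint) (auto simp: E_def F_def)
  also have "(\<Sum>d\<in>F. moebius d) = (\<Sum>d\<in>E. - moebius d)"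
  proof (rule sum.reindex_bij_witness[of _ "\<lambda>d. p * d" "\<lambda>d. d div p"])
    fix d assume d: "d \<in> F"
    then obtain e where e: "d = p * e" by (auto simp: F_def)
    have p0: "p > 0" using p(1) prime_gt_0_nat by blast
    have sq: "squarefree (p * e)" using d e by (simp add: F_def)
    have "\<not> p dvd e"
    proof
      assume "p dvd e"
      then have "p ^ 2 dvd p * e" by (simp add: power2_eq_square)
      then have "p dvd 1" using sq unfolding squarefree_def by blast
      then show False using p(1) by (simp add: One_nat_def)
    qed
    moreover have "e dvd n" using d e by (auto simp: F_def dest: dvd_mult_right)
    moreover have "squarefree e" using sq by (rule squarefree_multD)
    ultimately show "d div p \<in> E" using e p0 by (simp add: E_def)
    show "p * (d div p) = d" using e p0 by simp
    have "e > 0" using \<open>e dvd n\<close> assms by (auto intro: Nat.gr0I)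
    then show "- moebius (d div p) = moebius d"
      using moebius_prime_mult[OF p(1) \<open>\<not> p dvd e\<close>] e p0 by simp
  next
    fix d assume d: "d \<in> E"
    have p0: "p > 0" using p(1) prime_gt_0_nat by blast
    show "p * d div p = d" using p0 by simp
    have cop: "coprime p d" using d p(1) by (simp add: E_def prime_imp_coprime)
    have "p * d dvd n" using d p(2) cop by (simp add: E_def divides_mult)
    moreover have "squarefree (p * d)"
      using squarefree_mult_coprime[OF cop squarefree_prime[OF p(1)]] d by (simp add: E_def)
    ultimately show "p * d \<in> F" by (simp add: F_def)
  qed
  finally show ?thesis using False by (simp add: sum_negf)
qed

text \<open>Sorting all powers of \<open>u\<close> by their order shows that these sums satisfy the recursion
  \<open>sum_moebius_divisors\<close> of the Moebius function.\<close>

lemma sum_primitive_powers: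
  assumes "primitive_root m u" "m > 0"
  shows "(\<Sum>j\<in>totatives m. u ^ j) = of_int (moebius m)"
  using assms
proof (induction m arbitrary: u rule: less_induct)
  case (less m)
  have lower: "(\<Sum>j\<in>totatives d. u ^ (j * (m div d))) = of_int (moebius d)" if d: "d dvd m" "d < m" for d
  proof -
    have d0: "d > 0" using d(1) less.prems(2) by (auto intro: Nat.gr0I)
    have "primitive_root d (u ^ (m div d))"
      using primitive_root_power_div[OF less.prems d(1)] .
    from less.IH[OF d(2) this d0] show ?thesis by (simp add: power_mult[symmetric] mult.commute)
  qed
  have split: "{d. d dvd m} = insert m {d. d dvd m \<and> d < m}" using less.prems(2) by (auto dest: dvd_imp_le)
  have fin': "finite {d. d dvd m \<and> d < m}" by simp
  have "(if m = 1 then 1 else 0) = (\<Sum>s\<in>{0<..m}. u ^ s)"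
  proof -
    have "(\<Sum>s\<in>{0<..m}. u ^ s) = (if m dvd 1 then of_nat m else 0)"
      using sum_powers_primitive_root[OF less.prems(1), of 1] by simp
    then show ?thesis by (simp add: One_nat_def)
  qed
  also have "\<dots> = (\<Sum>d | d dvd m. \<Sum>j\<in>totatives d. u ^ (j * (m div d)))"
    by (rule sum_group_by_gcd[OF less.prems(2)])
  also have "\<dots> = (\<Sum>j\<in>totatives m. u ^ j) + (\<Sum>d | d dvd m \<and> d < m. of_int (moebius d))"
    unfolding split using less.prems(2) lower by (subst sum.insert[OF fin']) auto
  finally have 1: "(if m = 1 then 1 else 0) = (\<Sum>j\<in>totatives m. u ^ j) + of_int (\<Sum>d | d dvd m \<and> d < m. moebius d)"
    by simp
  have "(if m = 1 then 1 else 0) = moebius m + (\<Sum>d | d dvd m \<and> d < m. moebius d)"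
    unfolding sum_moebius_divisors[OF less.prems(2), symmetric] split by (subst sum.insert[OF fin']) auto
  then have "(if m = 1 then 1 else 0 :: complex) = of_int (moebius m) + of_int (\<Sum>d | d dvd m \<and> d < m. moebius d)"
    by (metis of_int_add of_int_0 of_int_1)
  then show ?case using 1 by (metis add_right_cancel)
qed

lemma coprime_lift:
  fixes m l i :: nat
  assumes "m dvd l" "l > 0" "coprime i m"
  obtains i' where "[i' = i] (mod m)" "coprime i' l"
proof
  \<comment> \<open>a prime divisor of \<open>l\<close> then divides exactly one of \<open>i\<close> and \<open>m * t\<close>\<close>
  define t where "t = \<Prod>{p \<in> prime_factors l. \<not> p dvd i}"
  show "[i + m * t = i] (mod m)" by (simp add: cong_def)
  show "coprime (i + m * t) l"
  proof (rule ccontr)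
    assume "\<not> coprime (i + m * t) l"
    then obtain p where p: "prime p" "p dvd i + m * t" "p dvd l"
      by (metis coprime_iff_gcd_eq_1 gcd_greatest_iff prime_factor_nat)
    have pf: "p \<in> prime_factors l" using p assms(2) by (simp add: in_prime_factors_iff)
    show False
    proof (cases "p dvd i")
      case True
      then have "p dvd m * t" using p(2) by (metis dvd_add_right_iff)
      moreover have "\<not> p dvd m" using True assms(3) p(1) by (metis coprime_common_divisor not_prime_unit)
      ultimately have "p dvd t" using p(1) prime_dvd_mult_iff by blast
      then obtain q where q: "q \<in> {p \<in> prime_factors l. \<not> p dvd i}" "p dvd q"
        unfolding t_def using p(1) by (auto simp: prime_dvd_prod_iff)
      then have "p = q" using p(1) by (auto intro: primes_dvd_imp_eq)
      then show False using q True by simp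
    next
      case False
      then have "p dvd t" unfolding t_def using pf by (intro dvd_prodI) auto
      then have "p dvd i" using p(2) by (metis dvd_add_left_iff dvd_mult)
      then show False using False by simp
    qed
  qed
qed

lemma power_cong:
  fixes u :: complex
  assumes "u ^ m = 1" "[a = b] (mod m)"
  shows "u ^ a = u ^ b"
proof -
  have "u ^ a = u ^ (a mod m)" for a
    by (metis assms(1) div_mult_mod_eq mult.commute mult.left_neutral power_add power_mult power_one)
  then show ?thesis using assms(2) by (metis cong_def)
qed

text \<open>Multiplication by \<open>i\<close> permutes the units modulo \<open>l\<close>.\<close>

lemma sum_totatives_unit:
  fixes u :: complex
  assumes u: "u ^ l = 1" and i: "coprime i l"
  shows "(\<Sum>a\<in>totatives l. u ^ (i * a)) = (\<Sum>a\<in>totatives l. u ^ a)"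
proof (cases "l > 1")
  case True
  have "inj_on (\<lambda>a. i * a mod l) (totatives l)"
  proof (rule inj_onI)
    fix a b assume ab: "a \<in> totatives l" "b \<in> totatives l" "i * a mod l = i * b mod l"
    then have "[i * a = i * b] (mod l)" by (simp add: cong_def)
    then have "[a = b] (mod l)" using i by (simp add: cong_mult_lcancel_nat)
    then show "a = b" using ab totatives_less[OF _ True] by (simp add: cong_def)
  qed
  moreover have "(\<lambda>a. i * a mod l) ` totatives l \<subseteq> totatives l"
  proof (rule image_subsetI)
    fix a assume a: "a \<in> totatives l"
    have cop: "coprime (i * a mod l) l" using a i True by (simp add: in_totatives_iff coprime_mod_left_iff)
    moreover have "i * a mod l \<noteq> 0"
    proof
      assume "i * a mod l = 0"
      then show False using cop True by simp
    qed
    ultimately show "i * a mod l \<in> totatives l"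
      using True by (simp add: in_totatives_iff less_imp_le)
  qed
  ultimately have "bij_betw (\<lambda>a. i * a mod l) (totatives l) (totatives l)"
    by (simp add: bij_betw_def endo_inj_surj)
  from sum.reindex_bij_betw[OF this, of "\<lambda>a. u ^ a"]
  have "(\<Sum>a\<in>totatives l. u ^ a) = (\<Sum>a\<in>totatives l. u ^ (i * a mod l))" by simp
  also have "\<dots> = (\<Sum>a\<in>totatives l. u ^ (i * a))"
    by (intro sum.cong refl power_cong[OF u]) (simp add: cong_def)
  finally show ?thesis ..
next
  case False
  then consider "l = 0" | "l = 1" by linarith
  then show ?thesis
  proof cases
    case 2
    then show ?thesis using u by (intro sum.cong) auto
  qed simp
qed

text \<open>The double sum of \<open>u ^ (i * a)\<close> over the units \<open>i\<close> modulo \<open>m\<close> and \<open>a\<close> modulo \<open>l\<close> is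
  evaluated in two ways: for fixed \<open>a\<close>, the power \<open>u ^ a\<close> is another primitive root of order
  \<open>m\<close>; for fixed \<open>i\<close>, a lift of \<open>i\<close> to a unit modulo \<open>l\<close> permutes the values of \<open>a\<close>.\<close>

lemma sum_totatives_primitive_root:
  assumes u: "primitive_root m u" and "m dvd l" "l > 0"
  shows "(\<Sum>a\<in>totatives l. u ^ a) = of_int (moebius m) * (of_nat (totient l) / of_nat (totient m))"
proof -
  have m: "m > 0" using assms by (auto intro: Nat.gr0I)
  have um: "u ^ m = 1" and ul: "u ^ l = 1" using primitive_rootD[OF u] assms(2) by auto
  have "of_nat (totient m) * (\<Sum>a\<in>totatives l. u ^ a) = (\<Sum>i\<in>totatives m. \<Sum>a\<in>totatives l. u ^ (i * a))"
  proof -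
    have "(\<Sum>a\<in>totatives l. u ^ (i * a)) = (\<Sum>a\<in>totatives l. u ^ a)" if i: "i \<in> totatives m" for i
    proof -
      obtain i' where i': "[i' = i] (mod m)" "coprime i' l"
        using coprime_lift[OF assms(2,3), of i] i by (auto simp: in_totatives_iff)
      have "(\<Sum>a\<in>totatives l. u ^ (i * a)) = (\<Sum>a\<in>totatives l. u ^ (i' * a))"
        using i'(1) by (intro sum.cong refl power_cong[OF um] cong_mult) (auto simp: cong_sym)
      also have "\<dots> = (\<Sum>a\<in>totatives l. u ^ a)" using ul i'(2) by (rule sum_totatives_unit)
      finally show ?thesis .
    qed
    then show ?thesis by (simp add: totient_def)
  qed
  also have "\<dots> = (\<Sum>a\<in>totatives l. \<Sum>i\<in>totatives m. (u ^ a) ^ i)"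
    by (subst sum.swap) (simp add: power_mult[symmetric] mult.commute)
  also have "\<dots> = (\<Sum>a\<in>totatives l. of_int (moebius m))"
  proof (intro sum.cong refl sum_primitive_powers[OF _ m] primitive_root_power_coprime[OF u m])
    fix a assume "a \<in> totatives l"
    then show "coprime a m" using assms(2) by (metis coprime_divisors dvd_refl in_totatives_iff)
  qed
  also have "\<dots> = of_nat (totient l) * of_int (moebius m)" by (simp add: totient_def)
  finally show ?thesis using m by (simp add: field_simps)
qed

text \<open>Hoelder's evaluation of the Ramanujan sum: \<open>\<omega> ^ k\<close> is a primitive root of order
  \<open>l div gcd k l\<close>.\<close>

theorem sum_totatives_eq_ramanujan_sum:
  assumes \<omega>: "primitive_root l \<omega>" and l: "l > 0" and r: "[int k = - r] (mod int l)"
  shows "(\<Sum>j\<in>totatives l. (\<omega> ^ k) ^ j) = ramanujan_sum l r"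
proof -
  have "gcd (int l) r = gcd (int l) (int k)"
    using r by (metis cong_gcd_eq gcd.commute gcd_neg2)
  then have g: "nat (gcd (int l) r) = gcd k l" by (simp add: gcd.commute)
  have "primitive_root (l div gcd k l) (\<omega> ^ k)" using primitive_root_power[OF \<omega> l] .
  from sum_totatives_primitive_root[OF this _ l]
  show ?thesis by (simp add: ramanujan_sum_def Let_def g div_dvd_iff_mult l)
qed

section \<open>Permutations with cycles of equal length\<close>

definition uniform_cycles :: "nat \<Rightarrow> nat \<Rightarrow> (nat \<Rightarrow> nat) set" where
  "uniform_cycles n l = {\<sigma>. \<sigma> permutes {1..n} \<and> (\<forall>k\<in>{1..n}. card (orbit \<sigma> k) = l)}"

lemma sum_card_orbits:
  fixes n :: nat
  assumes \<sigma>: "\<sigma> permutes {1..n}"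
  shows "(\<Sum>B\<in>orbit \<sigma> ` {1..n}. card B) = n"
proof -
  note orbit = permutes_orbit[OF \<sigma> finite_atLeastAtMost]
  have "(\<Sum>B\<in>orbit \<sigma> ` {1..n}. card B) = (\<Sum>B\<in>orbit \<sigma> ` {1..n}. \<Sum>k\<in>{k \<in> {1..n}. orbit \<sigma> k = B}. 1)"
  proof (intro sum.cong refl)
    fix B assume "B \<in> orbit \<sigma> ` {1..n}"
    then obtain k where k: "k \<in> {1..n}" "B = orbit \<sigma> k" by blast
    have "{l \<in> {1..n}. orbit \<sigma> l = B} = B" using orbit(3)[OF k(1)] k(2) by blast
    then show "card B = (\<Sum>k\<in>{k \<in> {1..n}. orbit \<sigma> k = B}. 1)" by (simp only: card_eq_sum)
  qed
  also have "\<dots> = (\<Sum>k\<in>{1..n}. 1)" by (rule sum.image_gen[symmetric]) simp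
  finally show ?thesis by simp
qed

lemma card_orbit_pos:
  fixes n :: nat
  assumes \<sigma>: "\<sigma> permutes {1..n}" and B: "B \<in> orbit \<sigma> ` {1..n}"
  shows "0 < card B"
proof -
  obtain k where k: "k \<in> {1..n}" "B = orbit \<sigma> k" using B by blast
  then have "k \<in> B" "B \<subseteq> {1..n}" using permutes_orbit(1,2)[OF \<sigma> finite_atLeastAtMost k(1)] by auto
  then show ?thesis using finite_subset[of B "{1..n}"] by (auto simp: card_gt_0_iff)
qed

lemma card_orbits_uniform:
  assumes "\<sigma> \<in> uniform_cycles n l" "l > 0"
  shows "card (orbit \<sigma> ` {1..n}) = n div l"
proof -
  have "(\<Sum>B\<in>orbit \<sigma> ` {1..n}. card B) = (\<Sum>B\<in>orbit \<sigma> ` {1..n}. l)"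
    using assms(1) by (intro sum.cong) (auto simp: uniform_cycles_def)
  then have "card (orbit \<sigma> ` {1..n}) * l = n"
    using sum_card_orbits[of \<sigma> n] assms(1) by (simp add: uniform_cycles_def)
  then show ?thesis using assms(2) by (metis div_mult_self_is_m)
qed

lemma cycle_type_uniform:
  assumes "l > 0" "\<sigma> permutes {1..n}"
  shows "cycle_type n \<sigma> = mset (replicate (n div l) l) \<longleftrightarrow> \<sigma> \<in> uniform_cycles n l"
proof
  assume eq: "cycle_type n \<sigma> = mset (replicate (n div l) l)"
  have "card (orbit \<sigma> k) = l" if "k \<in> {1..n}" for k
  proof -
    have "card (orbit \<sigma> k) \<in># cycle_type n \<sigma>" using that by (auto simp: cycle_type_def)
    then show ?thesis unfolding eq set_mset_mset in_set_replicate by blast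
  qed
  then show "\<sigma> \<in> uniform_cycles n l" using assms by (simp add: uniform_cycles_def)
next
  assume u: "\<sigma> \<in> uniform_cycles n l"
  have "cycle_type n \<sigma> = image_mset (\<lambda>_. l) (mset_set (orbit \<sigma> ` {1..n}))"
    unfolding cycle_type_def using u by (intro image_mset_cong) (auto simp: uniform_cycles_def)
  then show "cycle_type n \<sigma> = mset (replicate (n div l) l)"
    using card_orbits_uniform[OF u assms(1)] by (simp add: image_mset_const_eq)
qed

text \<open>The coordinates of \<open>g (a, i)\<close> are the number \<open>a\<close> of a cycle and the position \<open>i\<close> in
  it.\<close>

lemma uniform_coordinates:
  assumes u: "\<sigma> \<in> uniform_cycles n l" and l: "l > 0"
  obtains g where "bij_betw g ({..<n div l} \<times> {..<l}) {1..n}"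
    and "\<And>a i. a < n div l \<Longrightarrow> i < l \<Longrightarrow> \<sigma> (g (a, i)) = g (a, Suc i mod l)"
proof -
  have \<sigma>: "\<sigma> permutes {1..n}" using u by (simp add: uniform_cycles_def)
  note orbit = permutes_orbit[OF \<sigma> finite_atLeastAtMost]
  have powers: "orbit \<sigma> k = (\<lambda>i. (\<sigma> ^^ i) k) ` {..<l}" "inj_on (\<lambda>i. (\<sigma> ^^ i) k) {..<l}" "(\<sigma> ^^ l) k = k"
    if k: "k \<in> {1..n}" for k
  proof -
    let ?d = "funpow_dist1 \<sigma> k k"
    have img: "orbit \<sigma> k = (\<lambda>i. (\<sigma> ^^ i) k) ` {0..<?d}"
      using orbit(1)[OF k] by (rule orbit_conv_funpow_dist1)
    have inj: "inj_on (\<lambda>i. (\<sigma> ^^ i) k) {0..<?d}"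
      using orbit(1)[OF k] by (rule inj_on_funpow_dist1)
    have "card (orbit \<sigma> k) = ?d" unfolding img using card_image[OF inj] by simp
    then have "?d = l" using u k by (simp add: uniform_cycles_def)
    then show "orbit \<sigma> k = (\<lambda>i. (\<sigma> ^^ i) k) ` {..<l}" "inj_on (\<lambda>i. (\<sigma> ^^ i) k) {..<l}" "(\<sigma> ^^ l) k = k"
      using img inj funpow_dist1_prop[OF orbit(1)[OF k]] by (simp_all only: atLeast0LessThan)
  qed
  have "card (orbit \<sigma> ` {1..n}) = card {..<n div l}" using card_orbits_uniform[OF u l] by simp
  then obtain h where h: "bij_betw h {..<n div l} (orbit \<sigma> ` {1..n})"
    using finite_same_card_bij[of "{..<n div l}" "orbit \<sigma> ` {1..n}"] by auto
  define r where "r a = (SOME k. k \<in> {1..n} \<and> orbit \<sigma> k = h a)" for a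
  have r: "r a \<in> {1..n}" "orbit \<sigma> (r a) = h a" if "a < n div l" for a
  proof -
    have "h a \<in> orbit \<sigma> ` {1..n}" using h that by (auto dest: bij_betwE)
    then have "\<exists>k. k \<in> {1..n} \<and> orbit \<sigma> k = h a" by blast
    from someI_ex[OF this] show "r a \<in> {1..n}" "orbit \<sigma> (r a) = h a" by (simp_all add: r_def)
  qed
  define g where "g p = (\<sigma> ^^ snd p) (r (fst p))" for p
  have g_in: "g (a, i) \<in> h a" if "a < n div l" "i < l" for a i
    using powers(1)[OF r(1)[OF that(1)]] r(2)[OF that(1)] that(2) by (auto simp: g_def)
  have g_orbit: "orbit \<sigma> (g (a, i)) = h a" "g (a, i) \<in> {1..n}" if "a < n div l" "i < l" for a i
    using orbit(3)[OF r(1)[OF that(1)]] r(2)[OF that(1)] g_in[OF that] by auto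
  have "bij_betw g ({..<n div l} \<times> {..<l}) {1..n}"
  proof (rule bij_betwI')
    fix p q assume p: "p \<in> {..<n div l} \<times> {..<l}" and q: "q \<in> {..<n div l} \<times> {..<l}"
    show "g p = g q \<longleftrightarrow> p = q"
    proof
      assume eq: "g p = g q"
      obtain a i b j where pq: "p = (a, i)" "q = (b, j)" by (cases p, cases q)
      have "h a = h b" using g_orbit(1) p q eq pq by (metis lessThan_iff mem_Sigma_iff)
      then have "a = b" using bij_betw_imp_inj_on[OF h] p q pq by (auto dest: inj_onD)
      then have "i = j"
        using inj_onD[OF powers(2)[OF r(1)[of a]], of i j] p q eq pq by (auto simp: g_def)
      then show "p = q" using pq \<open>a = b\<close> by simp
    qed simp
    show "g p \<in> {1..n}" using g_orbit(2)[of "fst p" "snd p"] p by (cases p) simp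
  next
    fix k assume k: "k \<in> {1..n}"
    then obtain a where a: "a < n div l" "h a = orbit \<sigma> k"
      using bij_betw_imp_surj_on[OF h] by (metis imageE imageI lessThan_iff)
    have "k \<in> orbit \<sigma> (r a)" using orbit(1)[OF k] r(2)[OF a(1)] a(2) by simp
    then obtain i where "i < l" "k = g (a, i)" using powers(1)[OF r(1)[OF a(1)]] by (auto simp: g_def)
    then show "\<exists>p\<in>{..<n div l} \<times> {..<l}. k = g p" using a(1) by blast
  qed
  moreover have "\<sigma> (g (a, i)) = g (a, Suc i mod l)" if "a < n div l" "i < l" for a i
  proof (cases "Suc i = l")
    case True
    then have "\<sigma> (g (a, i)) = (\<sigma> ^^ l) (r a)" by (auto simp: g_def)
    then show ?thesis using powers(3)[OF r(1)[OF that(1)]] True by (simp add: g_def)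
  qed (use that in \<open>simp add: g_def\<close>)
  ultimately show ?thesis using that by blast
qed

text \<open>Matching the coordinates of the two permutations conjugates one into the other.\<close>

lemma uniform_conjugate:
  assumes "\<sigma> \<in> uniform_cycles n l" "\<sigma>' \<in> uniform_cycles n l" and l: "l > 0"
  obtains \<tau> where "\<tau> permutes {1..n}" "\<sigma>' = \<tau> \<circ> \<sigma> \<circ> inv \<tau>"
proof -
  let ?I = "{..<n div l} \<times> {..<l}"
  obtain g where g: "bij_betw g ?I {1..n}" "\<And>a i. a < n div l \<Longrightarrow> i < l \<Longrightarrow> \<sigma> (g (a, i)) = g (a, Suc i mod l)"
    using uniform_coordinates[OF assms(1) l] by metis
  obtain g' where g': "bij_betw g' ?I {1..n}" "\<And>a i. a < n div l \<Longrightarrow> i < l \<Longrightarrow> \<sigma>' (g' (a, i)) = g' (a, Suc i mod l)"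
    using uniform_coordinates[OF assms(2) l] by metis
  have \<sigma>: "\<sigma> permutes {1..n}" "\<sigma>' permutes {1..n}" using assms by (simp_all add: uniform_cycles_def)
  define \<tau> where "\<tau> k = (if k \<in> {1..n} then g' (inv_into ?I g k) else k)" for k
  have "bij_betw \<tau> {1..n} {1..n}"
    using bij_betw_trans[OF bij_betw_inv_into[OF g(1)] g'(1)]
    by (rule bij_betw_cong[THEN iffD1, rotated]) (simp add: \<tau>_def)
  then have \<tau>: "\<tau> permutes {1..n}" by (rule bij_imp_permutes) (auto simp: \<tau>_def)
  have \<tau>g: "\<tau> (g (a, i)) = g' (a, i)" if "a < n div l" "i < l" for a i
  proof -
    have "g (a, i) \<in> {1..n}" using bij_betwE[OF g(1)] that by blast
    then show ?thesis using bij_betw_inv_into_left[OF g(1), of "(a, i)"] that unfolding \<tau>_def by simp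
  qed
  have comm: "\<tau> (\<sigma> k) = \<sigma>' (\<tau> k)" for k
  proof (cases "k \<in> {1..n}")
    case True
    then obtain a i where k: "k = g (a, i)" "a < n div l" "i < l"
    proof -
      have "k \<in> g ` ?I" using bij_betw_imp_surj_on[OF g(1)] True by simp
      then obtain p where "p \<in> ?I" "k = g p" by blast
      then show ?thesis using that[of "fst p" "snd p"] by auto
    qed
    have "Suc i mod l < l" using l by simp
    show ?thesis unfolding k(1) g(2)[OF k(2,3)] \<tau>g[OF k(2) \<open>Suc i mod l < l\<close>] \<tau>g[OF k(2,3)] g'(2)[OF k(2,3)]
      by (rule refl)
  next
    case False
    then show ?thesis by (simp add: permutes_not_in[OF \<tau>] permutes_not_in[OF \<sigma>(1)] permutes_not_in[OF \<sigma>(2)])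
  qed
  have "\<tau> \<circ> \<sigma> \<circ> inv \<tau> = \<sigma>' \<circ> (\<tau> \<circ> inv \<tau>)" by (simp add: fun_eq_iff comm)
  then have "\<sigma>' = \<tau> \<circ> \<sigma> \<circ> inv \<tau>" by (simp add: permutes_inv_o[OF \<tau>])
  then show ?thesis using that \<tau> by blast
qed

section \<open>Limits at roots of unity\<close>

text \<open>The factor \<open>1 - (t * \<omega>) ^ i\<close>, divided by \<open>1 - t\<close> if it vanishes at \<open>t = 1\<close>.\<close>

definition reduced_factor :: "complex \<Rightarrow> nat \<Rightarrow> nat \<Rightarrow> real \<Rightarrow> complex" where
  "reduced_factor \<omega> l i t = (if l dvd i then \<Sum>k<i. of_real t ^ k else 1 - (of_real t * \<omega>) ^ i)"

lemma reduced_factor: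
  assumes root: "primitive_root l \<omega>"
  shows "1 - (of_real t * \<omega>) ^ i = (if l dvd i then 1 - of_real t else 1) * reduced_factor \<omega> l i t"
proof (cases "l dvd i")
  case True
  then have "\<omega> ^ i = 1" using primitive_rootD[OF root] by simp
  then show ?thesis using True by (simp add: reduced_factor_def power_mult_distrib one_diff_power_eq)
qed (simp add: reduced_factor_def)

lemma reduced_factor_nonzero:
  assumes root: "primitive_root l \<omega>" and "i > 0"
  shows "reduced_factor \<omega> l i 1 \<noteq> 0"
  using primitive_rootD[OF root, of i] assms(2) by (simp add: reduced_factor_def)

lemma tendsto_reduced_factor:
  "((\<lambda>t. reduced_factor \<omega> l i t) \<longlongrightarrow> reduced_factor \<omega> l i 1) (at_left 1)"
proof -
  have "isCont (reduced_factor \<omega> l i) 1"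
    unfolding reduced_factor_def by (cases "l dvd i") (auto intro!: continuous_intros)
  then show ?thesis unfolding isCont_def by (rule tendsto_mono[OF at_le[OF subset_UNIV]])
qed

lemma card_multiples:
  assumes "l > 0"
  shows "card {i \<in> {1..n}. l dvd i} = n div l"
proof -
  have "{i \<in> {1..n}. l dvd i} = (\<lambda>k. l * k) ` {1..n div l}"
  proof (intro set_eqI iffI)
    fix i assume i: "i \<in> {i \<in> {1..n}. l dvd i}"
    then obtain k where k: "i = l * k" by auto
    have "k \<le> n div l" using i k assms by (simp add: less_eq_div_iff_mult_less_eq mult.commute)
    moreover have "1 \<le> k" using i k by (cases k) auto
    ultimately show "i \<in> (\<lambda>k. l * k) ` {1..n div l}" using k by (intro image_eqI[of _ _ k]) auto
  next
    fix i assume "i \<in> (\<lambda>k. l * k) ` {1..n div l}"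
    then obtain k where "i = l * k" "k \<in> {1..n div l}" by blast
    then have k: "i = l * k" "1 \<le> k" "k \<le> n div l" by simp_all
    have "l * k \<le> n" using k(3) assms by (simp add: less_eq_div_iff_mult_less_eq mult.commute)
    moreover have "1 \<le> l * k" using assms k(2) by (metis One_nat_def Suc_leI nat_0_less_mult_iff order_less_le_trans zero_less_one)
    ultimately show "i \<in> {i \<in> {1..n}. l dvd i}" using k(1) by simp
  qed
  moreover have "inj_on (\<lambda>k. l * k) {1..n div l}" using assms by (auto intro: inj_onI)
  ultimately show ?thesis by (simp add: card_image)
qed

text \<open>The number \<open>m\<close> is the order of the pole at \<open>q = \<omega>\<close> in the term of \<open>\<sigma>\<close> in
  \<open>major_index_identity\<close>, and \<open>n div l\<close> is the order of the pole of the product on the other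
  side.\<close>

lemma card_divisible_orbits:
  assumes \<sigma>: "\<sigma> permutes {1..n}" and l: "l > 0" "l dvd n"
  defines "m \<equiv> card {B \<in> orbit \<sigma> ` {1..n}. l dvd card B}"
  shows "m \<le> n div l" and "m = n div l \<longleftrightarrow> \<sigma> \<in> uniform_cycles n l"
proof -
  let ?\<O> = "orbit \<sigma> ` {1..n}"
  have le: "(if l dvd card B then l else 0) \<le> card B" if "B \<in> ?\<O>" for B
    using card_orbit_pos[OF \<sigma> that] by (auto intro: dvd_imp_le)
  have ml: "(\<Sum>B\<in>?\<O>. if l dvd card B then l else 0) = m * l"
    by (simp add: m_def sum.If_cases Int_def)
  have "(\<Sum>B\<in>?\<O>. if l dvd card B then l else 0) \<le> (\<Sum>B\<in>?\<O>. card B)" using le by (rule sum_mono)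
  then have bound: "m * l \<le> n" unfolding ml sum_card_orbits[OF \<sigma>] .
  then show "m \<le> n div l" using l(1) by (simp add: less_eq_div_iff_mult_less_eq)
  show "m = n div l \<longleftrightarrow> \<sigma> \<in> uniform_cycles n l"
  proof
    assume "m = n div l"
    then have "m * l = n" using l(2) by simp
    have "card B = l" if B: "B \<in> ?\<O>" for B
    proof -
      have "card B = (if l dvd card B then l else 0)"
      proof (rule ccontr)
        assume "card B \<noteq> (if l dvd card B then l else 0)"
        then have "(if l dvd card B then l else 0) < card B" using le[OF B] by linarith
        then have "(\<Sum>B\<in>?\<O>. if l dvd card B then l else 0) < (\<Sum>B\<in>?\<O>. card B)"
          using B le by (intro sum_strict_mono_ex1) blast+
        then show False unfolding ml sum_card_orbits[OF \<sigma>] using \<open>m * l = n\<close> by simp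
      qed
      then show ?thesis using card_orbit_pos[OF \<sigma> B] by (auto split: if_splits)
    qed
    then show "\<sigma> \<in> uniform_cycles n l" using \<sigma> by (auto simp: uniform_cycles_def)
  next
    assume u: "\<sigma> \<in> uniform_cycles n l"
    have "{B \<in> ?\<O>. l dvd card B} = ?\<O>" using u by (auto simp: uniform_cycles_def)
    then show "m = n div l" unfolding m_def using card_orbits_uniform[OF u l(1)] by simp
  qed
qed

lemma prod_one_minus_power:
  fixes f :: "'b \<Rightarrow> nat"
  assumes root: "primitive_root l \<omega>" and "finite I"
  shows "(\<Prod>b\<in>I. 1 - (of_real t * \<omega>) ^ f b)
    = (1 - of_real t) ^ card {b \<in> I. l dvd f b} * (\<Prod>b\<in>I. reduced_factor \<omega> l (f b) t)"
  using assms(2) by (simp add: reduced_factor[OF root] prod.distrib prod.If_cases Int_def)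

text \<open>The limit for \<open>q \<rightarrow> \<omega>\<close> of the product of all \<open>1 - q ^ i\<close>, divided by the product of the
  \<open>1 - q ^ card B\<close> over the cycles of a permutation all of whose cycles have length \<open>l\<close>. It is
  the order of the centralizer of such a permutation, as \<open>uniform_weight_count\<close> shows.\<close>

definition uniform_weight :: "nat \<Rightarrow> nat \<Rightarrow> complex \<Rightarrow> complex" where
  "uniform_weight n l \<omega> = (\<Prod>i\<in>{1..n}. reduced_factor \<omega> l i 1) / reduced_factor \<omega> l l 1 ^ (n div l)"

context shape
begin

text \<open>Multiply \<open>major_index_identity\<close> by the product of the \<open>1 - q ^ i\<close> and let \<open>q = t * \<omega>\<close>
  with \<open>t \<rightarrow> 1\<close> from below. By \<open>card_divisible_orbits\<close>, the term of a permutation tends to 0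
  unless all its cycles have length \<open>l\<close>.\<close>

theorem maj_sum_at_root:
  assumes root: "primitive_root l \<omega>" and l: "l > 0" "l dvd n"
  shows "fact n * (\<Sum>T\<in>SYT lam. \<omega> ^ maj lam T)
    = uniform_weight n l \<omega> * (\<Sum>\<sigma>\<in>uniform_cycles n l. character \<sigma>)"
proof -
  have "\<omega> ^ l = 1" using primitive_rootD[OF root, of l] by simp
  then have "norm \<omega> ^ l = 1" by (metis norm_one norm_power)
  then have norm_\<omega>: "norm \<omega> = 1" using power_eq_imp_eq_base[of "norm \<omega>" l 1] l(1) by simp
  define m where "m \<sigma> = card {B \<in> orbit \<sigma> ` A. l dvd card B}" for \<sigma> :: "nat \<Rightarrow> nat"
  define H where "H t = (\<Prod>i\<in>A. reduced_factor \<omega> l i t)" for t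
  define H' where "H' \<sigma> t = (\<Prod>B\<in>orbit \<sigma> ` A. reduced_factor \<omega> l (card B) t)" for \<sigma> t
  have H: "(H \<longlongrightarrow> H 1) (at_left 1)" "(H' \<sigma> \<longlongrightarrow> H' \<sigma> 1) (at_left 1)" for \<sigma>
    unfolding H_def H'_def by (intro tendsto_prod tendsto_reduced_factor)+
  have H1: "H' \<sigma> 1 \<noteq> 0" if "\<sigma> permutes A" for \<sigma>
    using card_orbit_pos[OF that] reduced_factor_nonzero[OF root] by (auto simp: H'_def)
  let ?L = "\<lambda>t::real. \<Sum>\<sigma> | \<sigma> permutes A. character \<sigma> * ((1 - of_real t) ^ (n div l - m \<sigma>) * (H t / H' \<sigma> t))"
  let ?R = "\<lambda>t::real. fact n * (\<Sum>T\<in>SYT lam. (of_real t * \<omega>) ^ maj lam T)"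
  have finite_t: "?L t = ?R t" if t: "0 < t" "t < 1" for t :: real
  proof -
    define q where "q = of_real t * \<omega>"
    have q: "norm q < 1" using t norm_\<omega> by (simp add: q_def norm_mult)
    have t1: "(1 - of_real t :: complex) \<noteq> 0" using t by (metis eq_iff_diff_eq_0 less_irrefl of_real_1 of_real_eq_iff)
    have nz: "1 - q ^ i \<noteq> 0" if "i > 0" for i
    proof
      assume "1 - q ^ i = 0"
      then have "norm q ^ i = 1" by (metis norm_one norm_power eq_iff_diff_eq_0)
      then show False using q that by (metis norm_ge_zero power_less_one_iff less_irrefl)
    qed
    define Q where "Q = (\<Prod>i\<in>A. 1 - q ^ i)"
    have Q: "Q = (1 - of_real t) ^ (n div l) * H t"
      unfolding Q_def q_def H_def prod_one_minus_power[OF root finite_atLeastAtMost]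
      using card_multiples[OF l(1)] by simp
    have "Q \<noteq> 0" using nz by (simp add: Q_def)
    have orbits: "cycle_product \<sigma> q * Q = (1 - of_real t) ^ (n div l - m \<sigma>) * (H t / H' \<sigma> t)"
      if \<sigma>: "\<sigma> permutes A" for \<sigma>
    proof -
      have "(\<Prod>B\<in>orbit \<sigma> ` A. 1 - q ^ card B) = (1 - of_real t) ^ m \<sigma> * H' \<sigma> t"
        unfolding q_def H'_def m_def by (rule prod_one_minus_power[OF root]) simp
      then have "cycle_product \<sigma> q = 1 / ((1 - of_real t) ^ m \<sigma> * H' \<sigma> t)"
        by (simp add: prod_dividef)
      moreover have "n div l = m \<sigma> + (n div l - m \<sigma>)"
        using card_divisible_orbits(1)[OF \<sigma> l] by (simp add: m_def)
      then have "(1 - of_real t :: complex) ^ (n div l) = (1 - of_real t) ^ m \<sigma> * (1 - of_real t) ^ (n div l - m \<sigma>)"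
        by (metis power_add)
      ultimately show ?thesis using t1 unfolding Q by simp
    qed
    have "?L t
        = (\<Sum>\<sigma> | \<sigma> permutes A. character \<sigma> * (cycle_product \<sigma> q * Q))"
      using orbits by (intro sum.cong refl) simp
    also have "\<dots> = (\<Sum>\<sigma> | \<sigma> permutes A. character \<sigma> * cycle_product \<sigma> q) * Q"
      by (simp only: sum_distrib_right mult.assoc)
    also have "\<dots> = fact n * (\<Sum>T\<in>SYT lam. q ^ maj lam T) * ((\<Prod>i\<in>A. 1 / (1 - q ^ i)) * Q)"
      by (simp only: major_index_identity[OF q] mult.assoc)
    also have "(\<Prod>i\<in>A. 1 / (1 - q ^ i)) * Q = 1"
      using \<open>Q \<noteq> 0\<close> by (simp add: Q_def prod_dividef)
    finally show ?thesis by (simp add: q_def)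
  qed
  have lim1: "(?L \<longlongrightarrow> ?L 1) (at_left (1::real))"
    using H H1 by (intro tendsto_intros) auto
  have lim2: "(?R \<longlongrightarrow> ?R 1) (at_left (1::real))"
    by (intro tendsto_intros)
  have "eventually (\<lambda>t::real. 0 < t \<and> t < 1) (at_left 1)"
    using eventually_at_left_real[of 0 1] by simp
  then have "(?R \<longlongrightarrow> ?L 1) (at_left (1::real))"
    using finite_t by (intro Lim_transform_eventually[OF lim1]) (auto elim: eventually_mono)
  from tendsto_unique[OF _ this lim2]
  have "fact n * (\<Sum>T\<in>SYT lam. \<omega> ^ maj lam T)
      = ?L 1"
    by simp
  also have "\<dots> = (\<Sum>\<sigma> | \<sigma> permutes A. if \<sigma> \<in> uniform_cycles n l then uniform_weight n l \<omega> * character \<sigma> else 0)"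
  proof (intro sum.cong refl)
    fix \<sigma> assume "\<sigma> \<in> {\<sigma>. \<sigma> permutes A}"
    then have \<sigma>: "\<sigma> permutes A" by simp
    note m = card_divisible_orbits[OF \<sigma> l, folded m_def]
    show "character \<sigma> * ((1 - of_real 1) ^ (n div l - m \<sigma>) * (H 1 / H' \<sigma> 1))
        = (if \<sigma> \<in> uniform_cycles n l then uniform_weight n l \<omega> * character \<sigma> else 0)"
    proof (cases "\<sigma> \<in> uniform_cycles n l")
      case True
      have "H' \<sigma> 1 = (\<Prod>B\<in>orbit \<sigma> ` A. reduced_factor \<omega> l l 1)"
        unfolding H'_def using True by (intro prod.cong) (auto simp: uniform_cycles_def)
      then have "H' \<sigma> 1 = reduced_factor \<omega> l l 1 ^ (n div l)"
        using card_orbits_uniform[OF True l(1)] by simp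
      then show ?thesis using m True by (simp add: uniform_weight_def H_def)
    next
      case False
      then have "n div l - m \<sigma> > 0" using m by simp
      then show ?thesis using False by (simp add: power_0_left)
    qed
  qed
  also have "\<dots> = (\<Sum>\<sigma>\<in>uniform_cycles n l. uniform_weight n l \<omega> * character \<sigma>)"
    using finite_permutations[of A] by (subst sum.inter_filter[symmetric])
      (auto simp: uniform_cycles_def intro!: sum.cong)
  finally show ?thesis by (simp only: sum_distrib_left)
qed

lemma character_uniform:
  assumes "\<sigma> \<in> uniform_cycles n l" "\<sigma>' \<in> uniform_cycles n l" "l > 0"
  shows "character \<sigma>' = character \<sigma>"
proof -
  obtain \<tau> where "\<tau> permutes A" "\<sigma>' = \<tau> \<circ> \<sigma> \<circ> inv \<tau>" using uniform_conjugate[OF assms] .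
  then show ?thesis
    using trace_conjugate assms(1) by (simp add: character_def uniform_cycles_def)
qed

end

section \<open>One-row shapes\<close>

context
  fixes n :: nat
  assumes n_pos: "n \<ge> 1"
begin

lemma diagram_row: "diagram [n] = Pair 0 ` {..<n}"
  by (auto simp: diagram_def)

interpretation one_row: shape "[n]"
  using n_pos by unfold_locales (auto simp: int_partition_def)

text \<open>As there are no descents, the zero sequence is admissible for every standard tableau
  \<open>T\<close>, and \<open>T\<close> is recovered from the zero filling by standardization.\<close>

lemma one_row_SYT: "SYT [n] = {one_row.standardization (\<lambda>_. 0)}" and one_row_descents: "T \<in> SYT [n] \<Longrightarrow> descents [n] T = {}"
proof -
  show desc: "descents [n] T = {}" if "T \<in> SYT [n]" for T
  proof -
    interpret tableau_of_shape "[n]" T using that by (rule one_row.SYT_tableau)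
    have "fst (cell k) = 0" if "k \<in> {1..sum_list [n]}" for k
      using cell_in[OF that] by (auto simp: diagram_row)
    then show ?thesis by (auto simp: descents_def row_of_def cell_def[symmetric])
  qed
  have "one_row.standardization (\<lambda>_. 0) = T" if T: "T \<in> SYT [n]" for T
  proof -
    have "(\<lambda>_. 0) \<in> descending (sum_list [n]) (descents [n] T)"
      unfolding desc[OF T] by (simp add: descending_def)
    from one_row.standardization_fill[OF T this] show ?thesis by (simp add: one_row.fill_def)
  qed
  moreover have "one_row.standardization (\<lambda>_. 0) \<in> SYT [n]"
    by (rule one_row.standardization_SYT) (auto simp: column_strict_pp_def diagram_row)
  ultimately show "SYT [n] = {one_row.standardization (\<lambda>_. 0)}" by blast
qed

lemma one_row_polytabloid:
  assumes "t \<in> tableaux [n]"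
  shows "polytabloid [n] t = basis_vec [{1..n}]"
proof -
  interpret tableau_of_shape "[n]" t using assms by unfold_locales
  have row0: "row k = 0" if "k \<in> {1..sum_list [n]}" for k
    using cell_in[OF that] by (auto simp: diagram_row)
  have "tabloid [n] t = [{1..n}]" unfolding tabloid_eq using row0 by auto
  moreover have "\<pi> = id" if \<pi>: "\<pi> \<in> C" for \<pi>
  proof
    fix k
    show "\<pi> k = id k"
    proof (cases "k \<in> {1..sum_list [n]}")
      case True
      have \<pi>k: "\<pi> k \<in> {1..sum_list [n]}" using one_row.permutes_mem[OF C_permutes[OF \<pi>] True] .
      have "col (\<pi> k) = col k" using \<pi> True unfolding C_iff by blast
      then show ?thesis using cell_inj[OF \<pi>k True] row0[OF True] row0[OF \<pi>k] by (simp add: prod_eq_iff)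
    qed (use permutes_not_in[OF C_permutes[OF \<pi>]] in simp)
  qed
  then have "C = {id}" using id_in_C by blast
  ultimately show ?thesis unfolding polytabloid_def by (simp add: vec_scale_def)
qed

lemma one_row_character:
  assumes \<sigma>: "\<sigma> permutes {1..n}"
  shows "one_row.character \<sigma> = 1"
proof -
  let ?v = "basis_vec [{1..n}] :: nat set list \<Rightarrow> complex"
  have "polytabloid [n] ` tableaux [n] = (\<lambda>_. ?v) ` tableaux [n]"
    by (intro image_cong refl one_row_polytabloid)
  also have "\<dots> = {?v}" using one_row.tableaux_nonempty by auto
  finally have "polytabloid [n] ` tableaux [n] = {?v}" .
  then have S: "specht_module [n] = fun_space.span {?v}" by (simp add: specht_module_def)
  have "perm_action \<sigma> ?v = ?v"
    using \<sigma> by (simp add: perm_action_basis_vec permutes_bij tabloid_perm_def permutes_image)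
  then have fixed: "perm_action \<sigma> b = b" if "b \<in> specht_module [n]" for b
    using that unfolding S fun_space.span_singleton by (auto simp: perm_action_scale)
  have "one_row.character \<sigma> = of_nat (card one_row.basis)"
    unfolding one_row.character_def one_row.trace_eq using one_row.basis_subset
    by (simp add: fixed fun_space.representation_basis[OF one_row.basis(1)])
  moreover have "card one_row.basis \<le> card {?v}"
    using fun_space.independent_span_bound[OF _ one_row.basis(1), of "{?v}"] one_row.basis_subset S by auto
  moreover have "one_row.basis \<noteq> {}"
  proof
    assume "one_row.basis = {}"
    then have "specht_module [n] = {0}" using one_row.basis(2) by simp
    then have "?v = 0" using S fun_space.span_base[of ?v "{?v}"] by auto
    then show False by (metis basis_vec_def zero_fun_apply zero_neq_one)
  qed
  then have "card one_row.basis \<noteq> 0" using one_row.finite_basis by simp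
  ultimately show ?thesis by simp
qed

text \<open>For one row, the character and the generating function of the major index are both 1,
  and \<open>maj_sum_at_root\<close> counts the permutations with all cycles of length \<open>l\<close>.\<close>

lemma uniform_weight_count:
  assumes "primitive_root l \<omega>" "l > 0" "l dvd n"
  shows "fact n = uniform_weight n l \<omega> * of_nat (card (uniform_cycles n l))"
proof -
  have "(\<Sum>T\<in>SYT [n]. \<omega> ^ maj [n] T) = 1"
    using one_row_SYT one_row_descents by (simp add: maj_def)
  moreover have "(\<Sum>\<sigma>\<in>uniform_cycles n l. one_row.character \<sigma>) = of_nat (card (uniform_cycles n l))"
    using one_row_character by (simp add: uniform_cycles_def)
  ultimately show ?thesis using one_row.maj_sum_at_root[OF assms(1,2)] assms(3) by simp
qed

end

section \<open>Character values as values of the major index polynomial\<close>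

text \<open>All permutations with cycles of length \<open>l\<close> have the same character value, so dividing
  \<open>maj_sum_at_root\<close> by its one-row case isolates this value. The one-row case also shows that
  such permutations exist, so that the choice of a permutation in the definition of the
  character is meaningful.\<close>

theorem (in shape) maj_sum_eq_specht_char:
  assumes root: "primitive_root l \<omega>" and l: "l > 0" "l dvd n" and n: "n \<ge> 1"
  shows "(\<Sum>T\<in>SYT lam. \<omega> ^ maj lam T) = specht_char lam (replicate (n div l) l)"
proof -
  have weight: "fact n = uniform_weight n l \<omega> * of_nat (card (uniform_cycles n l))"
    using uniform_weight_count[OF n root l] .
  then have "card (uniform_cycles n l) \<noteq> 0" by (metis fact_nonzero mult_zero_right of_nat_0)
  then obtain \<sigma>1 where "\<sigma>1 \<in> uniform_cycles n l" by fastforce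
  then have ex: "\<exists>\<sigma>. \<sigma> permutes A \<and> cycle_type n \<sigma> = mset (replicate (n div l) l)"
    using cycle_type_uniform[OF l(1)] by (auto simp: uniform_cycles_def)
  define \<sigma> where "\<sigma> = (SOME \<sigma>. \<sigma> permutes A \<and> cycle_type n \<sigma> = mset (replicate (n div l) l))"
  have \<sigma>: "\<sigma> \<in> uniform_cycles n l"
    using someI_ex[OF ex] cycle_type_uniform[OF l(1)] unfolding \<sigma>_def by blast
  have "fact n * (\<Sum>T\<in>SYT lam. \<omega> ^ maj lam T) = uniform_weight n l \<omega> * (\<Sum>\<sigma>\<in>uniform_cycles n l. character \<sigma>)"
    by (rule maj_sum_at_root[OF root l])
  also have "(\<Sum>\<sigma>\<in>uniform_cycles n l. character \<sigma>) = (\<Sum>\<sigma>'\<in>uniform_cycles n l. character \<sigma>)"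
    using character_uniform[OF \<sigma> _ l(1)] by (intro sum.cong) auto
  also have "uniform_weight n l \<omega> * \<dots> = fact n * character \<sigma>" by (simp add: weight)
  finally have "(\<Sum>T\<in>SYT lam. \<omega> ^ maj lam T) = character \<sigma>" by simp
  then show ?thesis unfolding specht_char_def character_def \<sigma>_def .
qed

text \<open>Only the identity has all cycles of length 1, so the degree is the dimension of the
  Specht module, which contains the nonzero vector \<open>e\<close>.\<close>

theorem (in shape) specht_degree_nonzero: "specht_degree lam \<noteq> 0"
proof -
  define \<sigma> where "\<sigma> = (SOME \<sigma>. \<sigma> permutes A \<and> cycle_type n \<sigma> = mset (replicate n 1))"
  have div1: "n div 1 = n" by simp
  have "id \<in> uniform_cycles n 1"
  proof -
    have "orbit id k = {k}" for k :: nat by (simp add: orbit_eq_singleton_iff)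
    then show ?thesis by (simp add: uniform_cycles_def permutes_id)
  qed
  then have "\<exists>\<sigma>. \<sigma> permutes A \<and> cycle_type n \<sigma> = mset (replicate n 1)"
    using cycle_type_uniform[of 1 id n] permutes_id[of A] unfolding div1 by (metis zero_less_one)
  from someI_ex[OF this] have \<sigma>: "\<sigma> permutes A" "\<sigma> \<in> uniform_cycles n 1"
    using cycle_type_uniform[of 1 \<sigma> n] unfolding \<sigma>_def[symmetric] div1 by auto
  have "\<sigma> = id"
  proof
    fix k
    show "\<sigma> k = id k"
    proof (cases "k \<in> A")
      case True
      then have "card (orbit \<sigma> k) = 1" using \<sigma>(2) by (simp add: uniform_cycles_def)
      then obtain x where "orbit \<sigma> k = {x}" by (rule card_1_singletonE)
      moreover have "k \<in> orbit \<sigma> k" using permutes_orbit(1)[OF \<sigma>(1) _ True] by simp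
      ultimately show ?thesis by (simp add: orbit_eq_singleton_iff)
    qed (simp add: permutes_not_in[OF \<sigma>(1)])
  qed
  then have "specht_degree lam = of_nat (card basis)"
    unfolding specht_degree_def specht_char_def \<sigma>_def[symmetric] by (simp add: trace_id)
  moreover have "basis \<noteq> {}"
  proof
    assume "basis = {}"
    then have S: "specht_module lam = {0}" using basis(2) by simp
    obtain t where "t \<in> tableaux lam" using tableaux_nonempty by blast
    then interpret tableau_of_shape lam t by unfold_locales
    show False using e_in e_nonzero S by blast
  qed
  ultimately show ?thesis using finite_basis by simp
qed

section \<open>Fourier inversion\<close>

lemma ramanujan_sum_1: "ramanujan_sum 1 r = 1"
  by (simp add: ramanujan_sum_def moebius_def One_nat_def)

text \<open>Fourier inversion on the integers modulo \<open>n\<close>. The contributions of the powers \<open>\<omega> ^ s\<close>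
  are grouped by their order \<open>l\<close>, on which the value of the major index polynomial at \<open>\<omega> ^ s\<close>
  depends alone.\<close>

lemma (in shape) maj_count_expansion:
  assumes n: "n \<ge> 1"
  shows "of_nat n * of_nat (maj_count lam r)
    = (\<Sum>l | l dvd n. specht_char lam (replicate (n div l) l) * ramanujan_sum l r)"
proof -
  obtain \<omega> where \<omega>: "primitive_root n \<omega>" using ex_primitive_root[OF n] .
  have n0: "n > 0" using n by simp
  define k where "k = n - nat (r mod int n)"
  have "nat (r mod int n) \<le> n" using n0 by (simp add: nat_le_iff less_imp_le)
  then have "int k = int n - r mod int n" using n0 by (simp add: k_def)
  then have k: "[int k = - r] (mod int n)" by (simp add: cong_def mod_simps)
  have mem: "[int (maj lam T) = r] (mod int n) \<longleftrightarrow> n dvd maj lam T + k" for T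
  proof -
    have "n dvd maj lam T + k \<longleftrightarrow> [int (maj lam T) + int k = 0] (mod int n)"
      by (simp add: cong_0_iff flip: of_nat_add)
    also have "\<dots> \<longleftrightarrow> [int (maj lam T) + - r = 0] (mod int n)"
      using cong_add[OF cong_refl k] by (meson cong_sym cong_trans)
    also have "\<dots> \<longleftrightarrow> [int (maj lam T) = r] (mod int n)" by (simp add: cong_iff_dvd_diff)
    finally show ?thesis by blast
  qed
  have "of_nat n * of_nat (maj_count lam r) = (\<Sum>T\<in>SYT lam. if n dvd maj lam T + k then of_nat n else 0 :: complex)"
    using finite_SYT by (simp add: maj_count_def mem sum.If_cases Int_def)
  also have "\<dots> = (\<Sum>T\<in>SYT lam. \<Sum>s\<in>{0<..n}. (\<omega> ^ (maj lam T + k)) ^ s)"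
    by (simp only: sum_powers_primitive_root[OF \<omega>])
  also have "\<dots> = (\<Sum>s\<in>{0<..n}. (\<omega> ^ s) ^ k * (\<Sum>T\<in>SYT lam. (\<omega> ^ s) ^ maj lam T))"
    by (subst sum.swap) (simp add: sum_distrib_left power_add[symmetric] power_mult[symmetric] distrib_left mult.commute add.commute)
  also have "\<dots> = (\<Sum>l | l dvd n. \<Sum>j\<in>totatives l. (\<omega> ^ (j * (n div l))) ^ k *
      (\<Sum>T\<in>SYT lam. (\<omega> ^ (j * (n div l))) ^ maj lam T))"
    by (rule sum_group_by_gcd[OF n0])
  also have "\<dots> = (\<Sum>l | l dvd n. specht_char lam (replicate (n div l) l) * ramanujan_sum l r)"
  proof (rule sum.cong[OF refl])
    fix l assume "l \<in> {l. l dvd n}"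
    then have l: "l dvd n" "l > 0" using n0 by (auto intro: Nat.gr0I)
    define w where "w = \<omega> ^ (n div l)"
    have w: "primitive_root l w"
      unfolding w_def using primitive_root_power_div[OF \<omega> n0 l(1)] .
    have F: "(\<Sum>T\<in>SYT lam. (w ^ j) ^ maj lam T) = specht_char lam (replicate (n div l) l)"
      if "j \<in> totatives l" for j
    proof -
      have "primitive_root l (w ^ j)"
        using that by (intro primitive_root_power_coprime[OF w l(2)]) (simp add: in_totatives_iff)
      then show ?thesis
        using l n by (intro maj_sum_eq_specht_char)
    qed
    have "[int k = - r] (mod int l)" using k l(1) by (meson cong_dvd_modulus of_nat_dvd_iff)
    then have R: "(\<Sum>j\<in>totatives l. (w ^ k) ^ j) = ramanujan_sum l r"
      by (rule sum_totatives_eq_ramanujan_sum[OF w l(2)])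
    have "\<omega> ^ (j * (n div l)) = w ^ j" for j by (simp add: w_def power_mult[symmetric] mult.commute)
    then have "(\<Sum>j\<in>totatives l. (\<omega> ^ (j * (n div l))) ^ k * (\<Sum>T\<in>SYT lam. (\<omega> ^ (j * (n div l))) ^ maj lam T))
        = (\<Sum>j\<in>totatives l. (w ^ k) ^ j * specht_char lam (replicate (n div l) l))"
      using F by (intro sum.cong refl) (simp add: power_mult[symmetric] mult.commute)
    also have "\<dots> = specht_char lam (replicate (n div l) l) * ramanujan_sum l r"
      by (simp only: R sum_distrib_right[symmetric] mult.commute)
    finally show "(\<Sum>j\<in>totatives l. (\<omega> ^ (j * (n div l))) ^ k * (\<Sum>T\<in>SYT lam. (\<omega> ^ (j * (n div l))) ^ maj lam T))
        = specht_char lam (replicate (n div l) l) * ramanujan_sum l r" .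
  qed
  finally show ?thesis .
qed

theorem theorem4:
  fixes n :: nat and lam :: "nat list" and r :: int
  assumes "n \<ge> 1" and "int_partition lam n"
  shows "of_nat (maj_count lam r) / specht_degree lam =
    1 / of_nat n + 1 / of_nat n *
      (\<Sum>l | l dvd n \<and> l \<noteq> 1.
         specht_char lam (replicate (n div l) l) / specht_degree lam * ramanujan_sum l r)"
proof -
  have n: "sum_list lam = n" using assms(2) by (simp add: int_partition_def)
  interpret shape lam using assms(2) n by unfold_locales simp
  let ?f = "specht_degree lam"
  let ?X = "\<lambda>l. specht_char lam (replicate (n div l) l) * ramanujan_sum l r"
  have split: "{l. l dvd n} = insert 1 {l. l dvd n \<and> l \<noteq> 1}" by auto
  have "finite {l. l dvd n \<and> l \<noteq> 1}" using assms(1) by simp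
  then have "of_nat n * of_nat (maj_count lam r) = ?f + (\<Sum>l | l dvd n \<and> l \<noteq> 1. ?X l)"
    using maj_count_expansion[of r] assms(1) unfolding n split
    by (simp add: ramanujan_sum_1 specht_degree_def n)
  moreover have "(\<Sum>l | l dvd n \<and> l \<noteq> 1. ?X l / ?f) = (\<Sum>l | l dvd n \<and> l \<noteq> 1. ?X l) / ?f"
    by (simp only: sum_divide_distrib)
  ultimately show ?thesis
    using specht_degree_nonzero assms(1) by (simp add: field_simps)
qed

end
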